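(* Let $p$ be a prime, let $n\ge 2$ be an integer, let $(X,\le)$ be a finite nonempty totally ordered set, and let $S$ be the free profinite group on the basis $X$. Let $w,w'$ be Lyndon words of length $\le n$ in the alphabet $X$ which are not permutations of one another. Then $$(\sigma_{w,n},\alpha_{w',n})_n=0,$$ where $(\cdot,\cdot)_n\colon S^{(n,p)}\times H^2(S/S^{(n,p)},\mathbb{F}_p)\to\mathbb{F}_p$ is the transgression pairing, and $\sigma_{w,n}\in S^{(n,p)}$, $\alpha_{w',n}\in H^2(S/S^{(n,p)},\mathbb{F}_p)$ are the elements defined in the context.
   Context: Lower $p$-central filtration. For a profinite group $G$: $G^{(1,p)}=G$ and $G^{(n+1,p)}=(G^{(n,p)})^p[G,G^{(n,p)}]$, i.e. the closed subgroup generated by all $\tau^p$ and $[\sigma,\tau]=\sigma^{-1}\tau^{-1}\sigma\tau$ with $\sigma\in G$, $\tau\in G^{(n,p)}$. Words. $X^*$ is the free monoid on $X$ (words under concatenation), and $|w|$ is the length of $w$. A nonempty word is Lyndon if it is strictly smaller, in the lexicographic order induced by $\le$, than all its proper (nonempty) suffixes. If $w$ is Lyndon with $|w|\ge2$, its standard factorization is $w=uv$ where $v$ is the longest proper suffix of $w$ which is Lyndon; then $u$ is also Lyndon. Two words are permutations of one another if each letter occurs in both the same number of times. Elements $\sigma_{w,n}$. For a Lyndon word $w$ define $\tau_w\in S$ recursively: $\tau_{(x)}=x$ for $x\in X$, and $\tau_w=[\tau_u,\tau_v]=\tau_u^{-1}\tau_v^{-1}\tau_u\tau_v$ if $|w|\ge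 2$ has standard factorization $w=uv$. For $|w|=s\le n$ put $\sigma_{w,n}=\tau_w^{p^{n-s}}$; it lies in $S^{(n,p)}$. Magnus coefficients. For a profinite commutative unital ring $R$, $R\langle\langle X\rangle\rangle$ is the algebra of formal power series in the non-commuting variables $X$ over $R$ (words are viewed as monomials), and $\mathrm{Mag}_R\colon S\to R\langle\langle X\rangle\rangle^{\times}$ is the continuous homomorphism with $\mathrm{Mag}_R(x)=1+x$ for $x\in X$. Write $\epsilon_{w,R}(\sigma)$ for the coefficient of the word $w$ in $\mathrm{Mag}_R(\sigma)$. Elements $\alpha_{w,n}$. Let $w=(a_1\cdots a_s)$ be a word with $1\le s\le n$ and let $R=\mathbb{Z}/p^{n-s+1}$. Let $\mathbb{U}_s(R)$ be the group of unipotent upper triangular $(s+1)\times(s+1)$ matrices over $R$. The map $\rho_w\colon S\to\mathbb{U}_s(R)$, $\sigma\mapsto[\epsilon_{(a_i\cdots a_{j-1}),R}(\sigma)]_{1\le i\le j\le s+1}$, is a continuous homomorphism. The subgroup $\mathbb{U}_s(R)^{(n,p)}$ is central and consists of all matrices $I+ap^{n-s}E_{1,s+1}$, $a\in\mathbb{Z}$; identify it with $\mathbb{F}_p$ via $I+ap^{n-s}E_{1,s+1}\leftrightarrow a \bmod p$. Put $\overline{\mathbb{U}}_s(R)=\mathbb{U}_s(R)/\mathbb{U}_s(R)^{(n,p)}$ and let $\omega_{s,n}\in H^2(\overline{\mathbb{U}}_s(R),\mathbb{F}_p)$ be the class of the central extension $0\to\mathbb{F}_p\to\mathbb{U}_s(R)\to\overline{\mathbb{U}}_s(R)\to1$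 (represented, for a set-theoretic section $\theta$, by the cocycle $(g,h)\mapsto \theta(g)\theta(h)\theta(gh)^{-1}$). The map $\rho_w$ induces $\bar\rho_w\colon S/S^{(n,p)}\to\overline{\mathbb{U}}_s(R)$, and $\alpha_{w,n}=\bar\rho_w^{\,*}\omega_{s,n}\in H^2(S/S^{(n,p)},\mathbb{F}_p)$. Transgression pairing. For $n\ge2$ the transgression map $\mathrm{trg}\colon H^1(S^{(n,p)},\mathbb{F}_p)^S\to H^2(S/S^{(n,p)},\mathbb{F}_p)$ in the five-term exact sequence of $S^{(n,p)}\trianglelefteq S$ (trivial coefficients) is an isomorphism. Convention: $\mathrm{trg}(\psi)$ is the class of the cocycle on $S/S^{(n,p)}$ induced by the coboundary $(g,h)\mapsto y(h)-y(gh)+y(g)$, for a suitable continuous map $y\colon S\to\mathbb{F}_p$ extending $\psi$ for which this coboundary depends only on cosets modulo $S^{(n,p)}$. Define $(\sigma,\alpha)_n=-(\mathrm{trg}^{-1}(\alpha))(\sigma)$ for $\sigma\in S^{(n,p)}$ and $\alpha\in H^2(S/S^{(n,p)},\mathbb{F}_p)$. *)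

theory Defs
  imports
    "HOL-Analysis.Analysis"
    "HOL-Algebra.Generated_Groups"
    "HOL-Number_Theory.Residues"
    "HOL-Library.Sublist"
    "HOL-Library.Multiset"
begin

definition topological_group :: "('a, 'b) monoid_scheme \<Rightarrow> 'a topology \<Rightarrow> bool" where
  "topological_group G T \<longleftrightarrow>
     group G \<and> topspace T = carrier G \<and>
     continuous_map (prod_topology T T) T (\<lambda>(x, y). x \<otimes>\<^bsub>G\<^esub> y) \<and>
     continuous_map T T (\<lambda>x. inv\<^bsub>G\<^esub> x)"

text \<open>
  Among compact Hausdorff groups, the last condition singles out the inverse limits of finite groups.
\<close>

definition profinite_group :: "('a, 'b) monoid_scheme \<Rightarrow> 'a topology \<Rightarrow> bool" where
  "profinite_group G T \<longleftrightarrow>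
     topological_group G T \<and> compact_space T \<and> Hausdorff_space T \<and>
     (\<forall>U. openin T U \<and> \<one>\<^bsub>G\<^esub> \<in> U \<longrightarrow> (\<exists>V. subgroup V G \<and> openin T V \<and> V \<subseteq> U))"

definition continuous_hom ::
  "('a, 'c) monoid_scheme \<Rightarrow> 'a topology \<Rightarrow> ('b, 'd) monoid_scheme \<Rightarrow> 'b topology \<Rightarrow> ('a \<Rightarrow> 'b) set"
  where
  "continuous_hom G T H T' =
     {\<kappa> \<in> extensional (carrier G). \<kappa> \<in> hom G H \<and> continuous_map T T' \<kappa>}"

text \<open>
  Free profinite groups on a \<^emph>\<open>finite\<close> set, with basis \<open>\<iota> ` X\<close>, by the universal property with
  respect to all profinite groups.  HOL cannot quantify over types inside a formula, so the test
  groups \<open>H\<close> live on one type of the cardinality of the continuum.  This loses nothing for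
  finite \<open>X\<close>: a map \<open>X \<rightarrow> H\<close> only sees a finitely generated closed subgroup of \<open>H\<close>, and
  every finitely generated profinite group has at most continuum many elements.
\<close>

definition free_profinite_group ::
  "('a, 'b) monoid_scheme \<Rightarrow> 'a topology \<Rightarrow> 'x set \<Rightarrow> ('x \<Rightarrow> 'a) \<Rightarrow> bool" where
  "free_profinite_group S T X \<iota> \<longleftrightarrow>
     profinite_group S T \<and> \<iota> \<in> X \<rightarrow> carrier S \<and>
     (\<forall>(H :: (nat \<Rightarrow> nat) monoid) T' f.
        profinite_group H T' \<and> f \<in> X \<rightarrow> carrier H \<longrightarrow>
        (\<exists>!\<kappa>. \<kappa> \<in> continuous_hom S T H T' \<and> (\<forall>x\<in>X. \<kappa> (\<iota> x) = f x)))"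

definition commutator :: "('a, 'b) monoid_scheme \<Rightarrow> 'a \<Rightarrow> 'a \<Rightarrow> 'a" where
  "commutator G \<sigma> \<tau> = inv\<^bsub>G\<^esub> \<sigma> \<otimes>\<^bsub>G\<^esub> inv\<^bsub>G\<^esub> \<tau> \<otimes>\<^bsub>G\<^esub> \<sigma> \<otimes>\<^bsub>G\<^esub> \<tau>"

text \<open>The filtration is indexed from 1; the value at 0 is a dummy.\<close>

fun lower_p_central :: "nat \<Rightarrow> ('a, 'b) monoid_scheme \<Rightarrow> 'a topology \<Rightarrow> nat \<Rightarrow> 'a set" where
  "lower_p_central p G T 0 = carrier G"
| "lower_p_central p G T (Suc 0) = carrier G"
| "lower_p_central p G T (Suc (Suc n)) =
     T closure_of (generate G
       ({\<tau> [^]\<^bsub>G\<^esub> p | \<tau>. \<tau> \<in> lower_p_central p G T (Suc n)} \<union>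
        {commutator G \<sigma> \<tau> | \<sigma> \<tau>. \<sigma> \<in> carrier G \<and> \<tau> \<in> lower_p_central p G T (Suc n)}))"

definition quotient_topology :: "('a, 'b) monoid_scheme \<Rightarrow> 'a topology \<Rightarrow> 'a set \<Rightarrow> 'a set topology"
  where
  "quotient_topology G T N =
     topology (\<lambda>U. U \<subseteq> carrier (G Mod N) \<and> openin T {g \<in> carrier G. N #>\<^bsub>G\<^esub> g \<in> U})"

lemma openin_quotient_topology:
  "openin (quotient_topology G T N) U \<longleftrightarrow>
     U \<subseteq> carrier (G Mod N) \<and> openin T {g \<in> carrier G. N #>\<^bsub>G\<^esub> g \<in> U}"
proof -
  let ?pre = "\<lambda>U. {g \<in> carrier G. N #>\<^bsub>G\<^esub> g \<in> U}"
  have "istopology (\<lambda>U. U \<subseteq> carrier (G Mod N) \<and> openin T (?pre U))"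
    unfolding istopology_def
  proof (intro conjI allI impI)
    fix U V
    assume *: "U \<subseteq> carrier (G Mod N) \<and> openin T (?pre U)" "V \<subseteq> carrier (G Mod N) \<and> openin T (?pre V)"
    have "?pre (U \<inter> V) = ?pre U \<inter> ?pre V" by auto
    with * show "openin T (?pre (U \<inter> V))" by (simp only: openin_Int)
    from * show "U \<inter> V \<subseteq> carrier (G Mod N)" by auto
  next
    fix \<K> assume *: "\<forall>K\<in>\<K>. K \<subseteq> carrier (G Mod N) \<and> openin T (?pre K)"
    have "?pre (\<Union>\<K>) = (\<Union>K\<in>\<K>. ?pre K)" by auto
    moreover have "openin T (\<Union>K\<in>\<K>. ?pre K)" using * by (intro openin_Union) auto
    ultimately show "openin T (?pre (\<Union>\<K>))" by simp
    from * show "\<Union>\<K> \<subseteq> carrier (G Mod N)" by auto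
  qed
  then show ?thesis
    unfolding quotient_topology_def by (simp add: topology_inverse')
qed

abbreviation Fp :: "nat \<Rightarrow> int ring" where
  "Fp p \<equiv> residue_ring (int p)"

definition coboundary :: "('r, 'c) ring_scheme \<Rightarrow> ('a, 'b) monoid_scheme \<Rightarrow> ('a \<Rightarrow> 'r) \<Rightarrow> 'a \<times> 'a \<Rightarrow> 'r"
  where
  "coboundary R G y =
     (\<lambda>(g, h) \<in> carrier G \<times> carrier G. y h \<ominus>\<^bsub>R\<^esub> y (g \<otimes>\<^bsub>G\<^esub> h) \<oplus>\<^bsub>R\<^esub> y g)"

definition cocycles2 ::
  "('r, 'c) ring_scheme \<Rightarrow> ('a, 'b) monoid_scheme \<Rightarrow> 'a topology \<Rightarrow> ('a \<times> 'a \<Rightarrow> 'r) set" where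
  "cocycles2 R G T =
     {c \<in> extensional (carrier G \<times> carrier G).
        continuous_map (prod_topology T T) (discrete_topology (carrier R)) c \<and>
        (\<forall>g\<in>carrier G. \<forall>h\<in>carrier G. \<forall>k\<in>carrier G.
           c (h, k) \<ominus>\<^bsub>R\<^esub> c (g \<otimes>\<^bsub>G\<^esub> h, k) \<oplus>\<^bsub>R\<^esub> c (g, h \<otimes>\<^bsub>G\<^esub> k) \<ominus>\<^bsub>R\<^esub> c (g, h) = \<zero>\<^bsub>R\<^esub>)}"

definition coboundaries2 ::
  "('r, 'c) ring_scheme \<Rightarrow> ('a, 'b) monoid_scheme \<Rightarrow> 'a topology \<Rightarrow> ('a \<times> 'a \<Rightarrow> 'r) set" where
  "coboundaries2 R G T =
     {coboundary R G y | y. continuous_map T (discrete_topology (carrier R)) y}"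

definition cocycle_group ::
  "('r, 'c) ring_scheme \<Rightarrow> ('a, 'b) monoid_scheme \<Rightarrow> 'a topology \<Rightarrow> ('a \<times> 'a \<Rightarrow> 'r) monoid" where
  "cocycle_group R G T =
     \<lparr>carrier = cocycles2 R G T,
      monoid.mult = (\<lambda>c d. \<lambda>x \<in> carrier G \<times> carrier G. c x \<oplus>\<^bsub>R\<^esub> d x),
      one = (\<lambda>x \<in> carrier G \<times> carrier G. \<zero>\<^bsub>R\<^esub>)\<rparr>"

definition H2 ::
  "('r, 'c) ring_scheme \<Rightarrow> ('a, 'b) monoid_scheme \<Rightarrow> 'a topology \<Rightarrow> ('a \<times> 'a \<Rightarrow> 'r) set monoid" where
  "H2 R G T = cocycle_group R G T Mod coboundaries2 R G T"

definition H2_class ::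
  "('r, 'c) ring_scheme \<Rightarrow> ('a, 'b) monoid_scheme \<Rightarrow> 'a topology \<Rightarrow> ('a \<times> 'a \<Rightarrow> 'r) \<Rightarrow> ('a \<times> 'a \<Rightarrow> 'r) set"
  where
  "H2_class R G T c = coboundaries2 R G T #>\<^bsub>cocycle_group R G T\<^esub> c"

text \<open>
  The pullback along a continuous homomorphism from \<open>(G, T)\<close>.  The union is over the
  representatives of a class, all of which contribute the same class.
\<close>

definition H2_pullback ::
  "('r, 'c) ring_scheme \<Rightarrow> ('a, 'b) monoid_scheme \<Rightarrow> 'a topology \<Rightarrow> ('a \<Rightarrow> 'd) \<Rightarrow>
   ('d \<times> 'd \<Rightarrow> 'r) set \<Rightarrow> ('a \<times> 'a \<Rightarrow> 'r) set" where
  "H2_pullback R G T \<kappa> \<alpha> =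
     (\<Union>c\<in>\<alpha>. H2_class R G T (\<lambda>(g, h) \<in> carrier G \<times> carrier G. c (\<kappa> g, \<kappa> h)))"

text \<open>
  \<open>H\<^sup>1(N, R)\<^sup>G\<close> for a normal subgroup \<open>N\<close> of \<open>G\<close>: with trivial coefficients, \<open>H\<^sup>1\<close> consists of the
  continuous homomorphisms.
\<close>

definition H1_invariants ::
  "('r, 'c) ring_scheme \<Rightarrow> ('a, 'b) monoid_scheme \<Rightarrow> 'a topology \<Rightarrow> 'a set \<Rightarrow> ('a \<Rightarrow> 'r) set" where
  "H1_invariants R G T N =
     {\<psi> \<in> continuous_hom (G\<lparr>carrier := N\<rparr>) (subtopology T N)
            (add_monoid R) (discrete_topology (carrier R)).
        \<forall>\<sigma>\<in>carrier G. \<forall>\<tau>\<in>N. \<psi> (inv\<^bsub>G\<^esub> \<sigma> \<otimes>\<^bsub>G\<^esub> \<tau> \<otimes>\<^bsub>G\<^esub> \<sigma>) = \<psi> \<tau>}"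

definition transgression ::
  "('r, 'c) ring_scheme \<Rightarrow> ('a, 'b) monoid_scheme \<Rightarrow> 'a topology \<Rightarrow> 'a set \<Rightarrow>
   ('a \<Rightarrow> 'r) \<Rightarrow> ('a set \<times> 'a set \<Rightarrow> 'r) set" where
  "transgression R G T N \<psi> =
     (THE \<alpha>. \<alpha> \<in> carrier (H2 R (G Mod N) (quotient_topology G T N)) \<and>
        (\<exists>y. continuous_map T (discrete_topology (carrier R)) y \<and> (\<forall>\<tau>\<in>N. y \<tau> = \<psi> \<tau>) \<and>
           (\<exists>c\<in>\<alpha>. \<forall>g\<in>carrier G. \<forall>h\<in>carrier G.
              c (N #>\<^bsub>G\<^esub> g, N #>\<^bsub>G\<^esub> h) = coboundary R G y (g, h))))"

definition transgression_pairing ::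
  "nat \<Rightarrow> ('a, 'b) monoid_scheme \<Rightarrow> 'a topology \<Rightarrow> nat \<Rightarrow> 'a \<Rightarrow> ('a set \<times> 'a set \<Rightarrow> int) set \<Rightarrow> int"
  where
  "transgression_pairing p S T n \<sigma> \<alpha> =
     (let N = lower_p_central p S T n
      in \<ominus>\<^bsub>Fp p\<^esub> (the_inv_into (H1_invariants (Fp p) S T N) (transgression (Fp p) S T N) \<alpha> \<sigma>))"

definition lyndon :: "'x::linorder list \<Rightarrow> bool" where
  "lyndon w \<longleftrightarrow>
     w \<noteq> [] \<and> (\<forall>v. v \<noteq> [] \<and> strict_suffix v w \<longrightarrow> (w, v) \<in> lexord {(a, b). a < b})"

text \<open>The standard factorization of \<open>w\<close> is \<open>w = std_left w @ std_right w\<close>.\<close>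

definition std_right :: "'x::linorder list \<Rightarrow> 'x list" where
  "std_right w = (ARG_MAX length v. strict_suffix v w \<and> lyndon v)"

definition std_left :: "'x::linorder list \<Rightarrow> 'x list" where
  "std_left w = take (length w - length (std_right w)) w"

lemma std_right_lyndon_suffix:
  fixes w :: "'x::linorder list"
  assumes "2 \<le> length w"
  shows "strict_suffix (std_right w) w \<and> lyndon (std_right w)"
proof -
  have "w \<noteq> []" "w \<noteq> [last w]" using assms by (auto simp: length_Suc_conv dest: arg_cong[of _ _ length])
  moreover have "suffix [last w] w"
    using \<open>w \<noteq> []\<close> unfolding suffix_def by (metis append_butlast_last_id)
  ultimately have "strict_suffix [last w] w" by (auto simp: strict_suffix_def)
  moreover have "lyndon [last w]"
    by (auto simp: lyndon_def strict_suffix_def suffix_def Cons_eq_append_conv)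
  ultimately have ex: "strict_suffix [last w] w \<and> lyndon [last w]" by blast
  have "\<forall>v. strict_suffix v w \<and> lyndon v \<longrightarrow> length v < Suc (length w)"
    by (auto simp: strict_suffix_def suffix_def)
  from arg_max_natI[where P = "\<lambda>v. strict_suffix v w \<and> lyndon v", OF ex this]
  show ?thesis unfolding std_right_def .
qed

lemma length_std_factors:
  assumes "2 \<le> length w"
  shows "length (std_left w) < length w" "length (std_right w) < length w"
proof -
  obtain zs where zs: "w = zs @ std_right w" "zs \<noteq> []" "std_right w \<noteq> []"
    using std_right_lyndon_suffix[OF assms]
    unfolding lyndon_def strict_suffix_def suffix_def by fastforce
  from zs(1) have "length w = length zs + length (std_right w)"
    by (metis length_append)
  with zs(2,3) show "length (std_left w) < length w" "length (std_right w) < length w"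
    by (simp_all add: std_left_def)
qed

text \<open>The value at the empty word is a dummy.\<close>

function lyndon_commutator :: "('a, 'b) monoid_scheme \<Rightarrow> ('x::linorder \<Rightarrow> 'a) \<Rightarrow> 'x list \<Rightarrow> 'a" where
  "lyndon_commutator S \<iota> w =
     (if w = [] then \<one>\<^bsub>S\<^esub>
      else if length w = 1 then \<iota> (hd w)
      else commutator S (lyndon_commutator S \<iota> (std_left w)) (lyndon_commutator S \<iota> (std_right w)))"
  by pat_completeness auto
termination
proof (relation "Wellfounded.measure (\<lambda>(S, \<iota>, w). length w)", goal_cases)
  case (2 S \<iota> w)
  then have "2 \<le> length w" by (cases w; cases "tl w") auto
  from length_std_factors[OF this] show ?case by simp
next
  case (3 S \<iota> w)
  then have "2 \<le> length w" by (cases w; cases "tl w") auto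
  from length_std_factors[OF this] show ?case by simp
qed simp

declare lyndon_commutator.simps [simp del]

definition sigma_element ::
  "nat \<Rightarrow> ('a, 'b) monoid_scheme \<Rightarrow> ('x::linorder \<Rightarrow> 'a) \<Rightarrow> 'x list \<Rightarrow> nat \<Rightarrow> 'a" where
  "sigma_element p S \<iota> w n = lyndon_commutator S \<iota> w [^]\<^bsub>S\<^esub> (p ^ (n - length w))"

text \<open>A formal power series is the family of its coefficients, indexed by the words over \<open>X\<close>.\<close>

definition nc_power_series :: "('r, 'c) ring_scheme \<Rightarrow> 'x set \<Rightarrow> ('x list \<Rightarrow> 'r) ring" where
  "nc_power_series R X =
     \<lparr>carrier = lists X \<rightarrow>\<^sub>E carrier R,
      monoid.mult = (\<lambda>f g. \<lambda>w \<in> lists X.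
        \<Oplus>\<^bsub>R\<^esub>i\<in>{..length w}. f (take i w) \<otimes>\<^bsub>R\<^esub> g (drop i w)),
      one = (\<lambda>w \<in> lists X. if w = [] then \<one>\<^bsub>R\<^esub> else \<zero>\<^bsub>R\<^esub>),
      zero = (\<lambda>w \<in> lists X. \<zero>\<^bsub>R\<^esub>),
      add = (\<lambda>f g. \<lambda>w \<in> lists X. f w \<oplus>\<^bsub>R\<^esub> g w)\<rparr>"

definition nc_var :: "('r, 'c) ring_scheme \<Rightarrow> 'x set \<Rightarrow> 'x \<Rightarrow> 'x list \<Rightarrow> 'r" where
  "nc_var R X x = (\<lambda>w \<in> lists X. if w = [x] then \<one>\<^bsub>R\<^esub> else \<zero>\<^bsub>R\<^esub>)"

text \<open>
  Only finite coefficient rings \<open>R\<close> are needed, so \<open>R\<close> carries the discrete topology.  The subspace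
  topology makes the units a topological group, inversion of power series being continuous.
\<close>

definition nc_units_topology :: "('r, 'c) ring_scheme \<Rightarrow> 'x set \<Rightarrow> ('x list \<Rightarrow> 'r) topology" where
  "nc_units_topology R X =
     subtopology (product_topology (\<lambda>_. discrete_topology (carrier R)) (lists X))
       (Units (nc_power_series R X))"

definition magnus ::
  "('r, 'c) ring_scheme \<Rightarrow> ('a, 'b) monoid_scheme \<Rightarrow> 'a topology \<Rightarrow> 'x set \<Rightarrow> ('x \<Rightarrow> 'a) \<Rightarrow>
   'a \<Rightarrow> 'x list \<Rightarrow> 'r" where
  "magnus R S T X \<iota> =
     (THE \<kappa>. \<kappa> \<in> continuous_hom S T (units_of (nc_power_series R X)) (nc_units_topology R X) \<and>
        (\<forall>x\<in>X. \<kappa> (\<iota> x) = \<one>\<^bsub>nc_power_series R X\<^esub> \<oplus>\<^bsub>nc_power_series R X\<^esub> nc_var R X x))"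

definition magnus_coeff ::
  "('r, 'c) ring_scheme \<Rightarrow> ('a, 'b) monoid_scheme \<Rightarrow> 'a topology \<Rightarrow> 'x set \<Rightarrow> ('x \<Rightarrow> 'a) \<Rightarrow>
   'x list \<Rightarrow> 'a \<Rightarrow> 'r" where
  "magnus_coeff R S T X \<iota> w \<sigma> = magnus R S T X \<iota> \<sigma> w"

text \<open>Matrices have size \<open>s + 1\<close>, with rows and columns numbered from 1.\<close>

definition unitriangular_group :: "('r, 'c) ring_scheme \<Rightarrow> nat \<Rightarrow> (nat \<times> nat \<Rightarrow> 'r) monoid" where
  "unitriangular_group R s =
     \<lparr>carrier = {A \<in> {1..s+1} \<times> {1..s+1} \<rightarrow>\<^sub>E carrier R.
        (\<forall>i\<in>{1..s+1}. A (i, i) = \<one>\<^bsub>R\<^esub>) \<and>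
        (\<forall>i\<in>{1..s+1}. \<forall>j\<in>{1..s+1}. j < i \<longrightarrow> A (i, j) = \<zero>\<^bsub>R\<^esub>)},
      monoid.mult = (\<lambda>A B. \<lambda>(i, j) \<in> {1..s+1} \<times> {1..s+1}.
        \<Oplus>\<^bsub>R\<^esub>k\<in>{1..s+1}. A (i, k) \<otimes>\<^bsub>R\<^esub> B (k, j)),
      one = (\<lambda>(i, j) \<in> {1..s+1} \<times> {1..s+1}. if i = j then \<one>\<^bsub>R\<^esub> else \<zero>\<^bsub>R\<^esub>)\<rparr>"

text \<open>With \<open>w = (a\<^sub>1 \<dots> a\<^sub>s)\<close>, the word \<open>(a\<^sub>i \<dots> a\<^sub>j\<^sub>-\<^sub>1)\<close> is \<open>take (j - i) (drop (i - 1) w)\<close>.\<close>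

definition magnus_rep ::
  "('r, 'c) ring_scheme \<Rightarrow> ('a, 'b) monoid_scheme \<Rightarrow> 'a topology \<Rightarrow> 'x set \<Rightarrow> ('x \<Rightarrow> 'a) \<Rightarrow>
   'x list \<Rightarrow> 'a \<Rightarrow> nat \<times> nat \<Rightarrow> 'r" where
  "magnus_rep R S T X \<iota> w \<sigma> =
     (\<lambda>(i, j) \<in> {1..length w + 1} \<times> {1..length w + 1}.
        if i \<le> j then magnus_coeff R S T X \<iota> (take (j - i) (drop (i - 1) w)) \<sigma> else \<zero>\<^bsub>R\<^esub>)"

abbreviation coeff_ring :: "nat \<Rightarrow> nat \<Rightarrow> nat \<Rightarrow> int ring" where
  "coeff_ring p n s \<equiv> residue_ring (int (p ^ (n - s + 1)))"

abbreviation U_group :: "nat \<Rightarrow> nat \<Rightarrow> nat \<Rightarrow> (nat \<times> nat \<Rightarrow> int) monoid" where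
  "U_group p n s \<equiv> unitriangular_group (coeff_ring p n s) s"

abbreviation U_topology :: "nat \<Rightarrow> nat \<Rightarrow> nat \<Rightarrow> (nat \<times> nat \<Rightarrow> int) topology" where
  "U_topology p n s \<equiv> discrete_topology (carrier (U_group p n s))"

abbreviation U_centre :: "nat \<Rightarrow> nat \<Rightarrow> nat \<Rightarrow> (nat \<times> nat \<Rightarrow> int) set" where
  "U_centre p n s \<equiv> lower_p_central p (U_group p n s) (U_topology p n s) n"

abbreviation U_bar :: "nat \<Rightarrow> nat \<Rightarrow> nat \<Rightarrow> (nat \<times> nat \<Rightarrow> int) set monoid" where
  "U_bar p n s \<equiv> U_group p n s Mod U_centre p n s"

abbreviation U_bar_topology :: "nat \<Rightarrow> nat \<Rightarrow> nat \<Rightarrow> (nat \<times> nat \<Rightarrow> int) set topology" where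
  "U_bar_topology p n s \<equiv> quotient_topology (U_group p n s) (U_topology p n s) (U_centre p n s)"

text \<open>The matrix \<open>I + a p\<^sup>n\<^sup>-\<^sup>s E\<^sub>1\<^sub>,\<^sub>s\<^sub>+\<^sub>1\<close>, and the identification of \<open>U_centre\<close> with \<open>Fp\<close>.\<close>

definition corner_matrix :: "nat \<Rightarrow> nat \<Rightarrow> nat \<Rightarrow> int \<Rightarrow> nat \<times> nat \<Rightarrow> int" where
  "corner_matrix p n s a =
     (\<lambda>(i, j) \<in> {1..s+1} \<times> {1..s+1}.
        if i = j then 1
        else if i = 1 \<and> j = s + 1 then a * int p ^ (n - s) mod int p ^ (n - s + 1)
        else 0)"

definition centre_to_Fp :: "nat \<Rightarrow> nat \<Rightarrow> nat \<Rightarrow> (nat \<times> nat \<Rightarrow> int) \<Rightarrow> int" where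
  "centre_to_Fp p n s = the_inv_into (carrier (Fp p)) (corner_matrix p n s)"

text \<open>
  The class of the extension of \<open>U_bar\<close> by \<open>Fp\<close>.  It does not depend on the section, so an arbitrary
  choice of coset representatives is used.
\<close>

definition omega :: "nat \<Rightarrow> nat \<Rightarrow> nat \<Rightarrow> ((nat \<times> nat \<Rightarrow> int) set \<times> (nat \<times> nat \<Rightarrow> int) set \<Rightarrow> int) set" where
  "omega p n s =
     (let U = U_group p n s; V = U_bar p n s; \<theta> = (\<lambda>C. SOME A. A \<in> C)
      in H2_class (Fp p) V (U_bar_topology p n s)
           (\<lambda>(g, h) \<in> carrier V \<times> carrier V.
              centre_to_Fp p n s (\<theta> g \<otimes>\<^bsub>U\<^esub> \<theta> h \<otimes>\<^bsub>U\<^esub> inv\<^bsub>U\<^esub> \<theta> (g \<otimes>\<^bsub>V\<^esub> h))))"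

text \<open>The union is over the elements of a coset, all of which have the same image.\<close>

definition magnus_rep_bar ::
  "nat \<Rightarrow> ('a, 'b) monoid_scheme \<Rightarrow> 'a topology \<Rightarrow> 'x set \<Rightarrow> ('x \<Rightarrow> 'a) \<Rightarrow> 'x list \<Rightarrow> nat \<Rightarrow>
   'a set \<Rightarrow> (nat \<times> nat \<Rightarrow> int) set" where
  "magnus_rep_bar p S T X \<iota> w n C =
     (let s = length w
      in \<Union>\<sigma>\<in>C. U_centre p n s #>\<^bsub>U_group p n s\<^esub> magnus_rep (coeff_ring p n s) S T X \<iota> w \<sigma>)"

definition alpha_class ::
  "nat \<Rightarrow> ('a, 'b) monoid_scheme \<Rightarrow> 'a topology \<Rightarrow> 'x set \<Rightarrow> ('x \<Rightarrow> 'a) \<Rightarrow> 'x list \<Rightarrow> nat \<Rightarrow>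
   ('a set \<times> 'a set \<Rightarrow> int) set" where
  "alpha_class p S T X \<iota> w n =
     (let N = lower_p_central p S T n
      in H2_pullback (Fp p) (S Mod N) (quotient_topology S T N)
           (magnus_rep_bar p S T X \<iota> w n) (omega p n (length w)))"

end

theory Submission
  imports Defs "HOL-Algebra.Weak_Morphisms"
begin

text \<open>
  Let \<open>N = S^(n,p)\<close>, and let \<open>\<rho>\<close> be the representation belonging to \<open>w'\<close>.  Pulled back to \<open>S\<close>, the
  central extension defining \<open>\<alpha>\<close> is trivialized by \<open>\<rho>\<close> itself, so \<open>\<alpha>\<close> is the transgression of
  \<open>- \<rho>\<close> restricted to \<open>N\<close>.  The transgression is injective, because continuous homomorphisms
  \<open>S \<rightarrow> \<int>/p\<close> vanish on \<open>N\<close>.  Hence \<open>(\<sigma>, \<alpha>)\<close> is given by the corner entry of \<open>\<rho> \<sigma>\<close>, and it remains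
  to see that the coefficient of \<open>w'\<close> in the Magnus series of \<open>\<sigma>\<^sub>w\<close> vanishes modulo \<open>p^(n - |w'| + 1)\<close>.

  If \<open>|w| \<ge> 2\<close>, the series of \<open>\<tau>\<^sub>w\<close> is \<open>1\<close> plus a combination of permutations of \<open>w\<close> plus terms of
  degree \<open>> |w|\<close>, and raising it to the power \<open>p^r\<close> makes the terms of degree \<open>|w| + e\<close>, \<open>e > 0\<close>,
  divisible by \<open>p^(r - e + 1)\<close>; now take \<open>r = n - |w|\<close>.  If \<open>w = (x)\<close>, only powers of \<open>x\<close> occur, and
  these are not Lyndon words, except \<open>x\<close> itself.
\<close>

section \<open>The lower p-central filtration\<close>

text \<open>Two objects are given only by description. The Magnus homomorphism has values in units
  of power series, not in a test group of the universal property, so it is approached through finite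
  groups: each coefficient is the corner entry of a homomorphism into unitriangular matrices, and
  products of series become products of matrices. The pairing inverts the transgression, which calls
  for an explicit preimage and injectivity. It also presupposes that \<open>\<sigma>\<close> lies in
  \<open>N\<close>; the definition of the filtration only controls commutators with arbitrary
  elements of S, so the Hall-Witt identity enters.

  Congruences for single matrix entries carry all estimates, for U^(n,p) as well as for commutators
  and p-th powers. The exponent r - e + 1 is tuned to the modulus: r = n - |w| and e = |w'| - |w|
  give n - |w'| + 1. It survives a p-th power because a product of two nonconstant terms has degree
  at least 2|w|, so that e exceeds that of either factor by 2 or more. For |w| = 1 this fails: the
  coefficient of x^2 in (1 + x)^(2^r) is divisible by 2^(r-1) only. Hence the separate case of
  single letters.\<close>

no_notation eq_closure_of ("closure'_of\<index>")

lemma topological_group_mult: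
  assumes "topological_group G T" "continuous_map Z T f" "continuous_map Z T g"
  shows "continuous_map Z T (\<lambda>x. f x \<otimes>\<^bsub>G\<^esub> g x)"
proof -
  have "continuous_map Z (prod_topology T T) (\<lambda>x. (f x, g x))"
    using assms by (simp add: continuous_map_paired)
  moreover have "continuous_map (prod_topology T T) T (\<lambda>(x, y). x \<otimes>\<^bsub>G\<^esub> y)"
    using assms(1) unfolding topological_group_def by blast
  ultimately have "continuous_map Z T ((\<lambda>(x, y). x \<otimes>\<^bsub>G\<^esub> y) \<circ> (\<lambda>x. (f x, g x)))"
    by (rule continuous_map_compose)
  then show ?thesis by (simp add: o_def)
qed

lemma topological_group_translate:
  assumes "topological_group G T" "a \<in> carrier G" "b \<in> carrier G"
  shows "continuous_map T T (\<lambda>x. a \<otimes>\<^bsub>G\<^esub> x \<otimes>\<^bsub>G\<^esub> b)"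
  using assms
  by (intro topological_group_mult[OF assms(1)]) (auto simp: topological_group_def)

context group
begin

lemma inv_cancel_left [simp]:
  "x \<in> carrier G \<Longrightarrow> y \<in> carrier G \<Longrightarrow> inv x \<otimes> (x \<otimes> y) = y"
  "x \<in> carrier G \<Longrightarrow> y \<in> carrier G \<Longrightarrow> x \<otimes> (inv x \<otimes> y) = y"
  by (simp_all flip: m_assoc)

lemma commutator_closed [simp]:
  "x \<in> carrier G \<Longrightarrow> y \<in> carrier G \<Longrightarrow> commutator G x y \<in> carrier G"
  by (simp add: commutator_def)

lemma conj_pow:
  "x \<in> carrier G \<Longrightarrow> y \<in> carrier G \<Longrightarrow> x \<otimes> (y [^] (k::nat)) \<otimes> inv x = (x \<otimes> y \<otimes> inv x) [^] k"
proof (induction k)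
  case (Suc k)
  then have IH: "x \<otimes> (y [^] k) \<otimes> inv x = (x \<otimes> y \<otimes> inv x) [^] k" by blast
  from Suc.prems have "x \<otimes> (y [^] Suc k) \<otimes> inv x = (x \<otimes> (y [^] k) \<otimes> inv x) \<otimes> (x \<otimes> y \<otimes> inv x)"
    by (simp add: m_assoc)
  then show ?case using IH by simp
qed simp

lemma conj_commutator:
  "x \<in> carrier G \<Longrightarrow> y \<in> carrier G \<Longrightarrow> z \<in> carrier G \<Longrightarrow>
   x \<otimes> commutator G y z \<otimes> inv x = commutator G (x \<otimes> y \<otimes> inv x) (x \<otimes> z \<otimes> inv x)"
  by (simp add: commutator_def m_assoc inv_mult_group)

end

text \<open>Two-sided translation is a homeomorphism: the image is the preimage under translation by
  the inverses.\<close>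

lemma openin_translate:
  fixes G (structure)
  assumes T: "topological_group G T" and a: "a \<in> carrier G" and b: "b \<in> carrier G"
    and U: "openin T U"
  shows "openin T ((\<lambda>x. a \<otimes>\<^bsub>G\<^esub> x \<otimes>\<^bsub>G\<^esub> b) ` U)"
proof -
  interpret group G using T unfolding topological_group_def by blast
  have top: "topspace T = carrier G" using T unfolding topological_group_def by blast
  have U': "U \<subseteq> carrier G" using openin_subset[OF U] top by simp
  let ?f = "\<lambda>x. inv a \<otimes> x \<otimes> inv b"
  have "continuous_map T T ?f"
    by (rule topological_group_translate[OF T inv_closed[OF a] inv_closed[OF b]])
  then have "openin T {x \<in> topspace T. ?f x \<in> U}"
    by (rule openin_continuous_map_preimage[OF _ U])
  moreover have "{x \<in> topspace T. ?f x \<in> U} = (\<lambda>x. a \<otimes> x \<otimes> b) ` U"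
  proof (intro Set.set_eqI iffI)
    fix x assume x: "x \<in> {x \<in> topspace T. ?f x \<in> U}"
    then have "x \<in> carrier G" using top by blast
    then have "x = a \<otimes> ?f x \<otimes> b" using a b by (simp add: m_assoc)
    then show "x \<in> (\<lambda>x. a \<otimes> x \<otimes> b) ` U" using x by blast
  next
    fix x assume "x \<in> (\<lambda>x. a \<otimes> x \<otimes> b) ` U"
    then obtain u where u: "u \<in> U" and x: "x = a \<otimes> u \<otimes> b" by blast
    then have uC: "u \<in> carrier G" using U' by blast
    then have "?f x = u" using a b x by (simp add: m_assoc)
    moreover have "x \<in> carrier G" using x uC a b by simp
    ultimately show "x \<in> {x \<in> topspace T. ?f x \<in> U}" using u top by blast
  qed
  ultimately show ?thesis by (rule back_subst)
qed

text \<open>Continuity of inversion and multiplication pushes closures forward; for products, the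
  closure of \<open>H \<times> H\<close> is the product of the closures.\<close>

lemma subgroup_closure:
  fixes G (structure)
  assumes T: "topological_group G T" and H: "subgroup H G"
  shows "subgroup (T closure_of H) G"
proof -
  interpret group G using T unfolding topological_group_def by blast
  have top: "topspace T = carrier G" using T unfolding topological_group_def by blast
  have H': "H \<subseteq> carrier G" using H subgroup.subset by blast
  show ?thesis
  proof (rule subgroupI)
    show "T closure_of H \<subseteq> carrier G" using closure_of_subset_topspace[of T H] top by simp
    show "T closure_of H \<noteq> {}"
      using subgroup.one_closed[OF H] closure_of_subset[of H T] H' top by blast
  next
    fix a assume a: "a \<in> T closure_of H"
    have "continuous_map T T (m_inv G)" using T unfolding topological_group_def by blast
    then have "(m_inv G) ` (T closure_of H) \<subseteq> T closure_of ((m_inv G) ` H)"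
      by (rule continuous_map_image_closure_subset)
    moreover have "(m_inv G) ` H \<subseteq> H" using subgroup.m_inv_closed[OF H] by blast
    ultimately have "m_inv G ` (T closure_of H) \<subseteq> T closure_of H"
      by (meson closure_of_mono order_trans)
    then show "inv a \<in> T closure_of H" using a by blast
  next
    fix a b assume ab: "a \<in> T closure_of H" "b \<in> T closure_of H"
    have "continuous_map (prod_topology T T) T (\<lambda>(x, y). x \<otimes> y)"
      using T unfolding topological_group_def by blast
    then have "(\<lambda>(x, y). x \<otimes> y) ` (prod_topology T T closure_of (H \<times> H))
               \<subseteq> T closure_of ((\<lambda>(x, y). x \<otimes> y) ` (H \<times> H))"
      by (rule continuous_map_image_closure_subset)
    moreover have "(\<lambda>(x, y). x \<otimes> y) ` (H \<times> H) \<subseteq> H" using subgroup.m_closed[OF H] by auto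
    moreover have "(a, b) \<in> prod_topology T T closure_of (H \<times> H)"
      using ab by (simp add: closure_of_Times)
    ultimately have "(\<lambda>(x, y). x \<otimes> y) (a, b) \<in> T closure_of H"
      by (meson closure_of_mono image_subset_iff subset_iff)
    then show "a \<otimes> b \<in> T closure_of H" by simp
  qed
qed

lemma normal_closure:
  fixes G (structure)
  assumes T: "topological_group G T" and H: "H \<lhd> G"
  shows "(T closure_of H) \<lhd> G"
proof -
  interpret group G using T unfolding topological_group_def by blast
  show ?thesis
  proof (subst normal_inv_iff, intro conjI ballI)
    show "subgroup (T closure_of H) G"
      using subgroup_closure[OF T] H normal_imp_subgroup by blast
    fix x h assume x: "x \<in> carrier G" and h: "h \<in> T closure_of H"
    have "(\<lambda>h. x \<otimes> h \<otimes> inv x) ` (T closure_of H) \<subseteq> T closure_of ((\<lambda>h. x \<otimes> h \<otimes> inv x) ` H)"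
      using topological_group_translate[OF T] x by (intro continuous_map_image_closure_subset) auto
    moreover have "(\<lambda>h. x \<otimes> h \<otimes> inv x) ` H \<subseteq> H"
      using normal.inv_op_closed2[OF H] x by blast
    ultimately have "(\<lambda>h. x \<otimes> h \<otimes> inv x) ` (T closure_of H) \<subseteq> T closure_of H"
      by (meson closure_of_mono order_trans)
    then show "x \<otimes> h \<otimes> inv x \<in> T closure_of H" using h by blast
  qed
qed

text \<open>Conjugation commutes with powers and commutators and preserves the previous term, so it
  maps the set of generators into itself; taking closures keeps normality.\<close>

lemma lower_p_central_normal:
  "topological_group G T \<Longrightarrow> lower_p_central p G T n \<lhd> G"
proof (induction p G T n rule: lower_p_central.induct)
  case (1 p G T)
  then interpret group G unfolding topological_group_def by blast
  show ?case by (simp add: normal_invI subgroup_self)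
next
  case (2 p G T)
  then interpret group G unfolding topological_group_def by blast
  show ?case by (simp add: normal_invI subgroup_self)
next
  case (3 p G T n)
  then interpret group G unfolding topological_group_def by blast
  let ?N = "lower_p_central p G T (Suc n)"
  let ?A = "{\<tau> [^]\<^bsub>G\<^esub> p | \<tau>. \<tau> \<in> ?N} \<union> {commutator G \<sigma> \<tau> | \<sigma> \<tau>. \<sigma> \<in> carrier G \<and> \<tau> \<in> ?N}"
  have N: "?N \<lhd> G" by (rule "3.IH"[OF "3.prems"])
  then have sub: "?N \<subseteq> carrier G" using normal_imp_subgroup subgroup.subset by blast
  have "generate G ?A \<lhd> G"
  proof (rule normal_generateI)
    show "?A \<subseteq> carrier G" using sub by auto
    fix h g assume h: "h \<in> ?A" and g: "g \<in> carrier G"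
    from h consider \<tau> where "\<tau> \<in> ?N" "h = \<tau> [^]\<^bsub>G\<^esub> p"
      | \<sigma> \<tau> where "\<sigma> \<in> carrier G" "\<tau> \<in> ?N" "h = commutator G \<sigma> \<tau>" by blast
    then show "g \<otimes>\<^bsub>G\<^esub> h \<otimes>\<^bsub>G\<^esub> inv\<^bsub>G\<^esub> g \<in> ?A"
    proof cases
      case 1
      then have "g \<otimes>\<^bsub>G\<^esub> \<tau> \<otimes>\<^bsub>G\<^esub> inv\<^bsub>G\<^esub> g \<in> ?N" using normal.inv_op_closed2[OF N] g by blast
      moreover have "g \<otimes>\<^bsub>G\<^esub> h \<otimes>\<^bsub>G\<^esub> inv\<^bsub>G\<^esub> g = (g \<otimes>\<^bsub>G\<^esub> \<tau> \<otimes>\<^bsub>G\<^esub> inv\<^bsub>G\<^esub> g) [^]\<^bsub>G\<^esub> p"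
        using 1 g sub by (auto simp: conj_pow)
      ultimately show ?thesis by blast
    next
      case 2
      then have "g \<otimes>\<^bsub>G\<^esub> \<tau> \<otimes>\<^bsub>G\<^esub> inv\<^bsub>G\<^esub> g \<in> ?N" using normal.inv_op_closed2[OF N] g by blast
      moreover have "g \<otimes>\<^bsub>G\<^esub> \<sigma> \<otimes>\<^bsub>G\<^esub> inv\<^bsub>G\<^esub> g \<in> carrier G" using 2 g by simp
      moreover have "g \<otimes>\<^bsub>G\<^esub> h \<otimes>\<^bsub>G\<^esub> inv\<^bsub>G\<^esub> g = commutator G (g \<otimes>\<^bsub>G\<^esub> \<sigma> \<otimes>\<^bsub>G\<^esub> inv\<^bsub>G\<^esub> g) (g \<otimes>\<^bsub>G\<^esub> \<tau> \<otimes>\<^bsub>G\<^esub> inv\<^bsub>G\<^esub> g)"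
        using 2 g sub by (simp add: conj_commutator subset_iff)
      ultimately show ?thesis by blast
    qed
  qed
  then show ?case using normal_closure[OF "3.prems"] by simp
qed

text \<open>Minimality of the next term. Every upper bound on the filtration below comes from here,
  by exhibiting a closed subgroup that contains the generators.\<close>

lemma lower_p_central_subset:
  fixes G (structure)
  assumes "topological_group G T" "subgroup K G" "closedin T K" "2 \<le> n"
    and "\<And>\<tau>. \<tau> \<in> lower_p_central p G T (n - 1) \<Longrightarrow> \<tau> [^]\<^bsub>G\<^esub> p \<in> K"
    and "\<And>\<sigma> \<tau>. \<sigma> \<in> carrier G \<Longrightarrow> \<tau> \<in> lower_p_central p G T (n - 1) \<Longrightarrow> commutator G \<sigma> \<tau> \<in> K"
  shows "lower_p_central p G T n \<subseteq> K"
proof -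
  interpret group G using assms(1) unfolding topological_group_def by blast
  obtain k where n: "n = Suc (Suc k)" using assms(4) by (metis add_2_eq_Suc le_Suc_ex)
  show ?thesis unfolding n lower_p_central.simps
    by (intro closure_of_minimal generate_subgroup_incl assms(2,3)) (use assms(5,6) n in auto)
qed

lemma
  fixes G (structure)
  assumes T: "topological_group G T" and k: "1 \<le> k" and x: "x \<in> lower_p_central p G T k"
  shows lower_p_central_pow: "x [^]\<^bsub>G\<^esub> p \<in> lower_p_central p G T (Suc k)"
    and lower_p_central_commutator:
      "\<sigma> \<in> carrier G \<Longrightarrow> commutator G \<sigma> x \<in> lower_p_central p G T (Suc k)"
proof -
  interpret group G using T unfolding topological_group_def by blast
  have top: "topspace T = carrier G" using T unfolding topological_group_def by blast
  obtain j where k: "k = Suc j" using k by (cases k) auto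
  let ?N = "lower_p_central p G T k"
  let ?A = "{\<tau> [^] p | \<tau>. \<tau> \<in> ?N} \<union> {commutator G \<sigma> \<tau> | \<sigma> \<tau>. \<sigma> \<in> carrier G \<and> \<tau> \<in> ?N}"
  have sub: "?N \<subseteq> carrier G"
    using lower_p_central_normal[OF T] normal_imp_subgroup subgroup.subset by blast
  have A: "?A \<subseteq> carrier G" using sub by auto
  have "?A \<subseteq> generate G ?A" by (auto intro: generate.incl)
  also have "\<dots> \<subseteq> lower_p_central p G T (Suc k)"
    unfolding k lower_p_central.simps
    by (intro closure_of_subset) (use generate_incl[OF A] top k in simp)
  finally have *: "?A \<subseteq> lower_p_central p G T (Suc k)" .
  show "x [^] p \<in> lower_p_central p G T (Suc k)" using * x by blast
  show "\<sigma> \<in> carrier G \<Longrightarrow> commutator G \<sigma> x \<in> lower_p_central p G T (Suc k)" using * x by blast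
qed

section \<open>Commutators and the filtration\<close>

text \<open>The inverses are distributed so that the first factor is a conjugate of [[x, y], z] with
  no inverted entry; the identity is later solved for it.\<close>

lemma (in group) hall_witt:
  assumes "x \<in> carrier G" "y \<in> carrier G" "z \<in> carrier G"
  shows "(y \<otimes> commutator G (commutator G x y) z \<otimes> inv y) \<otimes>
    (inv z \<otimes> commutator G (commutator G (inv y) (inv z)) x \<otimes> z) \<otimes>
    (inv x \<otimes> commutator G (commutator G z (inv x)) (inv y) \<otimes> x) = \<one>"
  using assms by (simp add: commutator_def m_assoc inv_mult_group)

lemma (in group) commutator_swap:
  assumes "x \<in> carrier G" "y \<in> carrier G"
  shows "commutator G y x = inv (commutator G x y)"
  using assms by (simp add: commutator_def m_assoc inv_mult_group)

lemma (in group) commutator_inv_left: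
  assumes "x \<in> carrier G" "y \<in> carrier G"
  shows "commutator G (inv x) y = x \<otimes> commutator G y x \<otimes> inv x"
  using assms by (simp add: commutator_def m_assoc inv_mult_group)

text \<open>
  By the Hall-Witt identity, the elements \<open>c\<close> with \<open>[c, N\<^sub>b] \<subseteq> N\<^sub>a\<^sub>+\<^sub>b\<close> for all \<open>b\<close> behave like
  those of the \<open>a\<close>-th term of the lower central series.
\<close>

definition lowers_by :: "nat \<Rightarrow> ('a, 'b) monoid_scheme \<Rightarrow> 'a topology \<Rightarrow> nat \<Rightarrow> 'a \<Rightarrow> bool" where
  "lowers_by p G T a c \<longleftrightarrow> c \<in> carrier G \<and>
     (\<forall>b\<ge>1. \<forall>x\<in>lower_p_central p G T b. commutator G c x \<in> lower_p_central p G T (a + b))"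

lemma lowers_by_1:
  "topological_group G T \<Longrightarrow> c \<in> carrier G \<Longrightarrow> lowers_by p G T 1 c"
  unfolding lowers_by_def using lower_p_central_commutator by fastforce

text \<open>The three subgroups lemma for elements. In the identity for A, B, x the other two
  factors are conjugates of [[B^-1, x^-1], A] and [[x, A^-1], B^-1]; these move x down by b and by
  a, in either order, and [[A, B], x] must follow.\<close>

lemma lowers_by_commutator:
  fixes G (structure)
  assumes T: "topological_group G T" and A: "lowers_by p G T a A" and B: "lowers_by p G T b B"
    and a: "1 \<le> a" and b: "1 \<le> b"
  shows "lowers_by p G T (a + b) (commutator G A B)"
proof -
  interpret group G using T unfolding topological_group_def by blast
  let ?N = "lower_p_central p G T"
  have N: "?N k \<lhd> G" for k by (rule lower_p_central_normal[OF T])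
  have sub: "?N k \<subseteq> carrier G" for k using N normal_imp_subgroup subgroup.subset by blast
  note inv_in = subgroup.m_inv_closed[OF normal_imp_subgroup[OF N]]
  have AC: "A \<in> carrier G" and BC: "B \<in> carrier G" using A B unfolding lowers_by_def by auto
  \<comment> \<open>Since the terms are normal and closed under inverses, it does not matter on
    which side c stands or whether it is inverted.\<close>
  have right: "commutator G x c \<in> ?N (k + j)" if "lowers_by p G T k c" "x \<in> ?N j" "1 \<le> j" for x c k j
    using that sub inv_in unfolding lowers_by_def by (subst commutator_swap[of c x]) auto
  have left_inv: "commutator G (inv c) x \<in> ?N (k + j)"
    if "lowers_by p G T k c" "x \<in> ?N j" "1 \<le> j" for x c k j
    using that sub right[OF that] normal.inv_op_closed2[OF N] unfolding lowers_by_def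
    by (subst commutator_inv_left) auto
  have right_inv: "commutator G x (inv c) \<in> ?N (k + j)"
    if "lowers_by p G T k c" "x \<in> ?N j" "1 \<le> j" for x c k j
    using that sub left_inv[OF that] inv_in unfolding lowers_by_def
    by (subst commutator_swap[of "inv c" x]) auto
  show ?thesis unfolding lowers_by_def
  proof (intro conjI allI impI ballI)
    show "commutator G A B \<in> carrier G" using AC BC by simp
    fix c x assume c: "1 \<le> c" and x: "x \<in> ?N c"
    let ?M = "?N (a + b + c)"
    have xC: "x \<in> carrier G" using x sub by blast
    let ?X = "commutator G (commutator G A B) x"
    let ?Y = "commutator G (commutator G (inv B) (inv x)) A"
    let ?Z = "commutator G (commutator G x (inv A)) (inv B)"
    have carr: "?X \<in> carrier G" "?Y \<in> carrier G" "?Z \<in> carrier G" using AC BC xC by simp_all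
    have Y: "?Y \<in> ?M"
      using right[OF A left_inv[OF B inv_in[OF x] c]] c by (simp add: add_ac)
    have Z: "?Z \<in> ?M"
      using right_inv[OF B right_inv[OF A x c]] c by (simp add: add_ac)
    let ?Y' = "inv x \<otimes> ?Y \<otimes> x" and ?Z' = "inv A \<otimes> ?Z \<otimes> A"
    have Y': "?Y' \<in> ?M" using Y xC normal.inv_op_closed1[OF N] by blast
    have Z': "?Z' \<in> ?M" using Z AC normal.inv_op_closed1[OF N] by blast
    have "B \<otimes> ?X \<otimes> inv B \<otimes> (?Y' \<otimes> ?Z') = \<one>"
      using hall_witt[OF AC BC xC] AC BC xC carr by (simp add: m_assoc)
    then have "B \<otimes> ?X \<otimes> inv B = inv (?Y' \<otimes> ?Z')"
      using AC BC xC carr by (intro inv_equality[symmetric]) auto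
    then have "B \<otimes> ?X \<otimes> inv B \<in> ?M"
      using inv_in subgroup.m_closed[OF normal_imp_subgroup[OF N] Y' Z'] by simp
    then have "inv B \<otimes> (B \<otimes> ?X \<otimes> inv B) \<otimes> B \<in> ?M"
      using BC normal.inv_op_closed1[OF N] by blast
    then show "?X \<in> ?M" using BC carr by (simp add: m_assoc)
  qed
qed

section \<open>The elements belonging to Lyndon words\<close>

lemma std_factorization:
  assumes "2 \<le> length w"
  shows "std_left w @ std_right w = w" "std_left w \<noteq> []" "std_right w \<noteq> []"
proof -
  have suf: "suffix (std_right w) w" and ne: "std_right w \<noteq> []"
    using std_right_lyndon_suffix[OF assms] unfolding lyndon_def strict_suffix_def by auto
  then obtain zs where zs: "w = zs @ std_right w" unfolding suffix_def by blast
  then have "std_left w = zs" unfolding std_left_def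
    by (metis append_eq_conv_conj length_append add_diff_cancel_right')
  then show "std_left w @ std_right w = w" using zs by simp
  show "std_left w \<noteq> []" using length_std_factors(2)[OF assms] by (auto simp: std_left_def)
  show "std_right w \<noteq> []" by (fact ne)
qed

lemma lyndon_commutator_singleton: "lyndon_commutator S \<iota> [x] = \<iota> x"
  by (simp add: lyndon_commutator.simps)

lemma lyndon_commutator_factors:
  "2 \<le> length w \<Longrightarrow> lyndon_commutator S \<iota> w =
    commutator S (lyndon_commutator S \<iota> (std_left w)) (lyndon_commutator S \<iota> (std_right w))"
  by (subst lyndon_commutator.simps) auto

text \<open>The induction follows the recursion of \<open>lyndon_commutator\<close>. It runs over
  all nonempty words, as every word of length at least 2 has a longest proper Lyndon suffix.\<close>

lemma word_induct_std_factorization [consumes 1, case_names single factors]: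
  assumes "w \<noteq> []" and single: "\<And>x. P [x]"
    and factors: "\<And>w. 2 \<le> length w \<Longrightarrow> P (std_left w) \<Longrightarrow> P (std_right w) \<Longrightarrow> P w"
  shows "P w"
  using assms(1)
proof (induction w rule: length_induct)
  case (1 w)
  show ?case
  proof (cases "2 \<le> length w")
    case True
    then show ?thesis
      using 1 factors[OF True] std_factorization[OF True] length_std_factors[OF True] by blast
  next
    case False
    then obtain x where "w = [x]" using 1(2) by (cases w; cases "tl w") auto
    then show ?thesis using single by simp
  qed
qed

text \<open>Both properties travel together: that [\<tau>_u, \<tau>_v] lies in the term of index |u|
  + |v| follows from \<tau>_v lying in the term |v| and \<tau>_u lowering by |u|, while the
  filtration itself would only give |v| + 1.\<close>

lemma lyndon_commutator_in_lower_p_central: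
  assumes T: "topological_group S T" and w: "w \<noteq> []" "set w \<subseteq> X" and \<iota>: "\<iota> \<in> X \<rightarrow> carrier S"
  shows "lyndon_commutator S \<iota> w \<in> lower_p_central p S T (length w) \<and>
    lowers_by p S T (length w) (lyndon_commutator S \<iota> w)"
  using w
proof (induction w rule: word_induct_std_factorization)
  case (single x)
  then have "\<iota> x \<in> carrier S" using \<iota> by auto
  then show ?case using lowers_by_1[OF T] by (simp add: lyndon_commutator_singleton)
next
  case (factors w)
  note std = std_factorization[OF \<open>2 \<le> length w\<close>]
  have len: "length w = length (std_left w) + length (std_right w)"
    using std(1) by (metis length_append)
  have pos: "1 \<le> length (std_left w)" "1 \<le> length (std_right w)"
    using std by (simp_all add: Suc_le_eq)
  have sub: "set (std_left w) \<subseteq> X" "set (std_right w) \<subseteq> X"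
    using factors.prems std(1) by (metis set_append Un_subset_iff)+
  note IH = factors.IH(1)[OF sub(1)] factors.IH(2)[OF sub(2)]
  have "lowers_by p S T (length w) (lyndon_commutator S \<iota> w)"
    using lowers_by_commutator[OF T] IH pos
    by (simp add: lyndon_commutator_factors[OF \<open>2 \<le> length w\<close>] len)
  moreover have "lyndon_commutator S \<iota> w \<in> lower_p_central p S T (length w)"
    using IH pos unfolding lowers_by_def
    by (simp add: lyndon_commutator_factors[OF \<open>2 \<le> length w\<close>] len)
  ultimately show ?case by blast
qed

text \<open>Each p-th power raises the index by one, so the exponent p^(n - |w|) fills the gap from
  |w| to n.\<close>

lemma sigma_element_in_lower_p_central:
  assumes T: "topological_group S T" and w: "w \<noteq> []" "set w \<subseteq> X" "length w \<le> n"
    and \<iota>: "\<iota> \<in> X \<rightarrow> carrier S"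
  shows "sigma_element p S \<iota> w n \<in> lower_p_central p S T n"
proof -
  interpret group S using T unfolding topological_group_def by blast
  let ?t = "lyndon_commutator S \<iota> w"
  have t: "?t \<in> lower_p_central p S T (length w)" and tC: "?t \<in> carrier S"
    using lyndon_commutator_in_lower_p_central[OF T w(1,2) \<iota>, of p] unfolding lowers_by_def by auto
  have "?t [^]\<^bsub>S\<^esub> (p ^ m) \<in> lower_p_central p S T (length w + m)" for m
  proof (induction m)
    case (Suc m)
    have "1 \<le> length w + m" using w by (cases w) auto
    from lower_p_central_pow[OF T this Suc] show ?case
      using tC by (simp add: nat_pow_pow mult.commute)
  qed (use t tC in simp)
  from this[of "n - length w"] show ?thesis using w unfolding sigma_element_def by simp
qed

text \<open>
  A test group of the universal property lives on the type \<^typ>\<open>nat \<Rightarrow> nat\<close>, into which every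
  finite group embeds.
\<close>

lemma finite_discrete_profinite:
  fixes H (structure)
  assumes "group H" "finite (carrier H)"
  shows "profinite_group H (discrete_topology (carrier H))"
proof -
  interpret group H by fact
  have "subgroup {\<one>} H" by (rule triv_subgroup)
  then show ?thesis
    unfolding profinite_group_def topological_group_def
    using assms
    by (auto simp: compact_space_discrete_topology Hausdorff_space_discrete_topology
        prod_topology_discrete_topology [symmetric] intro!: exI[of _ "{\<one>}"])
qed

text \<open>Every map between discrete groups is continuous, so only algebra is asked of
  \<open>r\<close>; the restriction supplies the extensionality built into
  \<open>continuous_hom\<close>.\<close>

lemma continuous_hom_compose_discrete:
  assumes top: "topspace T = carrier S" and "group S"
    and "\<kappa> \<in> continuous_hom S T K (discrete_topology (carrier K))"
    and "r \<in> carrier K \<rightarrow> carrier K'"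
    and "\<And>g h. g \<in> carrier K \<Longrightarrow> h \<in> carrier K \<Longrightarrow> r (g \<otimes>\<^bsub>K\<^esub> h) = r g \<otimes>\<^bsub>K'\<^esub> r h"
  shows "(\<lambda>\<sigma>\<in>carrier S. r (\<kappa> \<sigma>)) \<in> continuous_hom S T K' (discrete_topology (carrier K'))"
proof -
  interpret S: group S by fact
  have "continuous_map T (discrete_topology (carrier K')) (r \<circ> \<kappa>)"
    using assms by (intro continuous_map_compose[of T "discrete_topology (carrier K)"])
      (auto simp: continuous_hom_def)
  then have "continuous_map T (discrete_topology (carrier K')) (\<lambda>\<sigma>\<in>carrier S. r (\<kappa> \<sigma>))"
    by (rule continuous_map_eq) (simp add: top)
  moreover have "\<kappa> \<in> carrier S \<rightarrow> carrier K" "\<kappa> \<in> hom S K"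
    using assms(3) by (auto simp: continuous_hom_def hom_def)
  ultimately show ?thesis
    using assms(4,5) by (auto simp: continuous_hom_def hom_def Pi_iff)
qed

text \<open>The group is transported to \<open>nat \<Rightarrow> nat\<close> along \<open>e\<close>,
  and existence and uniqueness are brought back by its inverse \<open>d\<close>. All later uses of
  freeness pass through finite groups in this way.\<close>

lemma free_profinite_finite:
  fixes H :: "('c, 'd) monoid_scheme"
  assumes free: "free_profinite_group S T X \<iota>" and H: "group H" "finite (carrier H)"
    and f: "f \<in> X \<rightarrow> carrier H"
  shows "\<exists>!\<kappa>. \<kappa> \<in> continuous_hom S T H (discrete_topology (carrier H)) \<and> (\<forall>x\<in>X. \<kappa> (\<iota> x) = f x)"
proof -
  interpret H: group H by fact
  have \<iota>: "\<iota> \<in> X \<rightarrow> carrier S" and S: "group S" and top: "topspace T = carrier S"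
    using free unfolding free_profinite_group_def profinite_group_def topological_group_def by auto
  interpret S: group S by fact
  obtain e0 :: "'c \<Rightarrow> nat" where e0: "inj_on e0 (carrier H)"
    using finite_imp_inj_to_nat_seg[OF H(2)] by blast
  define e :: "'c \<Rightarrow> nat \<Rightarrow> nat" where "e = (\<lambda>h _. e0 h)"
  have e: "inj_on e (carrier H)"
    using e0 unfolding e_def inj_on_def by metis
  define d where "d = inv_into (carrier H) e"
  define H' where "H' = image_group e H"
  have grp: "group H'" unfolding H'_def by (rule H.inj_imp_image_group_is_group[OF e])
  have car: "carrier H' = e ` carrier H" unfolding H'_def by (rule image_group_carrier)
  have de [simp]: "d (e h) = h" if "h \<in> carrier H" for h using that e by (simp add: d_def)
  have ed [simp]: "e (d y) = y" if "y \<in> carrier H'" for y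
    using that car by (simp add: d_def f_inv_into_f)
  have eH: "e h \<in> carrier H'" if "h \<in> carrier H" for h using that car by blast
  have dH: "d y \<in> carrier H" if "y \<in> carrier H'" for y
    using that car by (auto simp: d_def inv_into_into)
  have e_mult: "e (g \<otimes>\<^bsub>H\<^esub> h) = e g \<otimes>\<^bsub>H'\<^esub> e h" if "g \<in> carrier H" "h \<in> carrier H" for g h
    using that e by (simp add: H'_def image_group_def)
  have d_mult: "d (g \<otimes>\<^bsub>H'\<^esub> h) = d g \<otimes>\<^bsub>H\<^esub> d h" if "g \<in> carrier H'" "h \<in> carrier H'" for g h
    by (metis that de ed dH e_mult H.m_closed)
  let ?hom = "\<lambda>\<kappa>. \<kappa> \<in> continuous_hom S T H (discrete_topology (carrier H)) \<and> (\<forall>x\<in>X. \<kappa> (\<iota> x) = f x)"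
  let ?hom' = "\<lambda>\<kappa>. \<kappa> \<in> continuous_hom S T H' (discrete_topology (carrier H')) \<and>
    (\<forall>x\<in>X. \<kappa> (\<iota> x) = e (f x))"
  have to: "?hom' (\<lambda>\<sigma>\<in>carrier S. e (\<kappa> \<sigma>))" if "?hom \<kappa>" for \<kappa>
    using that \<iota> continuous_hom_compose_discrete[OF top S, of \<kappa> H e H'] eH e_mult by (auto simp: Pi_iff)
  have "\<exists>!\<kappa>. ?hom' \<kappa>"
  proof -
    have "(\<lambda>x. e (f x)) \<in> X \<rightarrow> carrier H'" using f eH by auto
    moreover have "finite (carrier H')" using car H by simp
    ultimately show ?thesis
      using free finite_discrete_profinite[OF grp] unfolding free_profinite_group_def by blast
  qed
  then obtain \<kappa>' where \<kappa>': "?hom' \<kappa>'" and uniq: "\<And>\<kappa>. ?hom' \<kappa> \<Longrightarrow> \<kappa> = \<kappa>'" by blast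
  show ?thesis
  proof (rule ex1I)
    show "?hom (\<lambda>\<sigma>\<in>carrier S. d (\<kappa>' \<sigma>))"
      using \<kappa>' \<iota> f continuous_hom_compose_discrete[OF top S, of \<kappa>' H' d H] dH d_mult by (auto simp: Pi_iff)
    fix \<kappa> assume \<kappa>: "?hom \<kappa>"
    then have "(\<lambda>\<sigma>\<in>carrier S. e (\<kappa> \<sigma>)) = \<kappa>'" using uniq to by blast
    then have *: "e (\<kappa> \<sigma>) = \<kappa>' \<sigma>" if "\<sigma> \<in> carrier S" for \<sigma> using that by (metis restrict_apply')
    have ext: "\<kappa> \<in> extensional (carrier S)" and in_H: "\<And>\<sigma>. \<sigma> \<in> carrier S \<Longrightarrow> \<kappa> \<sigma> \<in> carrier H"
      using \<kappa> by (auto simp: continuous_hom_def hom_def)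
    show "\<kappa> = (\<lambda>\<sigma>\<in>carrier S. d (\<kappa>' \<sigma>))"
    proof
      fix \<sigma> show "\<kappa> \<sigma> = (\<lambda>\<sigma>\<in>carrier S. d (\<kappa>' \<sigma>)) \<sigma>"
        using *[of \<sigma>] in_H[of \<sigma>] ext by (cases "\<sigma> \<in> carrier S") (auto simp: extensional_def simp flip: *)
    qed
  qed
qed

section \<open>Transgression\<close>

text \<open>A product of two discrete spaces is discrete, so \<open>h\<close> is continuous on it
  whatever it is.\<close>

lemma continuous_map_discrete_combine:
  assumes "continuous_map Z (discrete_topology A) f" "continuous_map Z (discrete_topology B) g"
    and "\<And>a b. a \<in> A \<Longrightarrow> b \<in> B \<Longrightarrow> h a b \<in> C"
  shows "continuous_map Z (discrete_topology C) (\<lambda>x. h (f x) (g x))"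
proof -
  have "continuous_map Z (discrete_topology (A \<times> B)) (\<lambda>x. (f x, g x))"
    using assms(1,2) by (simp add: prod_topology_discrete_topology continuous_map_paired)
  moreover have "continuous_map (discrete_topology (A \<times> B)) (discrete_topology C) (\<lambda>(a, b). h a b)"
    using assms(3) by auto
  ultimately have "continuous_map Z (discrete_topology C) ((\<lambda>(a, b). h a b) \<circ> (\<lambda>x. (f x, g x)))"
    by (rule continuous_map_compose)
  then show ?thesis by (simp add: o_def)
qed

section \<open>Alternating sums in an abelian group\<close>

context abelian_group
begin
lemma alternating_add:
  assumes "a \<in> carrier G" "b \<in> carrier G" "c \<in> carrier G" "d \<in> carrier G"
    "a' \<in> carrier G" "b' \<in> carrier G" "c' \<in> carrier G" "d' \<in> carrier G"
  shows "(a \<oplus> a') \<ominus> (b \<oplus> b') \<oplus> (c \<oplus> c') \<ominus> (d \<oplus> d') =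
    (a \<ominus> b \<oplus> c \<ominus> d) \<oplus> (a' \<ominus> b' \<oplus> c' \<ominus> d')"
  using assms by (simp add: a_minus_def a_ac minus_add)

lemma alternating_minus:
  assumes "a \<in> carrier G" "b \<in> carrier G" "c \<in> carrier G" "d \<in> carrier G"
  shows "(\<ominus> a) \<ominus> (\<ominus> b) \<oplus> (\<ominus> c) \<ominus> (\<ominus> d) = \<ominus> (a \<ominus> b \<oplus> c \<ominus> d)"
  using assms by (simp add: a_minus_def a_ac minus_add)

text \<open>Two successive coboundaries compose to zero: the variables stand for the values of a
  1-cochain at g, h, k, gh, hk, ghk, and each value occurs with both signs.\<close>

lemma coboundary_identity:
  assumes "x \<in> carrier G" "y \<in> carrier G" "z \<in> carrier G" "xy \<in> carrier G" "yz \<in> carrier G" "xyz \<in> carrier G"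
  shows "(z \<ominus> yz \<oplus> y) \<ominus> (z \<ominus> xyz \<oplus> xy) \<oplus> (yz \<ominus> xyz \<oplus> x) \<ominus> (y \<ominus> xy \<oplus> x) = \<zero>"
    (is "?lhs = _")
proof -
  let ?s = "x \<oplus> y \<oplus> z \<oplus> xy \<oplus> yz \<oplus> xyz"
  have "?lhs = ?s \<oplus> \<ominus> ?s" using assms by (simp add: a_minus_def a_ac minus_add)
  then show ?thesis using assms by (simp add: r_neg)
qed

lemma coboundary_minus:
  assumes "a \<in> carrier G" "b \<in> carrier G" "c \<in> carrier G"
  shows "((\<ominus> a) \<ominus> (\<ominus> b) \<oplus> (\<ominus> c)) \<oplus> (a \<ominus> b \<oplus> c) = \<zero>"
    (is "?lhs = _")
proof -
  let ?s = "a \<ominus> b \<oplus> c"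
  have "?lhs = \<ominus> ?s \<oplus> ?s" using assms by (simp add: a_minus_def a_ac minus_add)
  then show ?thesis using assms by (simp add: l_neg)
qed

lemma coboundary_add:
  assumes "a \<in> carrier G" "b \<in> carrier G" "c \<in> carrier G"
    "a' \<in> carrier G" "b' \<in> carrier G" "c' \<in> carrier G"
  shows "(a \<ominus> b \<oplus> c) \<oplus> (a' \<ominus> b' \<oplus> c') = (a \<oplus> a') \<ominus> (b \<oplus> b') \<oplus> (c \<oplus> c')"
  using assms by (simp add: a_minus_def a_ac minus_add)
lemma minus_add_cancel:
  assumes "x \<in> carrier G" "x' \<in> carrier G"
  shows "(x' \<ominus> x) \<oplus> x = x'"
  using assms by (simp add: minus_eq a_assoc l_neg)

text \<open>If g and h are translated by elements of N, an equivariant cochain changes by u at g, by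
  v at h and by u + v at gh, which cancels.\<close>

lemma coboundary_shift:
  assumes "a \<in> carrier G" "b \<in> carrier G" "c \<in> carrier G" "u \<in> carrier G" "v \<in> carrier G"
  shows "(v \<oplus> a) \<ominus> (u \<oplus> (v \<oplus> b)) \<oplus> (u \<oplus> c) = a \<ominus> b \<oplus> c"
proof -
  have "(v \<oplus> a) \<ominus> (u \<oplus> (v \<oplus> b)) \<oplus> (u \<oplus> c) = (v \<ominus> (u \<oplus> v) \<oplus> u) \<oplus> (a \<ominus> b \<oplus> c)"
    using assms by (subst coboundary_add) (auto simp: a_assoc)
  moreover have "v \<ominus> (u \<oplus> v) \<oplus> u = (u \<oplus> v) \<oplus> \<ominus> (u \<oplus> v)"
    using assms by (simp add: minus_eq a_ac)
  then have "v \<ominus> (u \<oplus> v) \<oplus> u = \<zero>" using assms by (simp only: r_neg a_closed)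
  ultimately show ?thesis using assms by simp
qed

lemma coboundary_diff:
  assumes "a \<in> carrier G" "b \<in> carrier G" "c \<in> carrier G"
    "a' \<in> carrier G" "b' \<in> carrier G" "c' \<in> carrier G"
  shows "((a' \<ominus> a) \<ominus> (b' \<ominus> b) \<oplus> (c' \<ominus> c)) \<oplus> (a \<ominus> b \<oplus> c) = a' \<ominus> b' \<oplus> c'"
  using assms by (subst coboundary_add) (auto simp: minus_add_cancel)

end

section \<open>Second cohomology of a topological quotient\<close>

locale topological_quotient = normal N G + R: abelian_group R
  for R :: "('r, 'c) ring_scheme" and N :: "'a set" and G :: "('a, 'b) monoid_scheme" (structure) +
  fixes T :: "'a topology"
  assumes topological_group: "topological_group G T"
begin

declare mult_FactGroup [simp del]

abbreviation add_R (infixl "\<oplus>\<^sub>R" 65) where "x \<oplus>\<^sub>R y \<equiv> x \<oplus>\<^bsub>R\<^esub> y"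
abbreviation minus_R (infixl "\<ominus>\<^sub>R" 65) where "x \<ominus>\<^sub>R y \<equiv> x \<ominus>\<^bsub>R\<^esub> y"
abbreviation uminus_R ("\<ominus>\<^sub>R _" [81] 80) where "\<ominus>\<^sub>R x \<equiv> \<ominus>\<^bsub>R\<^esub> x"
abbreviation zero_R ("\<zero>\<^sub>R") where "\<zero>\<^sub>R \<equiv> \<zero>\<^bsub>R\<^esub>"
abbreviation "Q \<equiv> quotient_topology G T N"
abbreviation "K \<equiv> G Mod N"
abbreviation "D \<equiv> discrete_topology (carrier R)"

lemma topspace: "topspace T = carrier G"
  using topological_group unfolding topological_group_def by blast

lemma coset_in [simp]: "g \<in> carrier G \<Longrightarrow> N #> g \<in> carrier K"
  by (auto simp: FactGroup_def RCOSETS_def)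

lemma coset_cases:
  assumes "C \<in> carrier K" obtains g where "g \<in> carrier G" "C = N #> g"
  using assms by (auto simp: FactGroup_def RCOSETS_def)

lemma coset_mult: "g \<in> carrier G \<Longrightarrow> h \<in> carrier G \<Longrightarrow> (N #> g) \<otimes>\<^bsub>K\<^esub> (N #> h) = N #> (g \<otimes> h)"
  by (simp add: FactGroup_def rcos_sum)

lemma topspace_quotient: "topspace Q = carrier K"
proof
  show "topspace Q \<subseteq> carrier K"
    using openin_topspace[of Q] unfolding openin_quotient_topology by blast
  have "{g \<in> carrier G. N #> g \<in> carrier K} = topspace T" using topspace by auto
  then have "openin Q (carrier K)" by (simp add: openin_quotient_topology)
  then show "carrier K \<subseteq> topspace Q" by (rule openin_subset)
qed

lemma coset_eq_iff:
  assumes "g \<in> carrier G" "h \<in> carrier G"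
  shows "N #> g = N #> h \<longleftrightarrow> (\<exists>n\<in>N. g = n \<otimes> h)"
proof -
  have "N #> g = N #> h \<longleftrightarrow> g \<in> N #> h"
    using assms subgroup_axioms by (metis repr_independence rcos_self is_group subset)
  then show ?thesis by (auto simp: r_coset_def)
qed

text \<open>The quotient map is open: the preimage of the image of U is the union of the translates
  of U by N.\<close>

lemma open_coset_image:
  assumes "openin T U"
  shows "openin Q ((\<lambda>g. N #> g) ` U)"
proof -
  have U: "U \<subseteq> carrier G" using openin_subset[OF assms] topspace by simp
  \<comment> \<open>The factor 1 on the right fits the two-sided translations of
    \<open>openin_translate\<close>.\<close>
  have "{g \<in> carrier G. N #> g \<in> (\<lambda>g. N #> g) ` U} = (\<Union>n\<in>N. (\<lambda>x. n \<otimes> x \<otimes> \<one>) ` U)"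
  proof (intro Set.set_eqI iffI)
    fix g assume "g \<in> {g \<in> carrier G. N #> g \<in> (\<lambda>g. N #> g) ` U}"
    then obtain u where u: "g \<in> carrier G" "u \<in> U" "N #> g = N #> u" by auto
    then obtain n where "n \<in> N" "g = n \<otimes> u" using U coset_eq_iff by blast
    then have "g = n \<otimes> u \<otimes> \<one>" using u by simp
    then show "g \<in> (\<Union>n\<in>N. (\<lambda>x. n \<otimes> x \<otimes> \<one>) ` U)" using \<open>n \<in> N\<close> u by blast
  next
    fix g assume "g \<in> (\<Union>n\<in>N. (\<lambda>x. n \<otimes> x \<otimes> \<one>) ` U)"
    then obtain n u where nu: "n \<in> N" "u \<in> U" "g = n \<otimes> u \<otimes> \<one>" by blast
    then have "u \<in> carrier G" "g = n \<otimes> u" "g \<in> carrier G" using U by auto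
    then show "g \<in> {g \<in> carrier G. N #> g \<in> (\<lambda>g. N #> g) ` U}"
      using coset_eq_iff nu by blast
  qed
  moreover have "openin T (\<Union>n\<in>N. (\<lambda>x. n \<otimes> x \<otimes> \<one>) ` U)"
    using openin_translate[OF topological_group _ _ assms] by (intro openin_Union) auto
  moreover have "(\<lambda>g. N #> g) ` U \<subseteq> carrier K" using U by auto
  ultimately show ?thesis by (simp add: openin_quotient_topology)
qed

lemma continuous_map_coset: "continuous_map T Q (\<lambda>g. N #> g)"
  unfolding continuous_map_def topspace_quotient
  by (auto simp: topspace openin_quotient_topology)

lemma continuous_map_from_quotient:
  assumes "continuous_map T (discrete_topology A) (\<lambda>g. f (N #> g))"
  shows "continuous_map Q (discrete_topology A) f"
  unfolding continuous_map_def topspace_quotient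
proof (intro conjI allI impI)
  show "f \<in> carrier K \<rightarrow> topspace (discrete_topology A)"
    using assms by (fastforce simp: continuous_map_def topspace elim: coset_cases)
  fix W assume "openin (discrete_topology A) W"
  then have "openin T {g \<in> topspace T. f (N #> g) \<in> W}"
    using assms unfolding continuous_map_def by blast
  moreover have "{g \<in> topspace T. f (N #> g) \<in> W} =
      {g \<in> carrier G. N #> g \<in> {x \<in> carrier K. f x \<in> W}}" using topspace by auto
  ultimately show "openin Q {x \<in> carrier K. f x \<in> W}" by (simp add: openin_quotient_topology)
qed

text \<open>A product of quotient maps need not be a quotient map; here it is, because the factors
  are open and carry open rectangles to open rectangles.\<close>

lemma continuous_map_from_quotient_prod:
  assumes "continuous_map (prod_topology T T) (discrete_topology A) (\<lambda>(g, h). f (N #> g, N #> h))"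
  shows "continuous_map (prod_topology Q Q) (discrete_topology A) f"
  unfolding continuous_map_def topspace_prod_topology topspace_quotient
proof (intro conjI allI impI)
  have inA: "f (N #> g, N #> h) \<in> A" if "g \<in> carrier G" "h \<in> carrier G" for g h
    using assms that by (auto simp: continuous_map_def topspace Pi_iff)
  show "f \<in> carrier K \<times> carrier K \<rightarrow> topspace (discrete_topology A)"
  proof (clarsimp simp: Pi_iff)
    fix C C' assume "C \<in> carrier K" "C' \<in> carrier K"
    then show "f (C, C') \<in> A" using inA by (metis coset_cases)
  qed
  fix W assume "openin (discrete_topology A) W"
  then have op: "openin (prod_topology T T) {x \<in> carrier G \<times> carrier G. case x of (g, h) \<Rightarrow> f (N #> g, N #> h) \<in> W}"
    using assms unfolding continuous_map_def topspace_prod_topology topspace by (simp add: case_prod_unfold)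
  show "openin (prod_topology Q Q) {x \<in> carrier K \<times> carrier K. f x \<in> W}"
    unfolding openin_prod_topology_alt
  proof (intro allI impI)
    fix C C' assume "(C, C') \<in> {x \<in> carrier K \<times> carrier K. f x \<in> W}"
    then have CC': "C \<in> carrier K" "C' \<in> carrier K" "f (C, C') \<in> W" by auto
    then obtain g h where gh: "g \<in> carrier G" "h \<in> carrier G" "C = N #> g" "C' = N #> h"
      by (metis coset_cases)
    then have "f (N #> g, N #> h) \<in> W" using CC' by simp
    then have "(g, h) \<in> {x \<in> carrier G \<times> carrier G. case x of (g, h) \<Rightarrow> f (N #> g, N #> h) \<in> W}"
      using gh by simp
    then obtain U V where UV: "openin T U" "openin T V" "g \<in> U" "h \<in> V"
        "U \<times> V \<subseteq> {x \<in> carrier G \<times> carrier G. case x of (g, h) \<Rightarrow> f (N #> g, N #> h) \<in> W}"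
      using op unfolding openin_prod_topology_alt by meson
    have "(\<lambda>g. N #> g) ` U \<times> (\<lambda>g. N #> g) ` V \<subseteq> {x \<in> carrier K \<times> carrier K. f x \<in> W}"
    proof clarify
      fix u v assume "u \<in> U" "v \<in> V"
      then have "(u, v) \<in> {x \<in> carrier G \<times> carrier G. case x of (g, h) \<Rightarrow> f (N #> g, N #> h) \<in> W}"
        using UV(5) by blast
      then show "(N #> u, N #> v) \<in> carrier K \<times> carrier K \<and> f (N #> u, N #> v) \<in> W" by simp
    qed
    moreover have "C \<in> (\<lambda>g. N #> g) ` U" "C' \<in> (\<lambda>g. N #> g) ` V" using gh UV by auto
    ultimately show "\<exists>U V. openin Q U \<and> openin Q V \<and> C \<in> U \<and> C' \<in> V \<and>
        U \<times> V \<subseteq> {x \<in> carrier K \<times> carrier K. f x \<in> W}"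
      using open_coset_image[OF UV(1)] open_coset_image[OF UV(2)] by blast
  qed
qed

lemma continuous_map_coset_compose:
  "continuous_map Q D b \<Longrightarrow> continuous_map T D (\<lambda>g. b (N #> g))"
  using continuous_map_compose[OF continuous_map_coset] by (simp add: o_def)

lemma continuous_coboundary:
  assumes y: "continuous_map T D y"
  shows "continuous_map (prod_topology T T) D (\<lambda>(g, h). y h \<ominus>\<^sub>R y (g \<otimes> h) \<oplus>\<^sub>R y g)"
proof -
  have fst: "continuous_map (prod_topology T T) D (\<lambda>x. y (fst x))"
    and snd: "continuous_map (prod_topology T T) D (\<lambda>x. y (snd x))"
    using continuous_map_compose[OF continuous_map_fst y, of T]
      continuous_map_compose[OF continuous_map_snd y, of T] by (simp_all add: o_def)
  have "continuous_map (prod_topology T T) T (\<lambda>(x, y). x \<otimes> y)"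
    using topological_group unfolding topological_group_def by blast
  from continuous_map_compose[OF this y]
  have mult: "continuous_map (prod_topology T T) D (\<lambda>x. y (fst x \<otimes> snd x))"
    by (simp add: o_def case_prod_unfold)
  have "continuous_map (prod_topology T T) D
      (\<lambda>x. y (snd x) \<ominus>\<^sub>R y (fst x \<otimes> snd x) \<oplus>\<^sub>R y (fst x))"
    by (intro continuous_map_discrete_combine[OF _ fst, where h = "add_R" and A = "carrier R"]
        continuous_map_discrete_combine[OF snd mult, where h = "\<lambda>a b. a \<ominus>\<^sub>R b"]) auto
  then show ?thesis by (simp add: case_prod_unfold)
qed

lemma continuous_map_in:
  "continuous_map T D y \<Longrightarrow> g \<in> carrier G \<Longrightarrow> y g \<in> carrier R"
  by (auto simp: continuous_map_def topspace)

lemma continuous_map_quotient_in: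
  "continuous_map Q D y \<Longrightarrow> C \<in> carrier K \<Longrightarrow> y C \<in> carrier R"
  by (auto simp: continuous_map_def topspace_quotient)

abbreviation "Z2 \<equiv> cocycle_group R K Q"
abbreviation "B2 \<equiv> coboundaries2 R K Q"

lemma group_K: "group K" by (rule factorgroup_is_group)

lemma cocycle_in:
  "c \<in> cocycles2 R K Q \<Longrightarrow> C \<in> carrier K \<Longrightarrow> C' \<in> carrier K \<Longrightarrow> c (C, C') \<in> carrier R"
  by (auto simp: cocycles2_def continuous_map_def topspace_quotient)

lemma group_cocycles: "comm_group Z2"
proof -
  interpret K: group K by (rule group_K)
  have closed: "(\<lambda>x\<in>carrier K \<times> carrier K. c x \<oplus>\<^sub>R d x) \<in> cocycles2 R K Q" (is "?cd \<in> _")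
    if c: "c \<in> cocycles2 R K Q" and d: "d \<in> cocycles2 R K Q" for c d
    unfolding cocycles2_def
  proof (intro CollectI conjI ballI)
    have "continuous_map (prod_topology Q Q) D (\<lambda>x. c x \<oplus>\<^sub>R d x)"
      using c d by (intro continuous_map_discrete_combine[where h = "add_R" and A = "carrier R" and B = "carrier R"])
        (auto simp: cocycles2_def)
    then show "continuous_map (prod_topology Q Q) D (\<lambda>x\<in>carrier K \<times> carrier K. c x \<oplus>\<^sub>R d x)"
      by (rule continuous_map_eq) (simp add: topspace_quotient)
    fix g h k assume ghk: "g \<in> carrier K" "h \<in> carrier K" "k \<in> carrier K"
    have eq: "c (h, k) \<ominus>\<^sub>R c (g \<otimes>\<^bsub>K\<^esub> h, k) \<oplus>\<^sub>R c (g, h \<otimes>\<^bsub>K\<^esub> k) \<ominus>\<^sub>R c (g, h) = \<zero>\<^sub>R"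
      "d (h, k) \<ominus>\<^sub>R d (g \<otimes>\<^bsub>K\<^esub> h, k) \<oplus>\<^sub>R d (g, h \<otimes>\<^bsub>K\<^esub> k) \<ominus>\<^sub>R d (g, h) = \<zero>\<^sub>R"
      using c d ghk unfolding cocycles2_def by blast+
    have "(c (h, k) \<oplus>\<^sub>R d (h, k)) \<ominus>\<^sub>R (c (g \<otimes>\<^bsub>K\<^esub> h, k) \<oplus>\<^sub>R d (g \<otimes>\<^bsub>K\<^esub> h, k)) \<oplus>\<^sub>R
        (c (g, h \<otimes>\<^bsub>K\<^esub> k) \<oplus>\<^sub>R d (g, h \<otimes>\<^bsub>K\<^esub> k)) \<ominus>\<^sub>R (c (g, h) \<oplus>\<^sub>R d (g, h)) =
        (c (h, k) \<ominus>\<^sub>R c (g \<otimes>\<^bsub>K\<^esub> h, k) \<oplus>\<^sub>R c (g, h \<otimes>\<^bsub>K\<^esub> k) \<ominus>\<^sub>R c (g, h)) \<oplus>\<^sub>R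
        (d (h, k) \<ominus>\<^sub>R d (g \<otimes>\<^bsub>K\<^esub> h, k) \<oplus>\<^sub>R d (g, h \<otimes>\<^bsub>K\<^esub> k) \<ominus>\<^sub>R d (g, h))"
      using c d ghk by (intro R.alternating_add cocycle_in) auto
    then show "?cd (h, k)
        \<ominus>\<^sub>R ?cd (g \<otimes>\<^bsub>K\<^esub> h, k)
        \<oplus>\<^sub>R ?cd (g, h \<otimes>\<^bsub>K\<^esub> k)
        \<ominus>\<^sub>R ?cd (g, h) = \<zero>\<^sub>R"
      using ghk eq by simp
  qed simp
  have neg: "(\<lambda>x\<in>carrier K \<times> carrier K. \<ominus>\<^sub>R c x) \<in> cocycles2 R K Q" (is "?nc \<in> _")
    if c: "c \<in> cocycles2 R K Q" for c
    unfolding cocycles2_def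
  proof (intro CollectI conjI ballI)
    have "continuous_map (prod_topology Q Q) D (\<lambda>x. \<ominus>\<^sub>R c x)"
      using c by (intro continuous_map_discrete_combine[where h = "\<lambda>a b. \<ominus>\<^sub>R a" and A = "carrier R" and B = "carrier R" and g = c]) (auto simp: cocycles2_def)
    then show "continuous_map (prod_topology Q Q) D (\<lambda>x\<in>carrier K \<times> carrier K. \<ominus>\<^sub>R c x)"
      by (rule continuous_map_eq) (simp add: topspace_quotient)
    fix g h k assume ghk: "g \<in> carrier K" "h \<in> carrier K" "k \<in> carrier K"
    have eq: "c (h, k) \<ominus>\<^sub>R c (g \<otimes>\<^bsub>K\<^esub> h, k) \<oplus>\<^sub>R c (g, h \<otimes>\<^bsub>K\<^esub> k) \<ominus>\<^sub>R c (g, h) = \<zero>\<^sub>R"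
      using c ghk unfolding cocycles2_def by blast
    have "(\<ominus>\<^sub>R c (h, k)) \<ominus>\<^sub>R (\<ominus>\<^sub>R c (g \<otimes>\<^bsub>K\<^esub> h, k)) \<oplus>\<^sub>R
        (\<ominus>\<^sub>R c (g, h \<otimes>\<^bsub>K\<^esub> k)) \<ominus>\<^sub>R (\<ominus>\<^sub>R c (g, h)) =
        \<ominus>\<^sub>R (c (h, k) \<ominus>\<^sub>R c (g \<otimes>\<^bsub>K\<^esub> h, k) \<oplus>\<^sub>R c (g, h \<otimes>\<^bsub>K\<^esub> k) \<ominus>\<^sub>R c (g, h))"
      using c ghk by (intro R.alternating_minus cocycle_in) auto
    then show "?nc (h, k)
        \<ominus>\<^sub>R ?nc (g \<otimes>\<^bsub>K\<^esub> h, k)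
        \<oplus>\<^sub>R ?nc (g, h \<otimes>\<^bsub>K\<^esub> k)
        \<ominus>\<^sub>R ?nc (g, h) = \<zero>\<^sub>R"
      using ghk eq by simp
  qed simp
  show ?thesis
  proof (rule comm_groupI)
    show "x \<otimes>\<^bsub>Z2\<^esub> y \<in> carrier Z2" if "x \<in> carrier Z2" "y \<in> carrier Z2" for x y
      using that closed by (simp add: cocycle_group_def)
    have neg_zero: "\<ominus>\<^sub>R \<zero>\<^sub>R = \<zero>\<^sub>R" using R.l_neg[of "\<zero>\<^sub>R"] by simp
    show "\<one>\<^bsub>Z2\<^esub> \<in> carrier Z2"
      by (simp add: cocycle_group_def cocycles2_def a_minus_def neg_zero)
        (auto intro!: continuous_map_eq[of _ _ "\<lambda>_. \<zero>\<^sub>R"] simp: topspace_quotient)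
    show "x \<otimes>\<^bsub>Z2\<^esub> y \<otimes>\<^bsub>Z2\<^esub> z = x \<otimes>\<^bsub>Z2\<^esub> (y \<otimes>\<^bsub>Z2\<^esub> z)"
      if "x \<in> carrier Z2" "y \<in> carrier Z2" "z \<in> carrier Z2" for x y z
      using that by (auto simp: cocycle_group_def fun_eq_iff cocycle_in R.a_assoc restrict_def)
    show "x \<otimes>\<^bsub>Z2\<^esub> y = y \<otimes>\<^bsub>Z2\<^esub> x"
      if "x \<in> carrier Z2" "y \<in> carrier Z2" for x y
      using that by (auto simp: cocycle_group_def fun_eq_iff cocycle_in R.a_comm restrict_def)
    show "\<one>\<^bsub>Z2\<^esub> \<otimes>\<^bsub>Z2\<^esub> x = x" if "x \<in> carrier Z2" for x
    proof -
      have "x \<in> extensional (carrier K \<times> carrier K)" using that by (simp add: cocycle_group_def cocycles2_def)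
      then show ?thesis using that
        by (auto simp: cocycle_group_def fun_eq_iff cocycle_in restrict_def extensional_def)
    qed
    show "\<exists>y\<in>carrier Z2. y \<otimes>\<^bsub>Z2\<^esub> x = \<one>\<^bsub>Z2\<^esub>" if "x \<in> carrier Z2" for x
      using that neg[of x] by (intro bexI[of _ "\<lambda>z\<in>carrier K \<times> carrier K. \<ominus>\<^sub>R x z"])
        (auto simp: cocycle_group_def fun_eq_iff cocycle_in restrict_def R.l_neg)
  qed
qed

lemma coboundaries_subgroup: "subgroup B2 Z2"
proof -
  interpret K: group K by (rule group_K)
  interpret Z: comm_group Z2 by (rule group_cocycles)
  have cob: "coboundary R K b \<in> cocycles2 R K Q" if b: "continuous_map Q D b" for b
    unfolding cocycles2_def
  proof (intro CollectI conjI ballI)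
    show "coboundary R K b \<in> extensional (carrier K \<times> carrier K)" by (simp add: coboundary_def)
    have "continuous_map (prod_topology T T) D
        (\<lambda>(g, h). b (N #> h) \<ominus>\<^sub>R b (N #> (g \<otimes> h)) \<oplus>\<^sub>R b (N #> g))"
      by (rule continuous_coboundary[OF continuous_map_coset_compose[OF b]])
    then have "continuous_map (prod_topology T T) D (\<lambda>(g, h). coboundary R K b (N #> g, N #> h))"
      by (rule continuous_map_eq) (auto simp: coboundary_def topspace coset_mult)
    then show "continuous_map (prod_topology Q Q) D (coboundary R K b)"
      by (rule continuous_map_from_quotient_prod)
    fix g h k assume ghk: "g \<in> carrier K" "h \<in> carrier K" "k \<in> carrier K"
    note bin = continuous_map_quotient_in[OF b]
    show "coboundary R K b (h, k) \<ominus>\<^sub>R coboundary R K b (g \<otimes>\<^bsub>K\<^esub> h, k) \<oplus>\<^sub>R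
        coboundary R K b (g, h \<otimes>\<^bsub>K\<^esub> k) \<ominus>\<^sub>R coboundary R K b (g, h) = \<zero>\<^sub>R"
      using ghk by (simp add: coboundary_def bin K.m_assoc R.coboundary_identity)
  qed
  show ?thesis
  proof (rule Z.subgroupI)
    show "B2 \<subseteq> carrier Z2" using cob by (auto simp: coboundaries2_def cocycle_group_def)
    have "continuous_map Q D (\<lambda>_. \<zero>\<^sub>R)" by simp
    then show "B2 \<noteq> {}" unfolding coboundaries2_def by blast
  next
    fix a assume "a \<in> B2"
    then obtain b where b: "continuous_map Q D b" "a = coboundary R K b" unfolding coboundaries2_def by blast
    note bin = continuous_map_quotient_in[OF b(1)]
    have b': "continuous_map Q D (\<lambda>x. \<ominus>\<^sub>R b x)"
      using b by (intro continuous_map_discrete_combine[where h = "\<lambda>a b. \<ominus>\<^sub>R a" and A = "carrier R" and B = "carrier R" and g = b]) auto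
    have "coboundary R K (\<lambda>x. \<ominus>\<^sub>R b x) \<otimes>\<^bsub>Z2\<^esub> a = \<one>\<^bsub>Z2\<^esub>"
      unfolding b(2) by (auto simp: coboundary_def cocycle_group_def fun_eq_iff restrict_def bin
          R.coboundary_minus)
    then have "inv\<^bsub>Z2\<^esub> a = coboundary R K (\<lambda>x. \<ominus>\<^sub>R b x)"
      using cob b b' by (intro Z.inv_equality) (auto simp: cocycle_group_def)
    then show "inv\<^bsub>Z2\<^esub> a \<in> B2" using b' unfolding coboundaries2_def by blast
  next
    fix a a' assume "a \<in> B2" "a' \<in> B2"
    then obtain b b' where b: "continuous_map Q D b" "a = coboundary R K b"
        "continuous_map Q D b'" "a' = coboundary R K b'" unfolding coboundaries2_def by blast
    note bin = continuous_map_quotient_in[OF b(1)] continuous_map_quotient_in[OF b(3)]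
    have b'': "continuous_map Q D (\<lambda>x. b x \<oplus>\<^sub>R b' x)"
      using b by (intro continuous_map_discrete_combine[where h = "add_R" and A = "carrier R" and B = "carrier R"]) auto
    have "a \<otimes>\<^bsub>Z2\<^esub> a' = coboundary R K (\<lambda>x. b x \<oplus>\<^sub>R b' x)"
      unfolding b by (auto simp: coboundary_def cocycle_group_def fun_eq_iff restrict_def bin
          R.coboundary_add)
    then show "a \<otimes>\<^bsub>Z2\<^esub> a' \<in> B2" using b'' unfolding coboundaries2_def by blast
  qed
qed

text \<open>Cochains on G/N are compared on cosets of elements of G, where explicit formulas are
  available; extensionality settles the remaining arguments.\<close>

lemma H2_class_eqI:
  assumes c: "c \<in> cocycles2 R K Q" and b: "continuous_map Q D b"
    and c': "c' \<in> extensional (carrier K \<times> carrier K)"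
    and eq: "\<And>g h. g \<in> carrier G \<Longrightarrow> h \<in> carrier G \<Longrightarrow>
      c' (N #> g, N #> h) =
        (b (N #> h) \<ominus>\<^sub>R b (N #> (g \<otimes> h)) \<oplus>\<^sub>R b (N #> g)) \<oplus>\<^sub>R c (N #> g, N #> h)"
  shows "H2_class R K Q c' = H2_class R K Q c"
proof -
  interpret Z: comm_group Z2 by (rule group_cocycles)
  have c' : "c' = coboundary R K b \<otimes>\<^bsub>Z2\<^esub> c"
  proof
    fix x show "c' x = (coboundary R K b \<otimes>\<^bsub>Z2\<^esub> c) x"
    proof (cases "x \<in> carrier K \<times> carrier K")
      case True
      then obtain C C' where x: "x = (C, C')" "C \<in> carrier K" "C' \<in> carrier K" by blast
      then obtain g h where "g \<in> carrier G" "h \<in> carrier G" "C = N #> g" "C' = N #> h"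
        by (metis coset_cases)
      then show ?thesis using eq[of g h] x
        by (simp add: cocycle_group_def coboundary_def coset_mult)
    next
      case False
      then show ?thesis using extensional_arb[OF c'] by (simp add: cocycle_group_def)
    qed
  qed
  have "coboundary R K b \<in> B2" using b unfolding coboundaries2_def by blast
  then have "c' \<in> B2 #>\<^bsub>Z2\<^esub> c" unfolding c' r_coset_def by blast
  moreover have "c \<in> carrier Z2" using c by (simp add: cocycle_group_def)
  ultimately show ?thesis
    unfolding H2_class_def using Z.repr_independence coboundaries_subgroup by metis
qed

lemma H2_class_eqD:
  assumes c: "c \<in> cocycles2 R K Q" and c': "c' \<in> cocycles2 R K Q"
    and eq: "H2_class R K Q c' = H2_class R K Q c"
  shows "\<exists>b. continuous_map Q D b \<and> (\<forall>g\<in>carrier G. \<forall>h\<in>carrier G.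
      c' (N #> g, N #> h) =
        (b (N #> h) \<ominus>\<^sub>R b (N #> (g \<otimes> h)) \<oplus>\<^sub>R b (N #> g)) \<oplus>\<^sub>R c (N #> g, N #> h))"
proof -
  interpret Z: comm_group Z2 by (rule group_cocycles)
  have "c' \<in> B2 #>\<^bsub>Z2\<^esub> c'"
    using Z.rcos_self[OF _ coboundaries_subgroup] c' by (simp add: cocycle_group_def)
  then have "c' \<in> B2 #>\<^bsub>Z2\<^esub> c" using eq unfolding H2_class_def by simp
  then obtain b where b: "continuous_map Q D b" "c' = coboundary R K b \<otimes>\<^bsub>Z2\<^esub> c"
    unfolding r_coset_def coboundaries2_def by blast
  show ?thesis
    by (rule exI[of _ b]) (simp add: b cocycle_group_def coboundary_def coset_mult)
qed

text \<open>The cocycle identity and continuity are inherited from the coboundary on G, because the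
  map from G to G/N is surjective and open.\<close>

lemma cocycle_of_coboundary:
  assumes y: "continuous_map T D y"
    and ext: "c \<in> extensional (carrier K \<times> carrier K)"
    and c: "\<And>g h. g \<in> carrier G \<Longrightarrow> h \<in> carrier G \<Longrightarrow> c (N #> g, N #> h) = coboundary R G y (g, h)"
  shows "c \<in> cocycles2 R K Q"
  unfolding cocycles2_def
proof (intro CollectI conjI ballI)
  show "c \<in> extensional (carrier K \<times> carrier K)" by (rule ext)
  have "continuous_map (prod_topology T T) D (\<lambda>(g, h). c (N #> g, N #> h))"
    using continuous_coboundary[OF y]
    by (rule continuous_map_eq) (auto simp: c coboundary_def topspace)
  then show "continuous_map (prod_topology Q Q) D c"
    by (rule continuous_map_from_quotient_prod)
  note yin = continuous_map_in[OF y]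
  fix C C' C'' assume "C \<in> carrier K" "C' \<in> carrier K" "C'' \<in> carrier K"
  then obtain g h k where "g \<in> carrier G" "h \<in> carrier G" "k \<in> carrier G"
      "C = N #> g" "C' = N #> h" "C'' = N #> k"
    by (metis coset_cases)
  then show "c (C', C'') \<ominus>\<^sub>R c (C \<otimes>\<^bsub>K\<^esub> C', C'') \<oplus>\<^sub>R c (C, C' \<otimes>\<^bsub>K\<^esub> C'') \<ominus>\<^sub>R c (C, C') = \<zero>\<^sub>R"
    by (simp add: coset_mult c coboundary_def m_assoc yin R.coboundary_identity)
qed

text \<open>The point is uniqueness. Two admissible cochains y and y' agree on N; their difference z
  turns out to be constant on cosets, and the cochain b it induces on G/N accounts for the
  difference of the two cocycles.\<close>

lemma transgression_eq:
  assumes y: "continuous_map T D y" and \<psi>: "\<And>\<tau>. \<tau> \<in> N \<Longrightarrow> y \<tau> = \<psi> \<tau>"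
    and ext: "c \<in> extensional (carrier K \<times> carrier K)"
    and c: "\<And>g h. g \<in> carrier G \<Longrightarrow> h \<in> carrier G \<Longrightarrow> c (N #> g, N #> h) = coboundary R G y (g, h)"
  shows "transgression R G T N \<psi> = H2_class R K Q c"
proof -
  interpret Z: comm_group Z2 by (rule group_cocycles)
  have carrier_H2: "carrier (H2 R K Q) = (\<lambda>x. B2 #>\<^bsub>Z2\<^esub> x) ` carrier Z2"
    unfolding H2_def by (rule carrier_FactGroup)
  have cZ: "c \<in> cocycles2 R K Q" by (rule cocycle_of_coboundary[OF y ext c])
  have mem: "e \<in> H2_class R K Q e" if "e \<in> cocycles2 R K Q" for e
    unfolding H2_class_def using Z.rcos_self[OF _ coboundaries_subgroup] that
    by (simp add: cocycle_group_def)
  show ?thesis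
    unfolding transgression_def
  proof (rule the_equality)
    have "H2_class R K Q c \<in> carrier (H2 R K Q)"
      unfolding carrier_H2 H2_class_def using cZ by (auto simp: cocycle_group_def)
    then show "H2_class R K Q c \<in> carrier (H2 R K Q) \<and>
      (\<exists>y. continuous_map T D y \<and> (\<forall>\<tau>\<in>N. y \<tau> = \<psi> \<tau>) \<and>
        (\<exists>c\<in>H2_class R K Q c. \<forall>g\<in>carrier G. \<forall>h\<in>carrier G.
          c (N #> g, N #> h) = coboundary R G y (g, h)))"
      using y \<psi> c mem[OF cZ] by blast
  next
    fix \<alpha>
    assume \<alpha>: "\<alpha> \<in> carrier (H2 R K Q) \<and>
      (\<exists>y. continuous_map T D y \<and> (\<forall>\<tau>\<in>N. y \<tau> = \<psi> \<tau>) \<and>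
        (\<exists>c\<in>\<alpha>. \<forall>g\<in>carrier G. \<forall>h\<in>carrier G.
          c (N #> g, N #> h) = coboundary R G y (g, h)))"
    then obtain y' c' where y': "continuous_map T D y'" "\<And>\<tau>. \<tau> \<in> N \<Longrightarrow> y' \<tau> = \<psi> \<tau>" "c' \<in> \<alpha>"
      and c': "\<And>g h. g \<in> carrier G \<Longrightarrow> h \<in> carrier G \<Longrightarrow> c' (N #> g, N #> h) = coboundary R G y' (g, h)"
      by blast
    obtain e where e: "e \<in> carrier Z2" "\<alpha> = B2 #>\<^bsub>Z2\<^esub> e"
      using \<alpha> unfolding carrier_H2 by auto
    have c'Z: "c' \<in> carrier Z2"
      using e y'(3) Z.r_coset_subset_G[OF subgroup.subset[OF coboundaries_subgroup]] by blast
    have \<alpha>_eq: "\<alpha> = H2_class R K Q c'"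
      unfolding H2_class_def e using Z.repr_independence[OF _ e(1) coboundaries_subgroup] y'(3) e by simp
    define z where "z = (\<lambda>g. y' g \<ominus>\<^sub>R y g)"
    note yin = continuous_map_in[OF y] continuous_map_in[OF y'(1)]
    have zin: "z g \<in> carrier R" if "g \<in> carrier G" for g using that yin by (simp add: z_def)
    have zc: "continuous_map T D z"
      unfolding z_def
      by (intro continuous_map_discrete_combine[OF y'(1) y, where h = "\<lambda>a b. a \<ominus>\<^sub>R b"]) auto
    have z_N: "z \<nu> = \<zero>\<^sub>R" if "\<nu> \<in> N" for \<nu>
      using that y'(2) \<psi> yin(1)[of \<nu>] subset by (auto simp: z_def R.minus_eq R.r_neg)
    have dz: "c' (N #> g, N #> h) = (z h \<ominus>\<^sub>R z (g \<otimes> h) \<oplus>\<^sub>R z g) \<oplus>\<^sub>R c (N #> g, N #> h)"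
      if "g \<in> carrier G" "h \<in> carrier G" for g h
      using that by (simp add: c' c coboundary_def z_def yin R.coboundary_diff)
    \<comment> \<open>The cosets of \<nu> and 1 agree, so \<open>dz\<close> at (\<nu>, h) and at (1,
      h) contains the same value of c, while z vanishes at \<nu> and at 1.\<close>
    have z_inv: "z (\<nu> \<otimes> h) = z h" if \<nu>: "\<nu> \<in> N" and h: "h \<in> carrier G" for \<nu> h
    proof -
      have \<nu>G: "\<nu> \<in> carrier G" using \<nu> subset by blast
      have "N #> \<nu> = N #> \<one>" using coset_eq_iff[OF \<nu>G one_closed] \<nu> \<nu>G by auto
      then have "(z h \<ominus>\<^sub>R z (\<nu> \<otimes> h) \<oplus>\<^sub>R z \<nu>) \<oplus>\<^sub>R c (N #> \<nu>, N #> h) =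
          (z h \<ominus>\<^sub>R z (\<one> \<otimes> h) \<oplus>\<^sub>R z \<one>) \<oplus>\<^sub>R c (N #> \<nu>, N #> h)"
        using dz[OF \<nu>G h] dz[OF one_closed h] by simp
      moreover have "c (N #> \<nu>, N #> h) \<in> carrier R" using cocycle_in[OF cZ] \<nu>G h by simp
      ultimately have "z h \<ominus>\<^sub>R z (\<nu> \<otimes> h) = \<zero>\<^sub>R"
        using zin \<nu>G h by (simp add: z_N \<nu> R.minus_eq R.r_neg)
      then show ?thesis using R.minus_add_cancel[of "z (\<nu> \<otimes> h)" "z h"] zin \<nu>G h by simp
    qed
    define b where "b = (\<lambda>C. z (SOME g. g \<in> carrier G \<and> C = N #> g))"
    have b: "b (N #> g) = z g" if g: "g \<in> carrier G" for g
    proof -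
      have "\<exists>h. h \<in> carrier G \<and> N #> g = N #> h" using g by blast
      from someI_ex[OF this] obtain h where h: "h \<in> carrier G" "N #> g = N #> h" "b (N #> g) = z h"
        unfolding b_def by blast
      then obtain \<nu> where "\<nu> \<in> N" "g = \<nu> \<otimes> h" using coset_eq_iff[OF g h(1)] by blast
      then show ?thesis using z_inv h by simp
    qed
    have bc: "continuous_map Q D b"
      by (rule continuous_map_from_quotient) (rule continuous_map_eq[OF zc], simp add: b topspace)
    have "H2_class R K Q c' = H2_class R K Q c"
      using c'Z dz by (intro H2_class_eqI[OF cZ bc]) (auto simp: cocycle_group_def cocycles2_def b)
    then show "\<alpha> = H2_class R K Q c" using \<alpha>_eq by simp
  qed
qed

section \<open>Invariant homomorphisms and injectivity of the transgression\<close>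

lemma H1_invariants_props:
  assumes "\<psi> \<in> H1_invariants R G T N"
  shows "\<psi> \<in> extensional N" "\<And>\<nu>. \<nu> \<in> N \<Longrightarrow> \<psi> \<nu> \<in> carrier R"
    "\<And>\<nu> \<tau>. \<nu> \<in> N \<Longrightarrow> \<tau> \<in> N \<Longrightarrow> \<psi> (\<nu> \<otimes> \<tau>) = \<psi> \<nu> \<oplus>\<^sub>R \<psi> \<tau>"
    "continuous_map (subtopology T N) D \<psi>"
    "\<And>\<sigma> \<tau>. \<sigma> \<in> carrier G \<Longrightarrow> \<tau> \<in> N \<Longrightarrow> \<psi> (\<sigma> \<otimes> \<tau> \<otimes> inv \<sigma>) = \<psi> \<tau>"
    "\<psi> \<one> = \<zero>\<^sub>R"
proof -
  show 1: "\<psi> \<in> extensional N" "\<And>\<nu>. \<nu> \<in> N \<Longrightarrow> \<psi> \<nu> \<in> carrier R"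
    "continuous_map (subtopology T N) D \<psi>"
    and 2: "\<And>\<nu> \<tau>. \<nu> \<in> N \<Longrightarrow> \<tau> \<in> N \<Longrightarrow> \<psi> (\<nu> \<otimes> \<tau>) = \<psi> \<nu> \<oplus>\<^sub>R \<psi> \<tau>"
    using assms by (auto simp: H1_invariants_def continuous_hom_def hom_def)
  show "\<psi> (\<sigma> \<otimes> \<tau> \<otimes> inv \<sigma>) = \<psi> \<tau>" if "\<sigma> \<in> carrier G" "\<tau> \<in> N" for \<sigma> \<tau>
  proof -
    have "\<psi> (inv (inv \<sigma>) \<otimes> \<tau> \<otimes> inv \<sigma>) = \<psi> \<tau>"
      using assms that unfolding H1_invariants_def by blast
    then show ?thesis using that by simp
  qed
  have "\<psi> \<one> \<oplus>\<^sub>R \<psi> \<one> = \<psi> \<one>" using 2[of \<one> \<one>] by simp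
  then show "\<psi> \<one> = \<zero>\<^sub>R" using 1(2)[of \<one>] by simp
qed

text \<open>
  A continuous section of \<open>G \<rightarrow> G/N\<close> is not needed: as \<open>ker \<psi> \<supseteq> N \<inter> V\<close> for some open subgroup
  \<open>V\<close>, a choice of representatives \<open>t\<close> of the cosets of the open subgroup \<open>N V\<close> suffices, with
  \<open>y (\<nu> v t) = \<psi> \<nu>\<close>.
\<close>

lemma equivariant_extension:
  assumes prof: "profinite_group G T" and \<psi>: "\<psi> \<in> H1_invariants R G T N"
  obtains y where "continuous_map T D y"
    and "\<And>\<nu> g. \<nu> \<in> N \<Longrightarrow> g \<in> carrier G \<Longrightarrow> y (\<nu> \<otimes> g) = \<psi> \<nu> \<oplus>\<^sub>R y g"
proof -
  note \<psi> = H1_invariants_props[OF \<psi>]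
  have "openin (subtopology T N) {x \<in> topspace (subtopology T N). \<psi> x \<in> {\<zero>\<^sub>R}}"
    using \<psi>(4) by (rule openin_continuous_map_preimage) simp
  then obtain U where U: "openin T U" "{x \<in> topspace (subtopology T N). \<psi> x \<in> {\<zero>\<^sub>R}} = U \<inter> N"
    unfolding openin_subtopology by blast
  have "\<one> \<in> {x \<in> topspace (subtopology T N). \<psi> x \<in> {\<zero>\<^sub>R}}"
    using \<psi>(6) by (simp add: topspace)
  then have "\<one> \<in> U" using U(2) by blast
  then obtain V where V: "subgroup V G" "openin T V" "V \<subseteq> U"
    using prof U(1) unfolding profinite_group_def by blast
  have VG: "V \<subseteq> carrier G" by (rule subgroup.subset[OF V(1)])
  have V0: "\<psi> x = \<zero>\<^sub>R" if "x \<in> V" "x \<in> N" for x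
    using that V(3) U(2) by blast
  define M where "M = N <#> V"
  have NVM: "\<nu> \<otimes> v \<in> M" if "\<nu> \<in> N" "v \<in> V" for \<nu> v
    using that unfolding M_def set_mult_def by blast
  have M: "subgroup M G"
  proof (rule subgroupI)
    show "M \<subseteq> carrier G" using VG subset by (auto simp: M_def set_mult_def)
    show "M \<noteq> {}" using NVM[OF subgroup.one_closed[OF is_subgroup] subgroup.one_closed[OF V(1)]] by blast
  next
    fix a assume "a \<in> M"
    then obtain \<nu> v where a: "\<nu> \<in> N" "v \<in> V" "a = \<nu> \<otimes> v" unfolding M_def set_mult_def by blast
    then have carr: "\<nu> \<in> carrier G" "v \<in> carrier G" using VG subset by auto
    then have "inv a = (inv v \<otimes> inv \<nu> \<otimes> v) \<otimes> inv v" using a by (simp add: m_assoc inv_mult_group)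
    moreover have "inv v \<otimes> inv \<nu> \<otimes> v \<in> N" using a carr inv_op_closed1 by simp
    ultimately show "inv a \<in> M" using NVM subgroup.m_inv_closed[OF V(1) a(2)] by simp
  next
    fix a b assume "a \<in> M" "b \<in> M"
    then obtain \<nu> v \<nu>' v' where a: "\<nu> \<in> N" "v \<in> V" "a = \<nu> \<otimes> v"
      and b: "\<nu>' \<in> N" "v' \<in> V" "b = \<nu>' \<otimes> v'" unfolding M_def set_mult_def by blast
    then have carr: "\<nu> \<in> carrier G" "v \<in> carrier G" "\<nu>' \<in> carrier G" "v' \<in> carrier G"
      using VG subset by auto
    then have "a \<otimes> b = (\<nu> \<otimes> (v \<otimes> \<nu>' \<otimes> inv v)) \<otimes> (v \<otimes> v')" using a b by (simp add: m_assoc)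
    moreover have "v \<otimes> \<nu>' \<otimes> inv v \<in> N" using b carr inv_op_closed2 by simp
    ultimately show "a \<otimes> b \<in> M"
      using NVM a b subgroup.m_closed[OF V(1)] by simp
  qed
  define r where "r g = (SOME t. t \<in> M #> g)" for g
  have r: "r g \<in> M #> g" if "g \<in> carrier G" for g
    unfolding r_def using rcos_self[OF that M] by (rule someI)
  have r_carr: "r g \<in> carrier G" if "g \<in> carrier G" for g
    using r[OF that] r_coset_subset_G[OF subgroup.subset[OF M] that] by blast
  have r_eq: "r (m \<otimes> g) = r g" if "m \<in> M" "g \<in> carrier G" for m g
  proof -
    have "m \<otimes> g \<in> M #> g" using that unfolding r_coset_def by blast
    then have "M #> (m \<otimes> g) = M #> g" using repr_independence[OF _ that(2) M] by simp
    then show ?thesis by (simp add: r_def)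
  qed
  have decomp: "\<exists>\<nu>\<in>N. \<exists>v\<in>V. g = \<nu> \<otimes> v \<otimes> r g" if g: "g \<in> carrier G" for g
  proof -
    have "M #> r g = M #> g" using repr_independence[OF r[OF g] g M] by simp
    then have "g \<in> M #> r g" using rcos_self[OF g M] by simp
    then show ?thesis unfolding r_coset_def M_def set_mult_def by blast
  qed
  define y where "y g = (SOME a. \<exists>\<nu>\<in>N. \<exists>v\<in>V. g = \<nu> \<otimes> v \<otimes> r g \<and> a = \<psi> \<nu>)" for g
  \<comment> \<open>Two decompositions of g differ by an element of N and V at once, where \<psi>
    vanishes; so the choice in \<open>y\<close> does not matter.\<close>
  have y_eq: "y g = \<psi> \<nu>" if g: "g \<in> carrier G" and \<nu>: "\<nu> \<in> N" "v \<in> V" "g = \<nu> \<otimes> v \<otimes> r g" for g \<nu> v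
  proof -
    have "\<exists>\<nu>'\<in>N. \<exists>v'\<in>V. g = \<nu>' \<otimes> v' \<otimes> r g \<and> y g = \<psi> \<nu>'"
      unfolding y_def by (rule someI[of _ "\<psi> \<nu>"]) (use \<nu> in blast)
    then obtain \<nu>' v' where \<nu>': "\<nu>' \<in> N" "v' \<in> V" "g = \<nu>' \<otimes> v' \<otimes> r g" "y g = \<psi> \<nu>'" by blast
    have carr: "\<nu> \<in> carrier G" "\<nu>' \<in> carrier G" "v \<in> carrier G" "v' \<in> carrier G"
      using \<nu> \<nu>' VG subset by auto
    have "\<nu>' \<otimes> v' = \<nu> \<otimes> v"
      using \<nu>(3) \<nu>'(3) r_carr[OF g] carr by (metis m_closed right_cancel)
    then have "inv \<nu> \<otimes> (\<nu>' \<otimes> v') \<otimes> inv v' = inv \<nu> \<otimes> (\<nu> \<otimes> v) \<otimes> inv v'" by simp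
    then have eq: "inv \<nu> \<otimes> \<nu>' = v \<otimes> inv v'" using carr by (simp add: m_assoc)
    have "inv \<nu> \<otimes> \<nu>' \<in> V" unfolding eq
      using subgroup.m_closed[OF V(1) \<nu>(2) subgroup.m_inv_closed[OF V(1) \<nu>'(2)]] .
    moreover have N': "inv \<nu> \<otimes> \<nu>' \<in> N" using \<nu> \<nu>' by simp
    ultimately have "\<psi> (inv \<nu> \<otimes> \<nu>') = \<zero>\<^sub>R" using V0 by blast
    moreover have "\<psi> \<nu>' = \<psi> (\<nu> \<otimes> (inv \<nu> \<otimes> \<nu>'))" using carr by simp
    ultimately have "\<psi> \<nu>' = \<psi> \<nu>" using \<psi>(2,3)[OF \<nu>(1)] N' by simp
    then show ?thesis using \<nu>'(4) by simp
  qed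
  have y_in: "y g \<in> carrier R" if "g \<in> carrier G" for g
    using decomp[OF that] y_eq[OF that] \<psi>(2) by metis
  have equi: "y (\<nu> \<otimes> g) = \<psi> \<nu> \<oplus>\<^sub>R y g" if \<nu>: "\<nu> \<in> N" and g: "g \<in> carrier G" for \<nu> g
  proof -
    obtain \<mu> v where \<mu>: "\<mu> \<in> N" "v \<in> V" "g = \<mu> \<otimes> v \<otimes> r g" using decomp[OF g] by blast
    have carr: "\<nu> \<in> carrier G" "\<mu> \<in> carrier G" "v \<in> carrier G" using \<nu> \<mu> VG subset by auto
    have rr: "r (\<nu> \<otimes> g) = r g"
      using r_eq[OF NVM[OF \<nu> subgroup.one_closed[OF V(1)]] g] carr by simp
    have "\<nu> \<otimes> g = \<nu> \<otimes> (\<mu> \<otimes> v \<otimes> r g)" using \<mu>(3) by simp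
    also have "\<dots> = (\<nu> \<otimes> \<mu>) \<otimes> v \<otimes> r (\<nu> \<otimes> g)"
      unfolding rr using carr r_carr[OF g] by (simp add: m_assoc)
    finally have "y (\<nu> \<otimes> g) = \<psi> (\<nu> \<otimes> \<mu>)"
      using \<nu> \<mu> carr g by (intro y_eq[of _ _ v]) auto
    then show ?thesis using y_eq[OF g \<mu>] \<psi>(3)[OF \<nu> \<mu>(1)] by simp
  qed
  have "continuous_map T D y"
    unfolding continuous_map_def
  proof (intro conjI allI impI)
    show "y \<in> topspace T \<rightarrow> topspace D" using y_in by (auto simp: topspace)
    fix W assume "openin D W"
    show "openin T {x \<in> topspace T. y x \<in> W}"
    proof (subst openin_subopen, intro ballI)
      fix g assume "g \<in> {x \<in> topspace T. y x \<in> W}"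
      then have g: "g \<in> carrier G" "y g \<in> W" by (auto simp: topspace)
      obtain \<nu> v where \<nu>: "\<nu> \<in> N" "v \<in> V" "g = \<nu> \<otimes> v \<otimes> r g" using decomp[OF g(1)] by blast
      have \<nu>G: "\<nu> \<in> carrier G" using \<nu> subset by auto
      have rg: "r g \<in> carrier G" by (rule r_carr[OF g(1)])
      \<comment> \<open>On this open neighbourhood of g the representative does not change, so y is
        constant there.\<close>
      let ?U = "(\<lambda>x. \<nu> \<otimes> x \<otimes> r g) ` V"
      have "?U \<subseteq> {x \<in> topspace T. y x \<in> W}"
      proof clarify
        fix x assume x: "x \<in> V"
        have xG: "x \<in> carrier G" "v \<in> carrier G" using x \<nu> VG by auto
        have "\<nu> \<otimes> x \<otimes> r g = \<nu> \<otimes> x \<otimes> inv (\<nu> \<otimes> v) \<otimes> (\<nu> \<otimes> v \<otimes> r g)"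
          using xG \<nu>G rg by (simp add: m_assoc inv_mult_group)
        also have "\<dots> = (\<nu> \<otimes> x) \<otimes> inv (\<nu> \<otimes> v) \<otimes> g" using \<nu>(3) by simp
        finally have *: "\<nu> \<otimes> x \<otimes> r g = (\<nu> \<otimes> x) \<otimes> inv (\<nu> \<otimes> v) \<otimes> g" .
        have "(\<nu> \<otimes> x) \<otimes> inv (\<nu> \<otimes> v) \<in> M"
          using subgroup.m_closed[OF M NVM[OF \<nu>(1) x] subgroup.m_inv_closed[OF M NVM[OF \<nu>(1,2)]]] .
        then have "r (\<nu> \<otimes> x \<otimes> r g) = r g" unfolding * using g(1) by (rule r_eq)
        then have "y (\<nu> \<otimes> x \<otimes> r g) = \<psi> \<nu>"
          using \<nu>G xG rg by (intro y_eq[OF _ \<nu>(1) x]) auto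
        then show "\<nu> \<otimes> x \<otimes> r g \<in> topspace T \<and> y (\<nu> \<otimes> x \<otimes> r g) \<in> W"
          using y_eq[OF g(1) \<nu>] g(2) \<nu>G xG rg by (simp add: topspace)
      qed
      moreover have "openin T ?U" by (rule openin_translate[OF topological_group \<nu>G rg V(2)])
      moreover have "g \<in> ?U" using \<nu> by blast
      ultimately show "\<exists>U. openin T U \<and> g \<in> U \<and> U \<subseteq> {x \<in> topspace T. y x \<in> W}" by blast
    qed
  qed
  then show ?thesis using equi that by blast
qed

text \<open>Writing g \<nu> h = (g \<nu> g^-1) g h, the invariance of \<psi> under conjugation turns
  left equivariance into equivariance in the middle; hence the coboundary depends on cosets
  only.\<close>

lemma transgression_witness:
  assumes prof: "profinite_group G T" and \<psi>: "\<psi> \<in> H1_invariants R G T N"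
  obtains y c where "continuous_map T D y" and "\<And>\<tau>. \<tau> \<in> N \<Longrightarrow> y \<tau> = \<psi> \<tau>"
    and "c \<in> extensional (carrier K \<times> carrier K)"
    and "\<And>g h. g \<in> carrier G \<Longrightarrow> h \<in> carrier G \<Longrightarrow> c (N #> g, N #> h) = coboundary R G y (g, h)"
proof -
  obtain y0 where y0: "continuous_map T D y0"
      "\<And>\<nu> g. \<nu> \<in> N \<Longrightarrow> g \<in> carrier G \<Longrightarrow> y0 (\<nu> \<otimes> g) = \<psi> \<nu> \<oplus>\<^sub>R y0 g"
    using equivariant_extension[OF assms] by blast
  note \<psi> = H1_invariants_props[OF \<psi>]
  \<comment> \<open>Subtracting the value at 1 keeps the equivariance and makes y restrict to \<psi>
    on N.\<close>
  define y where "y = (\<lambda>g. y0 g \<ominus>\<^sub>R y0 \<one>)"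
  have y0_in: "y0 g \<in> carrier R" if "g \<in> carrier G" for g using continuous_map_in[OF y0(1) that] .
  then have y_in: "y g \<in> carrier R" if "g \<in> carrier G" for g using that by (simp add: y_def)
  have yc: "continuous_map T D y"
    unfolding y_def using y0_in
    by (intro continuous_map_discrete_combine[OF y0(1) y0(1), where h = "\<lambda>a b. a \<ominus>\<^sub>R y0 \<one>"]) auto
  have left: "y (\<nu> \<otimes> g) = \<psi> \<nu> \<oplus>\<^sub>R y g" if "\<nu> \<in> N" "g \<in> carrier G" for \<nu> g
    using y0(2)[OF that] \<psi>(2) that y0_in by (simp add: y_def R.minus_eq R.a_assoc)
  have right: "y (g \<otimes> (\<nu> \<otimes> h)) = \<psi> \<nu> \<oplus>\<^sub>R y (g \<otimes> h)"
    if "\<nu> \<in> N" "g \<in> carrier G" "h \<in> carrier G" for \<nu> g h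
  proof -
    have "g \<otimes> (\<nu> \<otimes> h) = (g \<otimes> \<nu> \<otimes> inv g) \<otimes> (g \<otimes> h)" using that subset by (auto simp: m_assoc)
    moreover have "g \<otimes> \<nu> \<otimes> inv g \<in> N" using inv_op_closed2 that by blast
    ultimately show ?thesis using left \<psi>(5) that by simp
  qed
  have y_N: "y \<tau> = \<psi> \<tau>" if "\<tau> \<in> N" for \<tau>
  proof -
    have "y \<one> = \<zero>\<^sub>R" using y0_in by (simp add: y_def R.minus_eq R.r_neg)
    then show ?thesis using left[OF that one_closed] that subset \<psi>(2) by auto
  qed
  have dy: "coboundary R G y (\<mu> \<otimes> g, \<nu> \<otimes> h) = coboundary R G y (g, h)"
    if "\<mu> \<in> N" "\<nu> \<in> N" "g \<in> carrier G" "h \<in> carrier G" for \<mu> \<nu> g h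
  proof -
    have carr: "\<mu> \<in> carrier G" "\<nu> \<in> carrier G" using that subset by auto
    have "y (\<mu> \<otimes> g \<otimes> (\<nu> \<otimes> h)) = \<psi> \<mu> \<oplus>\<^sub>R (\<psi> \<nu> \<oplus>\<^sub>R y (g \<otimes> h))"
      using that carr left[OF that(1), of "g \<otimes> (\<nu> \<otimes> h)"] right by (simp add: m_assoc)
    then show ?thesis using that carr left \<psi>(2) y_in
      by (simp add: coboundary_def R.coboundary_shift)
  qed
  define rep where "rep C = (SOME g. g \<in> carrier G \<and> C = N #> g)" for C
  have rep: "\<exists>\<nu>\<in>N. rep (N #> g) = \<nu> \<otimes> g \<and> rep (N #> g) \<in> carrier G" if g: "g \<in> carrier G" for g
  proof -
    have "\<exists>h. h \<in> carrier G \<and> N #> g = N #> h" using g by blast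
    from someI_ex[OF this] have h: "rep (N #> g) \<in> carrier G" "N #> rep (N #> g) = N #> g"
      unfolding rep_def by auto
    then obtain \<nu> where "\<nu> \<in> N" "rep (N #> g) = \<nu> \<otimes> g"
      using coset_eq_iff[OF h(1) g] by blast
    then show ?thesis using h(1) by blast
  qed
  define c where "c = (\<lambda>(C, C') \<in> carrier K \<times> carrier K. coboundary R G y (rep C, rep C'))"
  have "c (N #> g, N #> h) = coboundary R G y (g, h)" if gh: "g \<in> carrier G" "h \<in> carrier G" for g h
  proof -
    obtain \<mu> where "\<mu> \<in> N" "rep (N #> g) = \<mu> \<otimes> g" using rep[OF gh(1)] by blast
    moreover obtain \<nu> where "\<nu> \<in> N" "rep (N #> h) = \<nu> \<otimes> h" using rep[OF gh(2)] by blast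
    ultimately show ?thesis using gh dy by (simp add: c_def)
  qed
  moreover have "c \<in> extensional (carrier K \<times> carrier K)" by (simp add: c_def)
  ultimately show ?thesis using that yc y_N by blast
qed

text \<open>Exactness of the five-term sequence at the invariants, \<open>vanish\<close> saying that
  restriction from G is zero. If the classes agree, y differs from y' and a cochain b of G/N by a
  continuous homomorphism on G, which is zero on N. So \<psi> and \<psi>' differ by the constant
  b(N), and evaluation at 1 shows that it is zero.\<close>

lemma inj_on_transgression:
  assumes prof: "profinite_group G T"
    and vanish: "\<And>f \<nu>. continuous_map T D f \<Longrightarrow>
      (\<And>g h. g \<in> carrier G \<Longrightarrow> h \<in> carrier G \<Longrightarrow> f (g \<otimes> h) = f g \<oplus>\<^sub>R f h) \<Longrightarrow>
      \<nu> \<in> N \<Longrightarrow> f \<nu> = \<zero>\<^sub>R"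
  shows "inj_on (transgression R G T N) (H1_invariants R G T N)"
proof (rule inj_onI)
  fix \<psi> \<psi>' assume \<psi>: "\<psi> \<in> H1_invariants R G T N" and \<psi>': "\<psi>' \<in> H1_invariants R G T N"
    and eq: "transgression R G T N \<psi> = transgression R G T N \<psi>'"
  obtain y c where y: "continuous_map T D y" "\<And>\<tau>. \<tau> \<in> N \<Longrightarrow> y \<tau> = \<psi> \<tau>"
    "c \<in> extensional (carrier K \<times> carrier K)"
    "\<And>g h. g \<in> carrier G \<Longrightarrow> h \<in> carrier G \<Longrightarrow> c (N #> g, N #> h) = coboundary R G y (g, h)"
    by (rule transgression_witness[OF prof \<psi>]) blast
  obtain y' c' where y': "continuous_map T D y'" "\<And>\<tau>. \<tau> \<in> N \<Longrightarrow> y' \<tau> = \<psi>' \<tau>"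
    "c' \<in> extensional (carrier K \<times> carrier K)"
    "\<And>g h. g \<in> carrier G \<Longrightarrow> h \<in> carrier G \<Longrightarrow> c' (N #> g, N #> h) = coboundary R G y' (g, h)"
    by (rule transgression_witness[OF prof \<psi>']) blast
  have H2_eq: "H2_class R K Q c = H2_class R K Q c'"
    using eq transgression_eq[OF y] transgression_eq[OF y'] by simp
  obtain b where b: "continuous_map Q D b"
    "\<And>g h. g \<in> carrier G \<Longrightarrow> h \<in> carrier G \<Longrightarrow>
      c (N #> g, N #> h) =
        (b (N #> h) \<ominus>\<^sub>R b (N #> (g \<otimes> h)) \<oplus>\<^sub>R b (N #> g)) \<oplus>\<^sub>R c' (N #> g, N #> h)"
    using H2_class_eqD[OF cocycle_of_coboundary[OF y'(1,3,4)] cocycle_of_coboundary[OF y(1,3,4)] H2_eq]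
    by blast
  define e where "e = (\<lambda>g. b (N #> g) \<oplus>\<^sub>R y' g)"
  define f where "f = (\<lambda>g. y g \<ominus>\<^sub>R e g)"
  note in_R = continuous_map_in[OF y(1)] continuous_map_in[OF y'(1)]
    continuous_map_quotient_in[OF b(1) coset_in]
  have ec: "continuous_map T D e"
    unfolding e_def
    by (intro continuous_map_discrete_combine[OF continuous_map_coset_compose[OF b(1)] y'(1),
          where h = "\<lambda>a b. a \<oplus>\<^sub>R b"]) auto
  have fc: "continuous_map T D f"
    unfolding f_def
    by (intro continuous_map_discrete_combine[OF y(1) ec, where h = "\<lambda>a b. a \<ominus>\<^sub>R b"]) auto
  note e_in = continuous_map_in[OF ec] and f_in = continuous_map_in[OF fc]
  have "f (g \<otimes> h) = f g \<oplus>\<^sub>R f h" if gh: "g \<in> carrier G" "h \<in> carrier G" for g h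
  proof -
    have "y h \<ominus>\<^sub>R y (g \<otimes> h) \<oplus>\<^sub>R y g = e h \<ominus>\<^sub>R e (g \<otimes> h) \<oplus>\<^sub>R e g"
      using b(2)[OF gh] gh in_R
      by (simp add: y y' coboundary_def e_def R.coboundary_add)
    then have "(f h \<ominus>\<^sub>R f (g \<otimes> h) \<oplus>\<^sub>R f g) \<oplus>\<^sub>R (e h \<ominus>\<^sub>R e (g \<otimes> h) \<oplus>\<^sub>R e g) =
        \<zero>\<^sub>R \<oplus>\<^sub>R (e h \<ominus>\<^sub>R e (g \<otimes> h) \<oplus>\<^sub>R e g)"
      using gh in_R e_in by (simp add: f_def R.coboundary_diff)
    then have "f h \<ominus>\<^sub>R f (g \<otimes> h) \<oplus>\<^sub>R f g = \<zero>\<^sub>R"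
      using gh e_in f_in by (subst (asm) R.add.right_cancel) auto
    then have "(f g \<oplus>\<^sub>R f h) \<ominus>\<^sub>R f (g \<otimes> h) = \<zero>\<^sub>R"
      using gh f_in by (simp add: R.minus_eq R.a_ac)
    then show ?thesis
      using R.minus_add_cancel[of "f (g \<otimes> h)" "f g \<oplus>\<^sub>R f h"] gh f_in by simp
  qed
  then have f0: "f \<nu> = \<zero>\<^sub>R" if "\<nu> \<in> N" for \<nu>
    using vanish[OF fc _ that] by blast
  have ye: "\<psi> \<nu> = b N \<oplus>\<^sub>R \<psi>' \<nu>" if "\<nu> \<in> N" for \<nu>
  proof -
    have \<nu>G: "\<nu> \<in> carrier G" using that subset by auto
    have "N #> \<nu> = N" using that \<nu>G by (simp add: coset_join2 is_subgroup)
    moreover have "y \<nu> = e \<nu>"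
      using f0[OF that] R.minus_add_cancel[of "e \<nu>" "y \<nu>"] in_R e_in \<nu>G by (simp add: f_def)
    ultimately show ?thesis using y(2) y'(2) that by (simp add: e_def)
  qed
  have "b N \<in> carrier R" using continuous_map_quotient_in[OF b(1) coset_in[OF one_closed]] subset by simp
  then have "b N = \<zero>\<^sub>R"
    using ye[OF subgroup.one_closed[OF is_subgroup]] H1_invariants_props(6)[OF \<psi>] H1_invariants_props(6)[OF \<psi>'] by simp
  then have "\<psi> \<nu> = \<psi>' \<nu>" if "\<nu> \<in> N" for \<nu>
    using ye[OF that] H1_invariants_props(2)[OF \<psi>' that] by simp
  then show "\<psi> = \<psi>'"
    by (rule extensionalityI[OF H1_invariants_props(1)[OF \<psi>] H1_invariants_props(1)[OF \<psi>']])
qed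

end

section \<open>Unitriangular matrices modulo an integer\<close>

text \<open>Inverses are powers in a finite group, so conditions on matrix entries have to be tested
  on products only.\<close>

lemma (in group) finite_submonoid_subgroup:
  assumes "finite (carrier G)" "H \<subseteq> carrier G" "\<one> \<in> H"
    and closed: "\<And>x y. x \<in> H \<Longrightarrow> y \<in> H \<Longrightarrow> x \<otimes> y \<in> H"
  shows "subgroup H G"
proof (rule subgroupI)
  fix a assume a: "a \<in> H"
  then have aG: "a \<in> carrier G" using assms(2) by blast
  have pow: "a [^] k \<in> H" for k :: nat
    by (induction k) (use a assms(3) closed in auto)
  have "order G > 0" using assms(1) aG by (auto simp: order_def card_gt_0_iff)
  then have "a [^] (order G - 1) \<otimes> a = \<one>"
    using pow_order_eq_1[OF aG] by (metis Suc_diff_1 nat_pow_Suc)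
  then have "inv a = a [^] (order G - 1)" using aG by (intro inv_equality) auto
  then show "inv a \<in> H" using pow by simp
qed (use assms in auto)

lemma dvd_mod_diff:
  "(g :: int) dvd m \<Longrightarrow> g dvd x mod m - y \<longleftrightarrow> g dvd x - y"
  by (metis dvd_mod_iff mod_diff_left_eq)

lemma residue_ring_simps [simp]:
  "carrier (residue_ring m) = {0..m - 1}" "\<one>\<^bsub>residue_ring m\<^esub> = 1" "\<zero>\<^bsub>residue_ring m\<^esub> = 0"
  "x \<otimes>\<^bsub>residue_ring m\<^esub> y = x * y mod m" "x \<oplus>\<^bsub>residue_ring m\<^esub> y = (x + y) mod m"
  by (simp_all add: residue_ring_def)

lemma finsum_residue_ring:
  assumes "1 < m" "finite A" "\<And>k. k \<in> A \<Longrightarrow> f k \<in> {0..m - 1}"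
  shows "finsum (residue_ring m) f A = (\<Sum>k\<in>A. f k) mod m"
proof -
  interpret residues m "residue_ring m" using assms(1) by unfold_locales
  interpret cring "residue_ring m" by (rule cring)
  show ?thesis using assms(2,3)
  proof (induction A)
    case empty then show ?case by (simp only: finsum_empty) simp
  next
    case (insert a A)
    then have "finsum (residue_ring m) f (insert a A) = f a \<oplus>\<^bsub>residue_ring m\<^esub> finsum (residue_ring m) f A"
      by (intro finsum_insert) auto
    then show ?case using insert by (simp add: mod_add_right_eq)
  qed
qed

locale unitriangular =
  fixes m :: int and s :: nat
  assumes m_gt_1: "1 < m"
begin

abbreviation "U \<equiv> unitriangular_group (residue_ring m) s"
abbreviation mult_U (infixl "\<cdot>" 70) where "A \<cdot> B \<equiv> A \<otimes>\<^bsub>U\<^esub> B"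

lemma carrier_iff:
  "A \<in> carrier U \<longleftrightarrow> A \<in> extensional ({1..s+1} \<times> {1..s+1}) \<and>
    (\<forall>i\<in>{1..s+1}. \<forall>j\<in>{1..s+1}. 0 \<le> A (i, j) \<and> A (i, j) < m \<and>
      (i = j \<longrightarrow> A (i, j) = 1) \<and> (j < i \<longrightarrow> A (i, j) = 0))"
  by (auto simp: unitriangular_group_def PiE_def Pi_iff)

lemma entry:
  assumes "A \<in> carrier U"
  shows "\<And>i. 1 \<le> i \<Longrightarrow> i \<le> s + 1 \<Longrightarrow> A (i, i) = 1"
    "\<And>i j. 1 \<le> j \<Longrightarrow> j < i \<Longrightarrow> i \<le> s + 1 \<Longrightarrow> A (i, j) = 0"
    "\<And>i j. 1 \<le> i \<Longrightarrow> i \<le> s + 1 \<Longrightarrow> 1 \<le> j \<Longrightarrow> j \<le> s + 1 \<Longrightarrow> 0 \<le> A (i, j)"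
    "\<And>i j. 1 \<le> i \<Longrightarrow> i \<le> s + 1 \<Longrightarrow> 1 \<le> j \<Longrightarrow> j \<le> s + 1 \<Longrightarrow> A (i, j) < m"
  using assms unfolding carrier_iff by auto

lemma matrix_eqI:
  assumes "A \<in> carrier U" "B \<in> carrier U"
    and "\<And>i j. 1 \<le> i \<Longrightarrow> i < j \<Longrightarrow> j \<le> s + 1 \<Longrightarrow> A (i, j) = B (i, j)"
  shows "A = B"
proof (rule extensionalityI[of _ "{1..s+1} \<times> {1..s+1}"])
  show "A \<in> extensional ({1..s+1} \<times> {1..s+1})" "B \<in> extensional ({1..s+1} \<times> {1..s+1})"
    using assms(1,2) by (simp_all only: carrier_iff)
  fix x assume "x \<in> {1..s+1} \<times> {1..s+1}"
  then obtain i j where x: "x = (i, j)" and ij: "1 \<le> i" "i \<le> s + 1" "1 \<le> j" "j \<le> s + 1" by auto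
  consider "i < j" | "i = j" | "j < i" by linarith
  then show "A x = B x"
    by cases (use x ij assms(3) entry[OF assms(1)] entry[OF assms(2)] in auto)
qed

text \<open>Reduction is postponed to the end: products are computed with integers, and divisibility
  by a divisor of m does not see the final \<open>mod\<close>.\<close>

lemma mult_full:
  assumes "A \<in> carrier U" "B \<in> carrier U" "i \<in> {1..s+1}" "j \<in> {1..s+1}"
  shows "(A \<cdot> B) (i, j) = (\<Sum>k\<in>{1..s+1}. A (i, k) * B (k, j)) mod m"
proof -
  have "(A \<cdot> B) (i, j) = (\<Oplus>\<^bsub>residue_ring m\<^esub>k\<in>{1..s+1}. A (i, k) * B (k, j) mod m)"
    using assms(3,4) by (simp add: unitriangular_group_def)
  also have "\<dots> = (\<Sum>k\<in>{1..s+1}. A (i, k) * B (k, j) mod m) mod m"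
    using m_gt_1 by (intro finsum_residue_ring) auto
  also have "\<dots> = (\<Sum>k\<in>{1..s+1}. A (i, k) * B (k, j)) mod m" by (rule mod_sum_eq)
  finally show ?thesis .
qed

lemma mult_interval:
  assumes A: "A \<in> carrier U" and B: "B \<in> carrier U" and ij: "i \<in> {1..s+1}" "j \<in> {1..s+1}"
  shows "(A \<cdot> B) (i, j) = (\<Sum>k\<in>{i..j}. A (i, k) * B (k, j)) mod m"
proof -
  have "(\<Sum>k\<in>{1..s+1}. A (i, k) * B (k, j)) = (\<Sum>k\<in>{i..j}. A (i, k) * B (k, j))"
  proof (rule sum.mono_neutral_right)
    show "\<forall>k\<in>{1..s+1} - {i..j}. A (i, k) * B (k, j) = 0"
    proof
      fix k assume k: "k \<in> {1..s+1} - {i..j}"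
      then consider "k < i" | "j < k" by fastforce
      then show "A (i, k) * B (k, j) = 0"
        by cases (use k ij entry(2)[OF A] entry(2)[OF B] in auto)
    qed
  qed (use ij in auto)
  then show ?thesis using mult_full[OF assms] by simp
qed

text \<open>This is (I + a)(I + b) = I + a + b + a b above the diagonal, the sum being the entry of
  a b.\<close>

lemma mult_above:
  assumes A: "A \<in> carrier U" and B: "B \<in> carrier U" and ij: "1 \<le> i" "i < j" "j \<le> s + 1"
  shows "(A \<cdot> B) (i, j) = (A (i, j) + B (i, j) + (\<Sum>k\<in>{i<..<j}. A (i, k) * B (k, j))) mod m"
proof -
  have "{i..j} = insert i (insert j {i<..<j})" using ij by auto
  then have "(\<Sum>k\<in>{i..j}. A (i, k) * B (k, j)) =
      A (i, i) * B (i, j) + (A (i, j) * B (j, j) + (\<Sum>k\<in>{i<..<j}. A (i, k) * B (k, j)))"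
    using ij by simp
  then show ?thesis
    using mult_interval[OF A B, of i j] ij entry(1)[OF A, of i] entry(1)[OF B, of j]
    by (simp add: algebra_simps)
qed

lemma mult_closed:
  assumes A: "A \<in> carrier U" and B: "B \<in> carrier U"
  shows "A \<cdot> B \<in> carrier U"
  unfolding carrier_iff
proof (intro conjI ballI)
  show "A \<cdot> B \<in> extensional ({1..s+1} \<times> {1..s+1})"
    by (simp add: unitriangular_group_def)
  fix i j assume ij: "i \<in> {1..s+1}" "j \<in> {1..s+1}"
  note eq = mult_interval[OF A B ij]
  show "0 \<le> (A \<cdot> B) (i, j)" "(A \<cdot> B) (i, j) < m"
    unfolding eq using m_gt_1 by auto
  show "i = j \<longrightarrow> (A \<cdot> B) (i, j) = 1"
    unfolding eq using m_gt_1 ij entry(1)[OF A] entry(1)[OF B] by auto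
  show "j < i \<longrightarrow> (A \<cdot> B) (i, j) = 0" unfolding eq by auto
qed

lemma one_entry: "i \<in> {1..s+1} \<Longrightarrow> j \<in> {1..s+1} \<Longrightarrow> \<one>\<^bsub>U\<^esub> (i, j) = (if i = j then 1 else 0)"
  by (simp add: unitriangular_group_def)

lemma one_in: "\<one>\<^bsub>U\<^esub> \<in> carrier U"
  unfolding carrier_iff
proof (intro conjI ballI)
  show "\<one>\<^bsub>U\<^esub> \<in> extensional ({1..s+1} \<times> {1..s+1})"
    by (simp add: unitriangular_group_def)
qed (use m_gt_1 one_entry in auto)

lemma finite_carrier: "finite (carrier U)"
proof (rule finite_subset)
  show "carrier U \<subseteq> ({1..s+1} \<times> {1..s+1}) \<rightarrow>\<^sub>E {0..m - 1}"
    unfolding unitriangular_group_def by (auto simp: Pi_iff PiE_def)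
qed (intro finite_PiE, auto)

text \<open>Left inverses come from counting: right multiplication by x is injective, since each row
  of y is recovered from y x column by column, and the carrier is finite.\<close>

lemma group: "group U"
proof (rule groupI)
  show "x \<cdot> y \<in> carrier U" if "x \<in> carrier U" "y \<in> carrier U" for x y
    using that by (rule mult_closed)
  show "\<one>\<^bsub>U\<^esub> \<in> carrier U" by (rule one_in)
  show one: "\<one>\<^bsub>U\<^esub> \<cdot> x = x" if x: "x \<in> carrier U" for x
  proof (rule matrix_eqI[OF mult_closed[OF one_in x] x])
    fix i j assume ij: "1 \<le> i" "i < j" "j \<le> s + 1"
    have "(\<Sum>k\<in>{i<..<j}. \<one>\<^bsub>U\<^esub> (i, k) * x (k, j)) = 0"
      by (rule sum.neutral) (use ij one_entry in auto)
    then show "(\<one>\<^bsub>U\<^esub> \<cdot> x) (i, j) = x (i, j)"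
      using ij mult_above[OF one_in x ij] one_entry[of i j] entry(3,4)[OF x, of i j] by simp
  qed
  show "x \<cdot> y \<cdot> z = x \<cdot> (y \<cdot> z)"
    if xyz: "x \<in> carrier U" "y \<in> carrier U" "z \<in> carrier U" for x y z
  proof (rule matrix_eqI)
    fix i j assume "1 \<le> i" "i < j" "j \<le> s + 1"
    then have ij: "i \<in> {1..s+1}" "j \<in> {1..s+1}" by auto
    let ?I = "{1..s+1}"
    have "(x \<cdot> y \<cdot> z) (i, j) =
        (\<Sum>l\<in>?I. (\<Sum>k\<in>?I. x (i, k) * y (k, l)) mod m * z (l, j)) mod m"
      using xyz mult_closed ij by (simp add: mult_full del: sum.cl_ivl_Suc)
    also have "\<dots> = (\<Sum>l\<in>?I. (\<Sum>k\<in>?I. x (i, k) * y (k, l)) * z (l, j)) mod m"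
      by (subst (1 2) mod_sum_eq[symmetric]) (simp only: mod_mult_left_eq)
    also have "(\<Sum>l\<in>?I. (\<Sum>k\<in>?I. x (i, k) * y (k, l)) * z (l, j)) =
        (\<Sum>l\<in>?I. \<Sum>k\<in>?I. x (i, k) * (y (k, l) * z (l, j)))"
      by (simp only: sum_distrib_right mult.assoc)
    also have "\<dots> = (\<Sum>k\<in>?I. \<Sum>l\<in>?I. x (i, k) * (y (k, l) * z (l, j)))"
      by (rule sum.swap)
    also have "\<dots> = (\<Sum>k\<in>?I. x (i, k) * (\<Sum>l\<in>?I. y (k, l) * z (l, j)))"
      by (simp only: sum_distrib_left)
    also have "\<dots> mod m = (\<Sum>k\<in>?I. x (i, k) * ((\<Sum>l\<in>?I. y (k, l) * z (l, j)) mod m)) mod m"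
      by (subst (1 2) mod_sum_eq[symmetric]) (simp only: mod_mult_right_eq)
    also have "\<dots> = (x \<cdot> (y \<cdot> z)) (i, j)"
      using xyz mult_closed ij by (simp add: mult_full del: sum.cl_ivl_Suc)
    finally show "(x \<cdot> y \<cdot> z) (i, j) = (x \<cdot> (y \<cdot> z)) (i, j)" .
  qed (use xyz mult_closed in auto)
  show "\<exists>y\<in>carrier U. y \<cdot> x = \<one>\<^bsub>U\<^esub>" if x: "x \<in> carrier U" for x
  proof -
    have "inj_on (\<lambda>y. y \<cdot> x) (carrier U)"
    proof (rule inj_onI)
      fix y z assume y: "y \<in> carrier U" and z: "z \<in> carrier U" and eq: "y \<cdot> x = z \<cdot> x"
      show "y = z"
      proof (rule matrix_eqI[OF y z])
        fix i j assume "1 \<le> i" "i < j" "j \<le> s + 1"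
        then show "y (i, j) = z (i, j)"
        proof (induction j rule: less_induct)
          case (less j)
          have sum: "(\<Sum>k\<in>{i<..<j}. y (i, k) * x (k, j)) = (\<Sum>k\<in>{i<..<j}. z (i, k) * x (k, j))"
            using less by (intro sum.cong) auto
          let ?c = "x (i, j) + (\<Sum>k\<in>{i<..<j}. z (i, k) * x (k, j))"
          have "(y (i, j) + ?c) mod m = (z (i, j) + ?c) mod m"
            using mult_above[OF y x less.prems] mult_above[OF z x less.prems] eq sum
            by (simp add: add.assoc)
          then have "(y (i, j) + ?c - ?c) mod m = (z (i, j) + ?c - ?c) mod m"
            by (rule mod_diff_cong) simp
          then show ?case
            using entry(3,4)[OF y, of i j] entry(3,4)[OF z, of i j] less.prems by simp
        qed
      qed
    qed
    then have "(\<lambda>y. y \<cdot> x) ` carrier U = carrier U"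
      using finite_carrier mult_closed x by (intro endo_inj_surj) auto
    then show ?thesis using one_in by (metis imageE)
  qed
qed

sublocale group U by (rule group)

text \<open>The condition on f is what the sum in \<open>mult_above\<close> demands. It serves the
  filtration of U as well as the series in a single letter.\<close>

lemma subgroup_dvd:
  assumes "\<And>i j. f i j dvd m"
    and "\<And>i k j. 1 \<le> i \<Longrightarrow> i < k \<Longrightarrow> k < j \<Longrightarrow> j \<le> s + 1 \<Longrightarrow> f i j dvd f i k * f k j"
  shows "subgroup {A \<in> carrier U. \<forall>i j. 1 \<le> i \<longrightarrow> i < j \<longrightarrow> j \<le> s + 1 \<longrightarrow> f i j dvd A (i, j)} U"
    (is "subgroup ?H U")
proof (rule finite_submonoid_subgroup[OF finite_carrier])
  show "\<one>\<^bsub>U\<^esub> \<in> ?H" using one_in one_entry by simp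
  fix A B assume A: "A \<in> ?H" and B: "B \<in> ?H"
  then have AB: "A \<in> carrier U" "B \<in> carrier U" by auto
  have "f i j dvd (A \<cdot> B) (i, j)" if ij: "1 \<le> i" "i < j" "j \<le> s + 1" for i j
  proof -
    have "f i j dvd A (i, k) * B (k, j)" if "k \<in> {i<..<j}" for k
    proof (rule dvd_trans[OF assms(2)[of i k j]])
      show "f i k * f k j dvd A (i, k) * B (k, j)"
        using A B ij that by (intro mult_dvd_mono) auto
    qed (use ij that in auto)
    then have "f i j dvd A (i, j) + B (i, j) + (\<Sum>k\<in>{i<..<j}. A (i, k) * B (k, j))"
      using A B ij by (intro dvd_add dvd_sum) auto
    then show ?thesis using mult_above[OF AB ij] dvd_mod_iff[OF assms(1)] by simp
  qed
  then show "A \<cdot> B \<in> ?H" using AB by simp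
qed auto

text \<open>In the next two lemmas, \<open>f\<close>, \<open>g\<close>, \<open>h\<close> take divisors of \<open>m\<close> as values, and the value \<open>m\<close>
  forces an entry to vanish.  Write \<open>A = I + a\<close> and \<open>B = I + b\<close>: then \<open>A\<^sup>r = I + r a + \<dots>\<close>, where the
  omitted terms lie in \<open>a\<^sup>2 \<int>[a]\<close>, and \<open>B A ([A, B] - I) = a b - b a\<close>.\<close>

lemma pow_entry_dvd:
  assumes A: "A \<in> carrier U"
    and f: "\<And>i j. 1 \<le> i \<Longrightarrow> i < j \<Longrightarrow> j \<le> s + 1 \<Longrightarrow> f i j dvd A (i, j)"
    and g: "\<And>i j. g i j dvd m"
    and ff: "\<And>i k j. 1 \<le> i \<Longrightarrow> i < k \<Longrightarrow> k < j \<Longrightarrow> j \<le> s + 1 \<Longrightarrow> g i j dvd f i k * f k j"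
    and gf: "\<And>i k j. 1 \<le> i \<Longrightarrow> i < k \<Longrightarrow> k < j \<Longrightarrow> j \<le> s + 1 \<Longrightarrow> g i j dvd g i k * f k j"
    and ij: "1 \<le> i" "i < j" "j \<le> s + 1"
  shows "g i j dvd (A [^]\<^bsub>U\<^esub> r) (i, j) - int r * A (i, j)"
  using ij
proof (induction r arbitrary: i j)
  case 0
  then show ?case using one_entry by simp
next
  case (Suc r)
  let ?P = "A [^]\<^bsub>U\<^esub> r"
  have P: "?P \<in> carrier U" using A by simp
  \<comment> \<open>The entry of the power is r times that of A up to an error divisible by
    \<open>g i k\<close>; \<open>gf\<close> takes care of the error and \<open>ff\<close> of the
    main term.\<close>
  have "g i j dvd ?P (i, k) * A (k, j)" if k: "k \<in> {i<..<j}" for k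
  proof -
    have fk: "f k j dvd A (k, j)" using k Suc.prems by (intro f) auto
    have "g i k * f k j dvd (?P (i, k) - int r * A (i, k)) * A (k, j)"
      using k Suc.prems by (intro mult_dvd_mono Suc.IH fk) auto
    moreover have "g i j dvd g i k * f k j" using k Suc.prems by (intro gf) auto
    ultimately have 1: "g i j dvd (?P (i, k) - int r * A (i, k)) * A (k, j)"
      using dvd_trans by blast
    have "f i k * f k j dvd A (i, k) * A (k, j)"
      using k Suc.prems by (intro mult_dvd_mono f) auto
    moreover have "g i j dvd f i k * f k j" using k Suc.prems by (intro ff) auto
    ultimately have "g i j dvd int r * (A (i, k) * A (k, j))" using dvd_trans dvd_mult by blast
    from dvd_add[OF 1 this] show ?thesis by (simp add: algebra_simps)
  qed
  then have "g i j dvd (\<Sum>k\<in>{i<..<j}. ?P (i, k) * A (k, j))" by (intro dvd_sum)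
  from dvd_add[OF Suc.IH[OF Suc.prems] this]
  have "g i j dvd (?P (i, j) + A (i, j) + (\<Sum>k\<in>{i<..<j}. ?P (i, k) * A (k, j)))
      - int (Suc r) * A (i, j)"
    by (simp add: algebra_simps)
  then show ?case using mult_above[OF P A Suc.prems] dvd_mod_diff[OF g] by simp
qed

lemma commutator_entry_dvd:
  assumes A: "A \<in> carrier U" and B: "B \<in> carrier U"
    and fA: "\<And>i j. 1 \<le> i \<Longrightarrow> i < j \<Longrightarrow> j \<le> s + 1 \<Longrightarrow> f i j dvd A (i, j)"
    and gB: "\<And>i j. 1 \<le> i \<Longrightarrow> i < j \<Longrightarrow> j \<le> s + 1 \<Longrightarrow> g i j dvd B (i, j)"
    and h: "\<And>i j. h i j dvd m"
    and fg: "\<And>i k j. 1 \<le> i \<Longrightarrow> i < k \<Longrightarrow> k < j \<Longrightarrow> j \<le> s + 1 \<Longrightarrow> h i j dvd f i k * g k j"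
    and gf: "\<And>i k j. 1 \<le> i \<Longrightarrow> i < k \<Longrightarrow> k < j \<Longrightarrow> j \<le> s + 1 \<Longrightarrow> h i j dvd g i k * f k j"
    and hh: "\<And>i k j. 1 \<le> i \<Longrightarrow> i < k \<Longrightarrow> k < j \<Longrightarrow> j \<le> s + 1 \<Longrightarrow> h i j dvd h k j"
    and ij: "1 \<le> i" "i < j" "j \<le> s + 1"
  shows "h i j dvd commutator U A B (i, j)"
  using ij
proof (induction "j - i" arbitrary: i rule: less_induct)
  case less
  note ij = less.prems
  let ?C = "commutator U A B" and ?P = "B \<cdot> A"
  have C: "?C \<in> carrier U" and P: "?P \<in> carrier U" using A B by simp_all
  \<comment> \<open>Treating the commutator as the solution C of (B A) C = A B spares computing with
    inverse matrices.\<close>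
  have eq: "?P \<cdot> ?C = A \<cdot> B"
    using A B by (simp add: commutator_def m_assoc)
  let ?AB = "\<Sum>k\<in>{i<..<j}. A (i, k) * B (k, j)" and ?BA = "\<Sum>k\<in>{i<..<j}. B (i, k) * A (k, j)"
    and ?PC = "\<Sum>k\<in>{i<..<j}. ?P (i, k) * ?C (k, j)"
  have "[?P (i, j) + ?C (i, j) + ?PC = A (i, j) + B (i, j) + ?AB] (mod m)"
    using mult_above[OF P C ij] mult_above[OF A B ij] eq by (simp add: cong_def)
  moreover have "[?P (i, j) = B (i, j) + A (i, j) + ?BA] (mod m)"
    using mult_above[OF B A ij] by (simp add: cong_def)
  ultimately have "[(?P (i, j) + ?C (i, j) + ?PC) - ?P (i, j) =
      (A (i, j) + B (i, j) + ?AB) - (B (i, j) + A (i, j) + ?BA)] (mod m)"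
    by (rule cong_diff)
  then have "m dvd (?C (i, j) + ?PC) - (?AB - ?BA)" by (simp add: cong_iff_dvd_diff algebra_simps)
  then have 1: "h i j dvd (?C (i, j) + ?PC) - (?AB - ?BA)" using h dvd_trans by blast
  have "h i j dvd ?AB"
  proof (rule dvd_sum)
    fix k assume k: "k \<in> {i<..<j}"
    show "h i j dvd A (i, k) * B (k, j)"
    proof (rule dvd_trans[OF fg[of i k j]])
      show "f i k * g k j dvd A (i, k) * B (k, j)" using k ij by (intro mult_dvd_mono fA gB) auto
    qed (use k ij in auto)
  qed
  moreover have "h i j dvd ?BA"
  proof (rule dvd_sum)
    fix k assume k: "k \<in> {i<..<j}"
    show "h i j dvd B (i, k) * A (k, j)"
    proof (rule dvd_trans[OF gf[of i k j]])
      show "g i k * f k j dvd B (i, k) * A (k, j)" using k ij by (intro mult_dvd_mono fA gB) auto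
    qed (use k ij in auto)
  qed
  \<comment> \<open>Nothing is known about the entries of B A, so the divisibility has to come from
    C at (k, j), which is nearer to the diagonal; \<open>hh\<close> makes this enough.\<close>
  moreover have "h i j dvd ?PC"
  proof (rule dvd_sum)
    fix k assume k: "k \<in> {i<..<j}"
    then have "h k j dvd ?C (k, j)" using ij by (intro less.hyps) auto
    moreover have "h i j dvd h k j" using k ij by (intro hh) auto
    ultimately show "h i j dvd ?P (i, k) * ?C (k, j)" by (meson dvd_mult dvd_trans)
  qed
  ultimately have "h i j dvd (?AB - ?BA) - ?PC" by (intro dvd_diff)
  from dvd_add[OF 1 this] show ?case by simp
qed

lemma topological_group_discrete: "topological_group U (discrete_topology (carrier U))"
  using finite_discrete_profinite[OF group finite_carrier] unfolding profinite_group_def by blast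

end

section \<open>The lower p-central filtration of unitriangular matrices\<close>

locale unitriangular_p = unitriangular m s for m s +
  fixes p n :: nat
  assumes m_eq: "m = int (p ^ (n - s + 1))" and prime: "prime p" and s: "1 \<le> s" "s \<le> n" and n: "2 \<le> n"
begin

abbreviation "C \<equiv> lower_p_central p U (discrete_topology (carrier U)) n"

lemma m_eq': "m = int p * int p ^ (n - s)" "m = int p ^ Suc (n - s)" by (simp_all add: m_eq)

lemma p_gt_1: "1 < p" using prime prime_gt_1_nat by blast

text \<open>The power p^t capped at m = p^(n-s+1). The cap makes it a divisor of m, as the entrywise
  lemmas require, and the value m expresses that an entry vanishes.\<close>

definition q :: "nat \<Rightarrow> int" where "q t = gcd (int p ^ t) m"

lemma q_dvd: "q t dvd m" by (simp add: q_def)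

lemma q_0 [simp]: "q 0 = 1" by (simp add: q_def)

lemma q_mono: "t \<le> t' \<Longrightarrow> q t dvd q t'"
  unfolding q_def by (intro gcd_mono le_imp_power_dvd) auto

lemma q_Suc: "q (Suc t) dvd int p * q t"
proof -
  have "int p * q t = gcd (int p * int p ^ t) (int p * m)"
    unfolding q_def using gcd_mult_distrib_int[of "int p"] by simp
  moreover have "q (Suc t) dvd gcd (int p * int p ^ t) (int p * m)"
    unfolding q_def by (intro gcd_mono) auto
  ultimately show ?thesis by simp
qed

lemma q_small:
  assumes "t \<le> n - s" shows "q t = int p ^ t"
proof -
  have "int p ^ t dvd m" unfolding m_eq'(2) using assms by (intro le_imp_power_dvd) simp
  then show ?thesis by (simp add: q_def gcd_proj1_if_dvd)
qed

lemma q_large: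
  assumes "n - s < t" shows "q t = m"
proof -
  have "m dvd int p ^ t" unfolding m_eq'(2) using assms by (intro le_imp_power_dvd) simp
  then show ?thesis using m_gt_1 by (simp add: q_def gcd_proj2_if_dvd)
qed

text \<open>An upper bound for U^(k,p): at distance d from the diagonal, entries are divisible by
  p^(k-d). By truncated subtraction there is no condition once d \<ge> k.\<close>

definition filtration :: "nat \<Rightarrow> (nat \<times> nat \<Rightarrow> int) set" where
  "filtration k = {A \<in> carrier U. \<forall>i j. 1 \<le> i \<longrightarrow> i < j \<longrightarrow> j \<le> s + 1 \<longrightarrow> q (k - (j - i)) dvd A (i, j)}"

lemma filtration_subgroup: "subgroup (filtration k) U"
  unfolding filtration_def
proof (rule subgroup_dvd)
  fix i l j :: nat assume "1 \<le> i" "i < l" "l < j" "j \<le> s + 1"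
  then show "q (k - (j - i)) dvd q (k - (l - i)) * q (k - (j - l))"
    by (intro dvd_mult2 q_mono) auto
qed (rule q_dvd)

lemma filtration_1: "filtration 1 = carrier U"
  unfolding filtration_def by auto

text \<open>The linear term p a gains a factor p. In a product of two entries the first is strictly
  nearer to the diagonal than (i, j), and this alone raises the exponent by one.\<close>

lemma filtration_pow:
  assumes "A \<in> filtration k" "1 \<le> k"
  shows "A [^]\<^bsub>U\<^esub> p \<in> filtration (Suc k)"
proof -
  have A: "A \<in> carrier U" and dvd: "\<And>i j. 1 \<le> i \<Longrightarrow> i < j \<Longrightarrow> j \<le> s + 1 \<Longrightarrow> q (k - (j - i)) dvd A (i, j)"
    using assms(1) unfolding filtration_def by auto
  have "q (Suc k - (j - i)) dvd (A [^]\<^bsub>U\<^esub> p) (i, j)" if ij: "1 \<le> i" "i < j" "j \<le> s + 1" for i j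
  proof -
    have "q (Suc k - (j - i)) dvd (A [^]\<^bsub>U\<^esub> p) (i, j) - int p * A (i, j)"
    proof (rule pow_entry_dvd[OF A dvd])
      fix i l j :: nat assume "1 \<le> i" "i < l" "l < j" "j \<le> s + 1"
      then show "q (Suc k - (j - i)) dvd q (k - (l - i)) * q (k - (j - l))"
        "q (Suc k - (j - i)) dvd q (Suc k - (l - i)) * q (k - (j - l))"
        by (intro dvd_mult2 q_mono; simp)+
    qed (use ij q_dvd in auto)
    moreover have "q (Suc k - (j - i)) dvd int p * A (i, j)"
    proof (cases "j - i \<le> k")
      case True
      then have "q (Suc k - (j - i)) dvd int p * q (k - (j - i))"
        using q_Suc[of "k - (j - i)"] by (simp add: Suc_diff_le)
      moreover have "int p * q (k - (j - i)) dvd int p * A (i, j)" using dvd[OF ij] by (rule mult_dvd_mono[OF dvd_refl])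
      ultimately show ?thesis by (rule dvd_trans)
    qed simp
    ultimately show ?thesis by (metis dvd_add diff_add_cancel)
  qed
  then show ?thesis using A unfolding filtration_def by simp
qed

text \<open>In a b - b a the entry of b is strictly nearer to the diagonal than (i, j), which gains
  one step whatever a is; hence the constant pattern 1 for A.\<close>

lemma filtration_commutator:
  assumes "B \<in> filtration k" "1 \<le> k" and A: "A \<in> carrier U"
  shows "commutator U A B \<in> filtration (Suc k)"
proof -
  have B: "B \<in> carrier U" and dvd: "\<And>i j. 1 \<le> i \<Longrightarrow> i < j \<Longrightarrow> j \<le> s + 1 \<Longrightarrow> q (k - (j - i)) dvd B (i, j)"
    using assms(1) unfolding filtration_def by auto
  have "q (Suc k - (j - i)) dvd commutator U A B (i, j)" if ij: "1 \<le> i" "i < j" "j \<le> s + 1" for i j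
  proof (rule commutator_entry_dvd[OF A B, where f = "\<lambda>_ _. 1", OF _ dvd])
    fix i l j :: nat assume "1 \<le> i" "i < l" "l < j" "j \<le> s + 1"
    then show "q (Suc k - (j - i)) dvd 1 * q (k - (j - l))"
      "q (Suc k - (j - i)) dvd q (k - (l - i)) * 1"
      "q (Suc k - (j - i)) dvd q (Suc k - (j - l))"
      by (simp_all, (intro q_mono; simp)+)
  qed (use ij q_dvd in auto)
  then show ?thesis using A B unfolding filtration_def by simp
qed

lemma lower_p_central_filtration:
  "1 \<le> k \<Longrightarrow> lower_p_central p U (discrete_topology (carrier U)) k \<subseteq> filtration k"
proof (induction k rule: nat_induct_at_least)
  case base
  then show ?case using filtration_1 by simp
next
  case (Suc k)
  show ?case
  proof (rule lower_p_central_subset[OF topological_group_discrete filtration_subgroup])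
    show "closedin (discrete_topology (carrier U)) (filtration (Suc k))"
      using subgroup.subset[OF filtration_subgroup] by simp
  qed (use Suc filtration_pow filtration_commutator in auto)
qed

text \<open>For k = n the exponent n - (j - i) exceeds n - s unless j - i = s, that is, outside the
  corner. So all other entries vanish modulo m, and the corner is a multiple of p^(n-s).\<close>

lemma centre_corner:
  assumes A: "A \<in> C"
  obtains a where "a \<in> carrier (Fp p)" "A = corner_matrix p n s a"
proof -
  have "A \<in> filtration n" using lower_p_central_filtration[of n] A n by auto
  then have AU: "A \<in> carrier U" and dvd: "\<And>i j. 1 \<le> i \<Longrightarrow> i < j \<Longrightarrow> j \<le> s + 1 \<Longrightarrow> q (n - (j - i)) dvd A (i, j)"
    unfolding filtration_def by auto
  have "int p ^ (n - s) dvd A (1, s + 1)" using dvd[of 1 "s + 1"] s q_small[of "n - s"] by simp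
  then obtain a where a: "A (1, s + 1) = a * int p ^ (n - s)" by (metis dvdE mult.commute)
  have pos: "0 < int p ^ (n - s)" using p_gt_1 by simp
  have bounds: "0 \<le> A (1, s + 1)" "A (1, s + 1) < m" using entry(3,4)[OF AU, of 1 "s + 1"] by simp_all
  have "0 \<le> a" using bounds(1) pos unfolding a by (simp add: zero_le_mult_iff)
  moreover have "a < int p" using bounds(2) pos unfolding a m_eq' by simp
  ultimately have aF: "a \<in> carrier (Fp p)" by simp
  have zero: "A (i, j) = 0" if ij: "1 \<le> i" "i < j" "j \<le> s + 1" "\<not> (i = 1 \<and> j = s + 1)" for i j
  proof -
    have "j - i < s" using ij by linarith
    then have "n - s < n - (j - i)" using s by linarith
    then have "m dvd A (i, j)" using dvd[OF ij(1-3)] q_large by simp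
    then show ?thesis using entry(3,4)[OF AU, of i j] ij zdvd_not_zless by fastforce
  qed
  have "A = corner_matrix p n s a"
  proof (rule extensionalityI[of _ "{1..s+1} \<times> {1..s+1}"])
    show "A \<in> extensional ({1..s+1} \<times> {1..s+1})" using AU by (simp only: carrier_iff)
    show "corner_matrix p n s a \<in> extensional ({1..s+1} \<times> {1..s+1})" by (simp add: corner_matrix_def)
    fix x assume "x \<in> {1..s+1} \<times> {1..s+1}"
    then obtain i j where x: "x = (i, j)" and ij: "1 \<le> i" "i \<le> s + 1" "1 \<le> j" "j \<le> s + 1" by auto
    consider "i = j" | "j < i" | "i < j" "\<not> (i = 1 \<and> j = s + 1)" | "i = 1" "j = s + 1" by linarith
    then show "A x = corner_matrix p n s a x"
    proof cases
      case 4
      have "corner_matrix p n s a (i, j) = a * int p ^ (n - s) mod m"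
        using 4 s by (simp add: corner_matrix_def m_eq')
      also have "\<dots> = A (i, j)" using bounds 4 by (simp flip: a)
      finally show ?thesis using x by simp
    qed (use x ij zero entry(1,2)[OF AU] s in \<open>auto simp: corner_matrix_def\<close>)
  qed
  then show ?thesis using aF that by blast
qed

lemma corner_entry:
  "1 \<le> i \<Longrightarrow> i < j \<Longrightarrow> j \<le> s + 1 \<Longrightarrow>
    corner_matrix p n s a (i, j) = (if i = 1 \<and> j = s + 1 then a * int p ^ (n - s) mod m else 0)"
  by (simp add: corner_matrix_def m_eq')

lemma corner_in: "corner_matrix p n s a \<in> carrier U"
  unfolding carrier_iff using s m_gt_1 by (auto simp: corner_matrix_def simp flip: m_eq')

text \<open>The corner position never occurs in a sum over k strictly between i and j, so corner
  matrices act by addition in one entry, from both sides.\<close>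

lemma corner_mult:
  assumes B: "B \<in> carrier U" and ij: "1 \<le> i" "i < j" "j \<le> s + 1"
  shows "(corner_matrix p n s a \<cdot> B) (i, j) = (corner_matrix p n s a (i, j) + B (i, j)) mod m"
    and "(B \<cdot> corner_matrix p n s a) (i, j) = (corner_matrix p n s a (i, j) + B (i, j)) mod m"
proof -
  have 1: "(\<Sum>k\<in>{i<..<j}. corner_matrix p n s a (i, k) * B (k, j)) = 0"
    by (rule sum.neutral) (use ij corner_entry in auto)
  show "(corner_matrix p n s a \<cdot> B) (i, j) = (corner_matrix p n s a (i, j) + B (i, j)) mod m"
    using mult_above[OF corner_in B ij, of a] unfolding 1 by simp
  have 2: "(\<Sum>k\<in>{i<..<j}. B (i, k) * corner_matrix p n s a (k, j)) = 0"
    by (rule sum.neutral) (use ij corner_entry in auto)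
  show "(B \<cdot> corner_matrix p n s a) (i, j) = (corner_matrix p n s a (i, j) + B (i, j)) mod m"
    using mult_above[OF B corner_in ij, of a] unfolding 2 by (simp add: add.commute)
qed

lemma centre_commute:
  assumes A: "A \<in> C" and B: "B \<in> carrier U"
  shows "A \<cdot> B = B \<cdot> A"
proof -
  obtain a where a: "A = corner_matrix p n s a" using centre_corner[OF A] by blast
  show ?thesis unfolding a
    by (rule matrix_eqI) (use corner_in B corner_mult[OF B] in auto)
qed

lemma corner_add:
  "corner_matrix p n s a \<cdot> corner_matrix p n s b = corner_matrix p n s ((a + b) mod int p)"
proof (rule matrix_eqI)
  fix i j assume ij: "1 \<le> i" "i < j" "j \<le> s + 1"
  \<comment> \<open>As m = p p^(n-s), scaling by p^(n-s) turns residues mod p into residues mod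
    m.\<close>
  have "((a + b) mod int p) * int p ^ (n - s) = (a + b) * int p ^ (n - s) mod m"
    unfolding m_eq'(1) by (simp only: mod_mult_mult2)
  then show "(corner_matrix p n s a \<cdot> corner_matrix p n s b) (i, j) =
      corner_matrix p n s ((a + b) mod int p) (i, j)"
    using corner_mult(1)[OF corner_in ij, of a b]
    by (simp add: corner_entry[OF ij] mod_add_eq algebra_simps)
qed (use corner_in in auto)

lemma inj_corner: "inj_on (corner_matrix p n s) (carrier (Fp p))"
proof (rule inj_onI)
  fix a b assume ab: "a \<in> carrier (Fp p)" "b \<in> carrier (Fp p)"
    and eq: "corner_matrix p n s a = corner_matrix p n s b"
  have *: "c * int p ^ (n - s) mod m = c * int p ^ (n - s)" if "c \<in> carrier (Fp p)" for c
    using that p_gt_1 unfolding m_eq'(1) by (intro mod_pos_pos_trivial) auto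
  have "a * int p ^ (n - s) mod m = b * int p ^ (n - s) mod m"
    using fun_cong[OF eq, of "(1, s + 1)"] s by (simp add: corner_matrix_def m_eq')
  then show "a = b" using * ab p_gt_1 by simp
qed

lemma centre_to_Fp_corner: "a \<in> carrier (Fp p) \<Longrightarrow> centre_to_Fp p n s (corner_matrix p n s a) = a"
  unfolding centre_to_Fp_def using inj_corner by (rule the_inv_into_f_f)

lemma centre_to_Fp_in: "A \<in> C \<Longrightarrow> centre_to_Fp p n s A \<in> carrier (Fp p)"
  using centre_corner centre_to_Fp_corner by metis

lemma centre_to_Fp_mult:
  assumes "A \<in> C" "B \<in> C"
  shows "centre_to_Fp p n s (A \<cdot> B) = centre_to_Fp p n s A \<oplus>\<^bsub>Fp p\<^esub> centre_to_Fp p n s B"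
proof -
  obtain a b where ab: "a \<in> carrier (Fp p)" "A = corner_matrix p n s a"
      "b \<in> carrier (Fp p)" "B = corner_matrix p n s b"
    using centre_corner assms by metis
  have "(a + b) mod int p \<in> carrier (Fp p)" using p_gt_1 by simp
  then show ?thesis using ab by (simp add: corner_add centre_to_Fp_corner del: residue_ring_simps(1))
qed

lemma centre_to_Fp_zero:
  assumes A: "A \<in> C" and zero: "A (1, s + 1) = 0"
  shows "centre_to_Fp p n s A = 0"
proof -
  obtain a where a: "a \<in> carrier (Fp p)" "A = corner_matrix p n s a" using centre_corner[OF A] by blast
  have "corner_matrix p n s 0 (i, j) = corner_matrix p n s a (i, j)"
    if "1 \<le> i" "i < j" "j \<le> s + 1" for i j
    using that zero a(2) by (simp add: corner_entry)
  then have "corner_matrix p n s 0 = corner_matrix p n s a"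
    by (intro matrix_eqI corner_in)
  then have "A = corner_matrix p n s 0" using a by simp
  moreover have "0 \<in> carrier (Fp p)" using p_gt_1 by simp
  ultimately show ?thesis using centre_to_Fp_corner by blast
qed

lemma centre_normal: "C \<lhd> U"
  by (rule lower_p_central_normal[OF topological_group_discrete])

end

section \<open>The Magnus representation\<close>

definition subword :: "nat \<Rightarrow> nat \<Rightarrow> 'x list \<Rightarrow> 'x list" where
  "subword i j w = take (j - i) (drop (i - 1) w)"

lemma length_subword: "1 \<le> i \<Longrightarrow> i \<le> j \<Longrightarrow> j \<le> length w + 1 \<Longrightarrow> length (subword i j w) = j - i"
  by (auto simp: subword_def)

lemma nth_subword:
  "1 \<le> i \<Longrightarrow> i \<le> j \<Longrightarrow> j \<le> length w + 1 \<Longrightarrow> l < j - i \<Longrightarrow> subword i j w ! l = w ! (i - 1 + l)"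
  by (auto simp: subword_def)

lemma subword_in_lists: "w \<in> lists X \<Longrightarrow> subword i j w \<in> lists X"
  unfolding subword_def in_lists_conv_set by (meson in_set_takeD in_set_dropD)

lemma
  assumes "1 \<le> i" "i \<le> k" "k \<le> j" "j \<le> length w + 1"
  shows take_subword: "take (k - i) (subword i j w) = subword i k w"
    and drop_subword: "drop (k - i) (subword i j w) = subword k j w"
  using assms by (auto simp: subword_def drop_take)

lemma subword_full: "subword 1 (length w + 1) w = w"
  by (simp add: subword_def)

lemma continuous_map_discrete_range:
  assumes "continuous_map Z (discrete_topology A) f" "f \<in> topspace Z \<rightarrow> B"
  shows "continuous_map Z (discrete_topology B) f"
  unfolding continuous_map_def
proof (intro conjI allI impI)
  fix W assume "openin (discrete_topology B) W"
  have "openin Z {x \<in> topspace Z. f x \<in> W \<inter> A}"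
    using assms(1) by (rule openin_continuous_map_preimage) simp
  moreover have "{x \<in> topspace Z. f x \<in> W \<inter> A} = {x \<in> topspace Z. f x \<in> W}"
    using assms(1) by (auto simp: continuous_map_def)
  ultimately show "openin Z {x \<in> topspace Z. f x \<in> W}" by simp
qed (use assms in auto)

text \<open>Finitely many coordinates determine the function, so each fibre is a finite intersection
  of open sets.\<close>

lemma continuous_map_discrete_finite_functions:
  assumes "finite I" "\<And>x. x \<in> topspace Z \<Longrightarrow> f x \<in> B" "B \<subseteq> extensional I"
    and "\<And>i. i \<in> I \<Longrightarrow> continuous_map Z (discrete_topology A) (\<lambda>x. f x i)"
  shows "continuous_map Z (discrete_topology B) f"
  unfolding continuous_map_def
proof (intro conjI allI impI)
  fix W assume "openin (discrete_topology B) W"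
  show "openin Z {x \<in> topspace Z. f x \<in> W}"
  proof (subst openin_subopen, intro ballI)
    fix y assume y: "y \<in> {x \<in> topspace Z. f x \<in> W}"
    let ?O = "topspace Z \<inter> (\<Inter>i\<in>I. {x \<in> topspace Z. f x i \<in> {f y i}})"
    have "openin Z {x \<in> topspace Z. f x i \<in> {f y i}}" if "i \<in> I" for i
    proof (rule openin_continuous_map_preimage[OF assms(4)[OF that]])
      show "openin (discrete_topology A) {f y i}"
        using assms(4)[OF that] y by (auto simp: continuous_map_def)
    qed
    then have "openin Z ?O" using assms(1) by (cases "I = {}") (auto intro!: openin_Int openin_Inter)
    moreover have "?O \<subseteq> {x \<in> topspace Z. f x \<in> W}"
    proof
      fix x assume x: "x \<in> ?O"
      then have "f x = f y"
        using y assms(2,3) by (intro extensionalityI[of _ I]) auto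
      then show "x \<in> {x \<in> topspace Z. f x \<in> W}" using x y by auto
    qed
    ultimately show "\<exists>V. openin Z V \<and> y \<in> V \<and> V \<subseteq> {x \<in> topspace Z. f x \<in> W}"
      using y by (intro exI[of _ ?O]) auto
  qed
qed (use assms in auto)

section \<open>Unitriangular representations and the series assembled from them\<close>

locale magnus_free =
  fixes S :: "('a, 'b) monoid_scheme" and T :: "'a topology" and X :: "'x set" and \<iota> :: "'x \<Rightarrow> 'a"
    and m :: int
  assumes free: "free_profinite_group S T X \<iota>" and m_gt_1: "1 < m"
begin

abbreviation "R \<equiv> residue_ring m"
abbreviation "U s \<equiv> unitriangular_group R s"

lemma unitri: "unitriangular m" by unfold_locales (rule m_gt_1)

lemmas M_carrier_iff = unitriangular.carrier_iff[OF unitri]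
  and M_entry = unitriangular.entry[OF unitri]
  and M_finite_carrier = unitriangular.finite_carrier[OF unitri]
  and M_group = unitriangular.group[OF unitri]
  and M_matrix_eqI = unitriangular.matrix_eqI[OF unitri]
  and M_mult_closed = unitriangular.mult_closed[OF unitri]
  and M_mult_interval = unitriangular.mult_interval[OF unitri]
  and M_one_entry = unitriangular.one_entry[OF unitri]

lemma \<iota>_in: "x \<in> X \<Longrightarrow> \<iota> x \<in> carrier S" and S_group: "group S" and S_top: "topspace T = carrier S"
  using free unfolding free_profinite_group_def profinite_group_def topological_group_def by auto

sublocale S: group S by (rule S_group)

text \<open>The matrix of the series 1 + x: above the diagonal, the entry (i, j) is the coefficient
  in it of the subword of w from position i to j - 1.\<close>

definition gen :: "'x list \<Rightarrow> 'x \<Rightarrow> nat \<times> nat \<Rightarrow> int" where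
  "gen w x = (\<lambda>(i, j) \<in> {1..length w + 1} \<times> {1..length w + 1}.
     if i = j then 1 else if j = i + 1 \<and> w ! (i - 1) = x then 1 else 0)"

lemma gen_in: "gen w x \<in> carrier (U (length w))"
  unfolding M_carrier_iff using m_gt_1 by (auto simp: gen_def)

text \<open>Obtained from freeness for a finite group, before any Magnus series is available; the
  series is recovered from these homomorphisms.\<close>

definition rep :: "'x list \<Rightarrow> 'a \<Rightarrow> nat \<times> nat \<Rightarrow> int" where
  "rep w = (THE \<kappa>. \<kappa> \<in> continuous_hom S T (U (length w)) (discrete_topology (carrier (U (length w)))) \<and>
     (\<forall>x\<in>X. \<kappa> (\<iota> x) = gen w x))"

lemma ex1_rep:
  "\<exists>!\<kappa>. \<kappa> \<in> continuous_hom S T (U (length w)) (discrete_topology (carrier (U (length w)))) \<and>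
     (\<forall>x\<in>X. \<kappa> (\<iota> x) = gen w x)"
  using free_profinite_finite[OF free M_group
      M_finite_carrier] gen_in by blast

lemma
  shows rep_hom: "rep w \<in> continuous_hom S T (U (length w)) (discrete_topology (carrier (U (length w))))"
    and rep_gen: "\<And>x. x \<in> X \<Longrightarrow> rep w (\<iota> x) = gen w x"
  using theI'[OF ex1_rep[of w]] unfolding rep_def by blast+

lemma rep_unique:
  assumes "\<kappa> \<in> continuous_hom S T (U (length w)) (discrete_topology (carrier (U (length w))))"
    and "\<And>x. x \<in> X \<Longrightarrow> \<kappa> (\<iota> x) = gen w x"
  shows "\<kappa> = rep w"
  using ex1_rep[of w] rep_hom rep_gen assms by blast

lemma rep_in: "\<sigma> \<in> carrier S \<Longrightarrow> rep w \<sigma> \<in> carrier (U (length w))"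
  and rep_mult: "\<sigma> \<in> carrier S \<Longrightarrow> \<tau> \<in> carrier S \<Longrightarrow>
    rep w (\<sigma> \<otimes>\<^bsub>S\<^esub> \<tau>) = rep w \<sigma> \<otimes>\<^bsub>U (length w)\<^esub> rep w \<tau>"
  and rep_continuous: "continuous_map T (discrete_topology (carrier (U (length w)))) (rep w)"
  using rep_hom[of w] by (auto simp: continuous_hom_def hom_def)

lemma rep_group_hom: "group_hom S (U (length w)) (rep w)"
  using rep_hom[of w] S_group M_group
  by (auto simp: group_hom_def group_hom_axioms_def continuous_hom_def)

text \<open>A block of consecutive rows and columns of \<open>rep w\<close> is the representation of a subword, as
  both are determined by their values on the basis.\<close>

lemma rep_subword:
  assumes ij: "1 \<le> i" "i \<le> j" "j \<le> length w + 1" and \<sigma>: "\<sigma> \<in> carrier S"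
  shows "rep w \<sigma> (i, j) = rep (subword i j w) \<sigma> (1, length (subword i j w) + 1)"
proof -
  let ?v = "subword i j w" and ?s = "length w"
  define t where "t = length ?v"
  have t: "t = j - i" using ij by (simp add: t_def length_subword)
  define d where "d = i - 1"
  have d: "d + t \<le> ?s" "i = 1 + d" "j = (t + 1) + d" using ij t by (auto simp: d_def)
  define r where "r A = (\<lambda>(a, b) \<in> {1..t+1} \<times> {1..t+1}. A (a + d, b + d))" for A :: "nat \<times> nat \<Rightarrow> int"
  have r_in: "r A \<in> carrier (U t)" if A: "A \<in> carrier (U ?s)" for A
    unfolding M_carrier_iff
  proof (intro conjI ballI)
    show "r A \<in> extensional ({1..t+1} \<times> {1..t+1})" by (simp add: r_def)
    fix a b assume ab: "a \<in> {1..t+1}" "b \<in> {1..t+1}"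
    then have ab': "1 \<le> a + d" "a + d \<le> ?s + 1" "1 \<le> b + d" "b + d \<le> ?s + 1" using d by auto
    have eq: "r A (a, b) = A (a + d, b + d)" using ab by (simp add: r_def)
    show "0 \<le> r A (a, b)" "r A (a, b) < m"
      unfolding eq using M_entry(3,4)[OF A] ab' by blast+
    show "a = b \<longrightarrow> r A (a, b) = 1" "b < a \<longrightarrow> r A (a, b) = 0"
      unfolding eq using M_entry(1,2)[OF A] ab' by auto
  qed
  have r_mult: "r (A \<otimes>\<^bsub>U ?s\<^esub> B) = r A \<otimes>\<^bsub>U t\<^esub> r B"
    if A: "A \<in> carrier (U ?s)" and B: "B \<in> carrier (U ?s)" for A B
  proof (rule M_matrix_eqI)
    show "r (A \<otimes>\<^bsub>U ?s\<^esub> B) \<in> carrier (U t)" "r A \<otimes>\<^bsub>U t\<^esub> r B \<in> carrier (U t)"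
      using r_in M_mult_closed A B by blast+
    fix a b assume "1 \<le> a" "a < b" "b \<le> t + 1"
    then have ab: "a \<in> {1..t+1}" "b \<in> {1..t+1}" "a + d \<in> {1..?s+1}" "b + d \<in> {1..?s+1}" using d by auto
    have "r (A \<otimes>\<^bsub>U ?s\<^esub> B) (a, b) = (\<Sum>k\<in>{a + d..b + d}. A (a + d, k) * B (k, b + d)) mod m"
      using ab M_mult_interval[OF A B] by (simp add: r_def)
    also have "(\<Sum>k\<in>{a + d..b + d}. A (a + d, k) * B (k, b + d)) =
        (\<Sum>k\<in>{a..b}. A (a + d, k + d) * B (k + d, b + d))"
      by (rule sum.shift_bounds_cl_nat_ivl)
    also have "\<dots> = (\<Sum>k\<in>{a..b}. r A (a, k) * r B (k, b))"
      using ab by (intro sum.cong) (auto simp: r_def)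
    also have "\<dots> mod m = (r A \<otimes>\<^bsub>U t\<^esub> r B) (a, b)"
      using M_mult_interval[OF r_in[OF A] r_in[OF B] ab(1,2)] by simp
    finally show "r (A \<otimes>\<^bsub>U ?s\<^esub> B) (a, b) = (r A \<otimes>\<^bsub>U t\<^esub> r B) (a, b)" .
  qed
  have "r (gen w x) = gen ?v x" for x
  proof (rule M_matrix_eqI)
    show "r (gen w x) \<in> carrier (U t)" using r_in gen_in by blast
    show "gen ?v x \<in> carrier (U t)" unfolding t_def by (rule gen_in)
    fix a b assume ab: "1 \<le> a" "a < b" "b \<le> t + 1"
    have "?v ! (a - 1) = w ! (i - 1 + (a - 1))" using ab t by (intro nth_subword ij) auto
    also have "i - 1 + (a - 1) = a + d - 1" using ab ij by (simp add: d_def)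
    finally have nth: "?v ! (a - 1) = w ! (a + d - 1)" .
    have "a + d \<le> ?s + 1" "b + d \<le> ?s + 1" using ab d by auto
    then have "r (gen w x) (a, b) = (if b = a + 1 \<and> w ! (a + d - 1) = x then 1 else 0)"
      using ab by (simp add: r_def gen_def)
    also have "\<dots> = gen ?v x (a, b)"
      using ab nth by (simp add: gen_def flip: t_def)
    finally show "r (gen w x) (a, b) = gen ?v x (a, b)" .
  qed
  then have "(\<lambda>\<sigma>\<in>carrier S. r (rep w \<sigma>)) = rep ?v"
    using continuous_hom_compose_discrete[OF S_top S_group rep_hom, where K' = "U t" and r = r]
      r_in r_mult rep_gen \<iota>_in by (intro rep_unique) (auto simp: t_def)
  then have "rep ?v \<sigma> = r (rep w \<sigma>)" using \<sigma> by (metis restrict_apply')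
  then have "rep ?v \<sigma> (1, t + 1) = rep w \<sigma> (i, j)" by (simp add: r_def d)
  then show ?thesis by (simp add: t_def)
qed

text \<open>The Magnus series assembled word by word, each coefficient coming from the
  representation of that very word.\<close>

definition mu :: "'a \<Rightarrow> 'x list \<Rightarrow> int" where
  "mu = (\<lambda>\<sigma>\<in>carrier S. \<lambda>w\<in>lists X. rep w \<sigma> (1, length w + 1))"

abbreviation "P \<equiv> nc_power_series R X"

lemma nc_mult:
  assumes "f \<in> carrier P" "g \<in> carrier P" "w \<in> lists X"
  shows "(f \<otimes>\<^bsub>P\<^esub> g) w = (\<Sum>i\<in>{..length w}. f (take i w) * g (drop i w)) mod m"
proof -
  have "(f \<otimes>\<^bsub>P\<^esub> g) w = (\<Oplus>\<^bsub>R\<^esub>i\<in>{..length w}. f (take i w) * g (drop i w) mod m)"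
    using assms(3) by (simp add: nc_power_series_def)
  also have "\<dots> = (\<Sum>i\<in>{..length w}. f (take i w) * g (drop i w) mod m) mod m"
    using m_gt_1 by (intro finsum_residue_ring) auto
  also have "\<dots> = (\<Sum>i\<in>{..length w}. f (take i w) * g (drop i w)) mod m" by (rule mod_sum_eq)
  finally show ?thesis .
qed

lemma nc_carrier: "carrier P = lists X \<rightarrow>\<^sub>E {0..m - 1}"
  by (simp add: nc_power_series_def)

lemma nc_mult_extensional: "f \<otimes>\<^bsub>P\<^esub> g \<in> extensional (lists X)"
  by (simp add: nc_power_series_def)

lemma mu_in:
  assumes \<sigma>: "\<sigma> \<in> carrier S" shows "mu \<sigma> \<in> carrier P"
  unfolding nc_carrier
proof (rule PiE_I)
  show "mu \<sigma> w \<in> {0..m - 1}" if "w \<in> lists X" for w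
    using M_entry(3,4)[OF rep_in[OF \<sigma>, of w], of 1 "length w + 1"] that \<sigma>
    by (simp add: mu_def)
  show "mu \<sigma> w = undefined" if "w \<notin> lists X" for w using that \<sigma> by (simp add: mu_def)
qed

text \<open>The corner entry of a matrix product is a sum over k of entries (1, k + 1) and (k + 1,
  |w| + 1). By \<open>rep_subword\<close> these are the coefficients of the prefix of length k and
  of the remaining suffix, so the sum is the convolution of the two series.\<close>

lemma mu_mult:
  assumes \<sigma>: "\<sigma> \<in> carrier S" and \<tau>: "\<tau> \<in> carrier S"
  shows "mu (\<sigma> \<otimes>\<^bsub>S\<^esub> \<tau>) = mu \<sigma> \<otimes>\<^bsub>P\<^esub> mu \<tau>"
proof (rule extensionalityI[OF _ nc_mult_extensional])
  show "mu (\<sigma> \<otimes>\<^bsub>S\<^esub> \<tau>) \<in> extensional (lists X)" using \<sigma> \<tau> by (simp add: mu_def)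
  fix w assume w: "w \<in> lists X"
  let ?s = "length w"
  have sub: "rep w \<rho> (i, j) = mu \<rho> (subword i j w)"
    if "\<rho> \<in> carrier S" "1 \<le> i" "i \<le> j" "j \<le> ?s + 1" for \<rho> i j
    using rep_subword[OF that(2-4,1)] that(1) subword_in_lists[OF w, of i j] by (simp add: mu_def)
  have "mu (\<sigma> \<otimes>\<^bsub>S\<^esub> \<tau>) w = (\<Sum>k\<in>{0 + 1..?s + 1}. rep w \<sigma> (1, k) * rep w \<tau> (k, ?s + 1)) mod m"
    using \<sigma> \<tau> w M_mult_interval[OF rep_in[OF \<sigma>, of w] rep_in[OF \<tau>], of 1 "?s + 1"]
    by (simp add: mu_def rep_mult)
  also have "(\<Sum>k\<in>{0 + 1..?s + 1}. rep w \<sigma> (1, k) * rep w \<tau> (k, ?s + 1)) =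
      (\<Sum>k\<in>{0..?s}. rep w \<sigma> (1, k + 1) * rep w \<tau> (k + 1, ?s + 1))"
    by (rule sum.shift_bounds_cl_nat_ivl)
  also have "\<dots> = (\<Sum>k\<in>{..?s}. mu \<sigma> (take k w) * mu \<tau> (drop k w))"
  proof (rule sum.cong)
    fix k assume "k \<in> {..?s}"
    then have k: "1 \<le> k + 1" "k + 1 \<le> ?s + 1" by auto
    have "rep w \<sigma> (1, k + 1) = mu \<sigma> (take k w)"
      using sub[OF \<sigma>, of 1 "k + 1"] k by (simp add: subword_def)
    moreover have "rep w \<tau> (k + 1, ?s + 1) = mu \<tau> (drop k w)"
      using sub[OF \<tau>, of "k + 1" "?s + 1"] k by (simp add: subword_def)
    ultimately show "rep w \<sigma> (1, k + 1) * rep w \<tau> (k + 1, ?s + 1) = mu \<sigma> (take k w) * mu \<tau> (drop k w)"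
      by simp
  qed auto
  finally show "mu (\<sigma> \<otimes>\<^bsub>S\<^esub> \<tau>) w = (mu \<sigma> \<otimes>\<^bsub>P\<^esub> mu \<tau>) w"
    using nc_mult[OF mu_in[OF \<sigma>] mu_in[OF \<tau>] w] by simp
qed

lemma mu_one: "mu \<one>\<^bsub>S\<^esub> = \<one>\<^bsub>P\<^esub>"
proof -
  have "rep w \<one>\<^bsub>S\<^esub> = \<one>\<^bsub>U (length w)\<^esub>" for w
    using group_hom.hom_one[OF rep_group_hom] .
  then show ?thesis
    using M_one_entry
    by (auto simp: mu_def nc_power_series_def fun_eq_iff restrict_def)
qed

lemma mu_Units:
  assumes \<sigma>: "\<sigma> \<in> carrier S" shows "mu \<sigma> \<in> Units P"
  unfolding Units_def
proof (intro CollectI conjI bexI)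
  have inv: "inv\<^bsub>S\<^esub> \<sigma> \<in> carrier S" using \<sigma> by simp
  show "mu \<sigma> \<in> carrier P" "mu (inv\<^bsub>S\<^esub> \<sigma>) \<in> carrier P" using mu_in \<sigma> inv by blast+
  show "mu (inv\<^bsub>S\<^esub> \<sigma>) \<otimes>\<^bsub>P\<^esub> mu \<sigma> = \<one>\<^bsub>P\<^esub>" "mu \<sigma> \<otimes>\<^bsub>P\<^esub> mu (inv\<^bsub>S\<^esub> \<sigma>) = \<one>\<^bsub>P\<^esub>"
    using mu_mult[OF inv \<sigma>] mu_mult[OF \<sigma> inv] mu_one \<sigma> by simp_all
qed

lemma mu_gen: "x \<in> X \<Longrightarrow> mu (\<iota> x) = \<one>\<^bsub>P\<^esub> \<oplus>\<^bsub>P\<^esub> nc_var R X x"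
proof (rule extensionalityI)
  assume x: "x \<in> X"
  show "mu (\<iota> x) \<in> extensional (lists X)" using x \<iota>_in by (simp add: mu_def)
  show "\<one>\<^bsub>P\<^esub> \<oplus>\<^bsub>P\<^esub> nc_var R X x \<in> extensional (lists X)" by (simp add: nc_power_series_def)
  fix w assume w: "w \<in> lists X"
  have "mu (\<iota> x) w = gen w x (1, length w + 1)" using x w \<iota>_in by (simp add: mu_def rep_gen)
  also have "\<dots> = (\<one>\<^bsub>P\<^esub> \<oplus>\<^bsub>P\<^esub> nc_var R X x) w"
    using w m_gt_1 by (cases w) (auto simp: gen_def nc_power_series_def nc_var_def)
  finally show "mu (\<iota> x) w = (\<one>\<^bsub>P\<^esub> \<oplus>\<^bsub>P\<^esub> nc_var R X x) w" .
qed

lemma continuous_mu: "continuous_map T (nc_units_topology R X) mu"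
  unfolding nc_units_topology_def continuous_map_in_subtopology
proof
  show "mu \<in> topspace T \<rightarrow> Units P" using mu_Units S_top by auto
  show "continuous_map T (product_topology (\<lambda>_. discrete_topology (carrier R)) (lists X)) mu"
    unfolding continuous_map_componentwise
  proof
    show "mu ` topspace T \<subseteq> extensional (lists X)" using S_top by (auto simp: mu_def)
    show "\<forall>w\<in>lists X. continuous_map T (discrete_topology (carrier R)) (\<lambda>\<sigma>. mu \<sigma> w)"
    proof
      fix w assume w: "w \<in> lists X"
      have "continuous_map (discrete_topology (carrier (U (length w)))) (discrete_topology (carrier R))
          (\<lambda>A. A (1, length w + 1))"
        using M_entry(3,4) by fastforce
      from continuous_map_compose[OF rep_continuous this]
      have "continuous_map T (discrete_topology (carrier R)) (\<lambda>\<sigma>. rep w \<sigma> (1, length w + 1))"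
        by (simp add: o_def)
      then show "continuous_map T (discrete_topology (carrier R)) (\<lambda>\<sigma>. mu \<sigma> w)"
        by (rule continuous_map_eq) (use w S_top in \<open>simp add: mu_def\<close>)
    qed
  qed
qed

section \<open>Uniqueness of the Magnus homomorphism\<close>

abbreviation "is_magnus \<kappa> \<equiv> \<kappa> \<in> continuous_hom S T (units_of P) (nc_units_topology R X) \<and>
  (\<forall>x\<in>X. \<kappa> (\<iota> x) = \<one>\<^bsub>P\<^esub> \<oplus>\<^bsub>P\<^esub> nc_var R X x)"

lemma mu_is_magnus: "is_magnus mu"
  unfolding continuous_hom_def
  using continuous_mu mu_gen mu_Units mu_mult
  by (auto simp: hom_def units_of_def) (simp add: mu_def)

context
  fixes \<kappa> assumes \<kappa>: "is_magnus \<kappa>"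
begin

lemma magnus_in: "\<sigma> \<in> carrier S \<Longrightarrow> \<kappa> \<sigma> \<in> Units P"
  and magnus_mult: "\<sigma> \<in> carrier S \<Longrightarrow> \<tau> \<in> carrier S \<Longrightarrow> \<kappa> (\<sigma> \<otimes>\<^bsub>S\<^esub> \<tau>) = \<kappa> \<sigma> \<otimes>\<^bsub>P\<^esub> \<kappa> \<tau>"
  using \<kappa> by (auto simp: continuous_hom_def hom_def units_of_def)

lemma magnus_carrier: "\<sigma> \<in> carrier S \<Longrightarrow> \<kappa> \<sigma> \<in> carrier P"
  using magnus_in by (auto simp: Units_def)

lemma magnus_coeff_in: "\<sigma> \<in> carrier S \<Longrightarrow> w \<in> lists X \<Longrightarrow> \<kappa> \<sigma> w \<in> {0..m - 1}"
  using magnus_carrier unfolding nc_carrier by blast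

lemma magnus_coeff_continuous:
  assumes w: "w \<in> lists X"
  shows "continuous_map T (discrete_topology (carrier R)) (\<lambda>\<sigma>. \<kappa> \<sigma> w)"
  using \<kappa> w unfolding continuous_hom_def nc_units_topology_def continuous_map_in_subtopology
    continuous_map_componentwise by auto

lemma magnus_gen_coeff:
  "x \<in> X \<Longrightarrow> w \<in> lists X \<Longrightarrow> \<kappa> (\<iota> x) w = gen w x (1, length w + 1)"
  using \<kappa> mu_gen \<iota>_in by (simp add: mu_def rep_gen flip: mu_gen)

text \<open>An invertible series only has an invertible constant term. But the constant term is a
  continuous homomorphism into the finite unit group of R which is 1 on the basis, hence trivial.
  This is what makes the matrices of coefficients unipotent.\<close>

lemma magnus_constant: "\<sigma> \<in> carrier S \<Longrightarrow> \<kappa> \<sigma> [] = 1"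
proof -
  interpret residues m R using m_gt_1 by unfold_locales
  let ?G = "units_of R"
  have G: "group ?G" by (rule units_group)
  have carr: "carrier ?G = Units R" by (simp add: units_of_def)
  have fin: "finite (carrier ?G)"
    unfolding carr by (rule finite_subset[OF Units_closed[THEN subsetI]]) auto
  let ?e = "\<lambda>\<sigma>\<in>carrier S. \<kappa> \<sigma> []" and ?one = "\<lambda>\<sigma>\<in>carrier S. (1 :: int)"
  have mult_nil: "(f \<otimes>\<^bsub>P\<^esub> g) [] = f [] * g [] mod m" if "f \<in> carrier P" "g \<in> carrier P" for f g
    using nc_mult[OF that, of "[]"] by simp
  have unit: "\<kappa> \<sigma> [] \<in> Units R" if \<sigma>: "\<sigma> \<in> carrier S" for \<sigma>
  proof -
    obtain g where g: "g \<in> carrier P" "g \<otimes>\<^bsub>P\<^esub> \<kappa> \<sigma> = \<one>\<^bsub>P\<^esub>" "\<kappa> \<sigma> \<otimes>\<^bsub>P\<^esub> g = \<one>\<^bsub>P\<^esub>"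
      using magnus_in[OF \<sigma>] by (auto simp: Units_def)
    have "\<one>\<^bsub>P\<^esub> [] = 1" by (simp add: nc_power_series_def)
    then have "g [] * \<kappa> \<sigma> [] mod m = 1" "\<kappa> \<sigma> [] * g [] mod m = 1"
      using mult_nil[OF g(1) magnus_carrier[OF \<sigma>]] mult_nil[OF magnus_carrier[OF \<sigma>] g(1)] g by auto
    moreover have "g [] \<in> {0..m - 1}" using g(1) unfolding nc_carrier by auto
    ultimately show ?thesis using magnus_coeff_in[OF \<sigma>, of "[]"]
      unfolding Units_def by auto
  qed
  have "?e \<in> continuous_hom S T ?G (discrete_topology (carrier ?G))"
    unfolding continuous_hom_def hom_def
  proof (intro CollectI conjI ballI)
    show "?e \<in> carrier S \<rightarrow> carrier ?G" using unit carr by simp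
    show "?e (\<sigma> \<otimes>\<^bsub>S\<^esub> \<tau>) = ?e \<sigma> \<otimes>\<^bsub>?G\<^esub> ?e \<tau>" if "\<sigma> \<in> carrier S" "\<tau> \<in> carrier S" for \<sigma> \<tau>
      using that magnus_mult mult_nil magnus_carrier by (simp add: units_of_def)
    have "continuous_map T (discrete_topology (carrier R)) ?e"
      by (rule continuous_map_eq[OF magnus_coeff_continuous[of "[]"]]) (simp_all add: S_top)
    then show "continuous_map T (discrete_topology (carrier ?G)) ?e"
      by (rule continuous_map_discrete_range) (use unit carr S_top in auto)
  qed simp
  moreover have "?one \<in> continuous_hom S T ?G (discrete_topology (carrier ?G))"
    unfolding continuous_hom_def hom_def
  proof (intro CollectI conjI ballI)
    have one: "1 \<in> Units R" using Units_one_closed by simp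
    then show "?one \<in> carrier S \<rightarrow> carrier ?G" using carr by simp
    show "?one (\<sigma> \<otimes>\<^bsub>S\<^esub> \<tau>) = ?one \<sigma> \<otimes>\<^bsub>?G\<^esub> ?one \<tau>" if "\<sigma> \<in> carrier S" "\<tau> \<in> carrier S" for \<sigma> \<tau>
      using that m_gt_1 by (simp add: units_of_def)
    have "continuous_map T (discrete_topology (carrier ?G)) (\<lambda>_. 1)" using one carr by simp
    then show "continuous_map T (discrete_topology (carrier ?G)) ?one"
      by (rule continuous_map_eq) (simp add: S_top)
  qed simp
  moreover have "?e (\<iota> x) = 1" "?one (\<iota> x) = 1" if "x \<in> X" for x
    using that \<iota>_in magnus_gen_coeff[of x "[]"] by (simp_all add: gen_def)
  moreover have "(\<lambda>_. 1) \<in> X \<rightarrow> carrier ?G" using Units_one_closed carr by simp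
  ultimately have "?e = ?one"
    using free_profinite_finite[OF free G fin, of "\<lambda>_. 1"] by blast
  then show "\<sigma> \<in> carrier S \<Longrightarrow> \<kappa> \<sigma> [] = 1" by (metis restrict_apply')
qed

text \<open>The coefficients of the subwords of w form a continuous homomorphism M into a finite
  matrix group with the prescribed values on the basis, so freeness identifies M with
  \<open>rep w\<close>.\<close>

lemma magnus_coeff_eq_rep:
  assumes w: "w \<in> lists X" and \<sigma>: "\<sigma> \<in> carrier S"
  shows "\<kappa> \<sigma> w = rep w \<sigma> (1, length w + 1)"
proof -
  let ?s = "length w" and ?I = "{1..length w + 1} \<times> {1..length w + 1}"
  define M where "M = (\<lambda>\<sigma>\<in>carrier S. \<lambda>(i, j) \<in> ?I. if i \<le> j then \<kappa> \<sigma> (subword i j w) else 0)"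
  have M_in: "M \<sigma> \<in> carrier (U ?s)" if \<sigma>: "\<sigma> \<in> carrier S" for \<sigma>
    unfolding M_carrier_iff
  proof (intro conjI ballI)
    show "M \<sigma> \<in> extensional ?I" using \<sigma> by (simp add: M_def)
    fix i j assume ij: "i \<in> {1..?s+1}" "j \<in> {1..?s+1}"
    have eq: "M \<sigma> (i, j) = (if i \<le> j then \<kappa> \<sigma> (subword i j w) else 0)" using \<sigma> ij by (simp add: M_def)
    show "0 \<le> M \<sigma> (i, j)" "M \<sigma> (i, j) < m"
      unfolding eq using magnus_coeff_in[OF \<sigma> subword_in_lists[OF w, of i j]] m_gt_1 by auto
    show "i = j \<longrightarrow> M \<sigma> (i, j) = 1" "j < i \<longrightarrow> M \<sigma> (i, j) = 0"
      unfolding eq using magnus_constant[OF \<sigma>] by (auto simp: subword_def)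
  qed
  have "M = rep w"
  proof (rule rep_unique)
    show "M \<in> continuous_hom S T (U ?s) (discrete_topology (carrier (U ?s)))"
      unfolding continuous_hom_def hom_def
    proof (intro CollectI conjI ballI)
      show "M \<in> extensional (carrier S)" by (simp add: M_def)
      show "M \<in> carrier S \<rightarrow> carrier (U ?s)" using M_in by simp
      show "continuous_map T (discrete_topology (carrier (U ?s))) M"
      proof (rule continuous_map_discrete_finite_functions)
        show "finite ?I" by simp
        show "M \<sigma> \<in> carrier (U ?s)" if "\<sigma> \<in> topspace T" for \<sigma> using that M_in S_top by simp
        show "carrier (U ?s) \<subseteq> extensional ?I" using M_carrier_iff by blast
        fix x assume "x \<in> ?I"
        then obtain i j where x: "x = (i, j)" "(i, j) \<in> ?I" by (cases x) auto
        show "continuous_map T (discrete_topology (carrier R)) (\<lambda>\<sigma>. M \<sigma> x)"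
        proof (cases "i \<le> j")
          case True
          show ?thesis
            by (rule continuous_map_eq[OF magnus_coeff_continuous[OF subword_in_lists[OF w, of i j]]])
              (use x True S_top in \<open>simp add: M_def\<close>)
        next
          case False
          have "continuous_map T (discrete_topology (carrier R)) (\<lambda>_. 0)" using m_gt_1 by simp
          then show ?thesis
            by (rule continuous_map_eq) (use x False S_top in \<open>simp add: M_def\<close>)
        qed
      qed
      fix \<sigma> \<tau> assume \<sigma>: "\<sigma> \<in> carrier S" and \<tau>: "\<tau> \<in> carrier S"
      show "M (\<sigma> \<otimes>\<^bsub>S\<^esub> \<tau>) = M \<sigma> \<otimes>\<^bsub>U ?s\<^esub> M \<tau>"
      proof (rule M_matrix_eqI)
        show "M (\<sigma> \<otimes>\<^bsub>S\<^esub> \<tau>) \<in> carrier (U ?s)" "M \<sigma> \<otimes>\<^bsub>U ?s\<^esub> M \<tau> \<in> carrier (U ?s)"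
          using M_in M_mult_closed \<sigma> \<tau> by simp_all
        fix i j assume ij: "1 \<le> i" "i < j" "j \<le> ?s + 1"
        let ?v = "subword i j w"
        have len: "length ?v = j - i" using ij by (simp add: length_subword)
        have "M (\<sigma> \<otimes>\<^bsub>S\<^esub> \<tau>) (i, j) = (\<kappa> \<sigma> \<otimes>\<^bsub>P\<^esub> \<kappa> \<tau>) ?v"
          using \<sigma> \<tau> ij by (simp add: M_def magnus_mult)
        also have "\<dots> = (\<Sum>l\<in>{0..j - i}. \<kappa> \<sigma> (take l ?v) * \<kappa> \<tau> (drop l ?v)) mod m"
          using nc_mult[OF magnus_carrier[OF \<sigma>] magnus_carrier[OF \<tau>] subword_in_lists[OF w]] len
          by (simp add: atMost_atLeast0)
        also have "(\<Sum>l\<in>{0..j - i}. \<kappa> \<sigma> (take l ?v) * \<kappa> \<tau> (drop l ?v)) =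
            (\<Sum>l\<in>{0..j - i}. M \<sigma> (i, l + i) * M \<tau> (l + i, j))"
        proof (rule sum.cong)
          fix l assume "l \<in> {0..j - i}"
          then have l: "i \<le> l + i" "l + i \<le> j" using ij by auto
          show "\<kappa> \<sigma> (take l ?v) * \<kappa> \<tau> (drop l ?v) = M \<sigma> (i, l + i) * M \<tau> (l + i, j)"
            using take_subword[of i "l + i" j w] drop_subword[of i "l + i" j w] l ij \<sigma> \<tau>
            by (simp add: M_def)
        qed simp
        also have "\<dots> = (\<Sum>k\<in>{0 + i..(j - i) + i}. M \<sigma> (i, k) * M \<tau> (k, j))"
          by (rule sum.shift_bounds_cl_nat_ivl[symmetric])
        also have "\<dots> mod m = (M \<sigma> \<otimes>\<^bsub>U ?s\<^esub> M \<tau>) (i, j)"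
          using M_mult_interval[OF M_in[OF \<sigma>] M_in[OF \<tau>], of i j] ij by simp
        finally show "M (\<sigma> \<otimes>\<^bsub>S\<^esub> \<tau>) (i, j) = (M \<sigma> \<otimes>\<^bsub>U ?s\<^esub> M \<tau>) (i, j)" .
      qed
    qed
    fix x assume x: "x \<in> X"
    show "M (\<iota> x) = gen w x"
    proof (rule M_matrix_eqI[OF M_in[OF \<iota>_in[OF x]] gen_in])
      fix i j assume ij: "1 \<le> i" "i < j" "j \<le> ?s + 1"
      have "M (\<iota> x) (i, j) = gen (subword i j w) x (1, length (subword i j w) + 1)"
        using ij x \<iota>_in magnus_gen_coeff[OF x subword_in_lists[OF w]] by (simp add: M_def)
      also have "\<dots> = rep (subword i j w) (\<iota> x) (1, length (subword i j w) + 1)"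
        using x by (simp add: rep_gen)
      also have "\<dots> = rep w (\<iota> x) (i, j)" using rep_subword[of i j w "\<iota> x"] ij x \<iota>_in by simp
      finally show "M (\<iota> x) (i, j) = gen w x (i, j)" using x by (simp add: rep_gen)
    qed
  qed
  then have "rep w \<sigma> (1, ?s + 1) = M \<sigma> (1, ?s + 1)" by simp
  also have "\<dots> = \<kappa> \<sigma> w" using \<sigma> subword_full[of w] by (simp add: M_def)
  finally show ?thesis by simp
qed

end

lemma magnus_eq_mu: "magnus R S T X \<iota> = mu"
  unfolding magnus_def
proof (rule the_equality)
  show "is_magnus mu" by (rule mu_is_magnus)
  fix \<kappa> assume \<kappa>: "is_magnus \<kappa>"
  show "\<kappa> = mu"
  proof (rule extensionalityI[of _ "carrier S"])
    show "\<kappa> \<in> extensional (carrier S)" using \<kappa> by (simp add: continuous_hom_def)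
    show "mu \<in> extensional (carrier S)" by (simp add: mu_def)
    fix \<sigma> assume \<sigma>: "\<sigma> \<in> carrier S"
    show "\<kappa> \<sigma> = mu \<sigma>"
    proof (rule extensionalityI[of _ "lists X"])
      show "\<kappa> \<sigma> \<in> extensional (lists X)" "mu \<sigma> \<in> extensional (lists X)"
        using magnus_carrier[OF \<kappa> \<sigma>] mu_in[OF \<sigma>] unfolding nc_carrier by (simp_all add: PiE_def)
    qed (use magnus_coeff_eq_rep[OF \<kappa> _ \<sigma>] \<sigma> in \<open>simp add: mu_def\<close>)
  qed
qed

lemma magnus_rep_eq_rep:
  assumes w: "w \<in> lists X" and \<sigma>: "\<sigma> \<in> carrier S"
  shows "magnus_rep R S T X \<iota> w \<sigma> = rep w \<sigma>"
proof (rule extensionalityI[of _ "{1..length w + 1} \<times> {1..length w + 1}"])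
  show "magnus_rep R S T X \<iota> w \<sigma> \<in> extensional ({1..length w + 1} \<times> {1..length w + 1})"
    by (simp add: magnus_rep_def)
  show "rep w \<sigma> \<in> extensional ({1..length w + 1} \<times> {1..length w + 1})"
    using rep_in[OF \<sigma>] unfolding M_carrier_iff by blast
  fix x assume "x \<in> {1..length w + 1} \<times> {1..length w + 1}"
  then obtain i j where x: "x = (i, j)" and ij: "1 \<le> i" "i \<le> length w + 1" "1 \<le> j" "j \<le> length w + 1"
    by auto
  have "magnus_coeff R S T X \<iota> (subword i j w) \<sigma> = rep w \<sigma> (i, j)" if "i \<le> j"
    using rep_subword[OF ij(1) that ij(4) \<sigma>] \<sigma> subword_in_lists[OF w, of i j]
    by (simp add: magnus_coeff_def magnus_eq_mu mu_def)
  moreover have "rep w \<sigma> (i, j) = 0" if "j < i"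
    using M_entry(2)[OF rep_in[OF \<sigma>] ij(3) that ij(2)] .
  ultimately show "magnus_rep R S T X \<iota> w \<sigma> x = rep w \<sigma> x"
    using x ij by (simp add: magnus_rep_def subword_def)
qed

end

section \<open>The transgression pairing\<close>

lemma lower_p_central_closedin:
  assumes "topological_group G T"
  shows "closedin T (lower_p_central p G T n)"
proof -
  have "topspace T = carrier G" using assms unfolding topological_group_def by blast
  then have "closedin T (carrier G)" using closedin_topspace[of T] by simp
  then show ?thesis by (cases "(p, G, T, n)" rule: lower_p_central.cases) auto
qed

text \<open>The preimage of a term is a closed subgroup that contains the generators of the
  corresponding term of G.\<close>

lemma lower_p_central_image:
  assumes G: "topological_group G T" and H: "topological_group H T'"
    and \<kappa>: "continuous_map T T' \<kappa>" "\<kappa> \<in> hom G H" and k: "1 \<le> k"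
  shows "\<kappa> ` lower_p_central p G T k \<subseteq> lower_p_central p H T' k"
  using k
proof (induction k rule: nat_induct_at_least)
  case base
  then show ?case using \<kappa>(2) by (auto simp: hom_def)
next
  case (Suc k)
  have topG: "topspace T = carrier G" and gG: "group G" and gH: "group H"
    using G H unfolding topological_group_def by blast+
  interpret group_hom G H \<kappa>
    using gG gH \<kappa>(2) by (simp add: group_hom_def group_hom_axioms_def)
  let ?L = "lower_p_central p H T' (Suc k)"
  have L: "subgroup ?L H" using lower_p_central_normal[OF H] normal_imp_subgroup by blast
  let ?K = "{\<sigma> \<in> carrier G. \<kappa> \<sigma> \<in> ?L}"
  have "lower_p_central p G T (Suc k) \<subseteq> ?K"
  proof (rule lower_p_central_subset[OF G])
    show "subgroup ?K G"
      using subgroup.one_closed[OF L] subgroup.m_closed[OF L] subgroup.m_inv_closed[OF L]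
      by (intro G.subgroupI) auto
    show "closedin T ?K"
      using closedin_continuous_map_preimage[OF \<kappa>(1) lower_p_central_closedin[OF H]] topG by simp
    show "2 \<le> Suc k" using Suc by simp
    fix \<tau> assume \<tau>: "\<tau> \<in> lower_p_central p G T (Suc k - 1)"
    then have \<tau>G: "\<tau> \<in> carrier G"
      using lower_p_central_normal[OF G] normal_imp_subgroup subgroup.subset by blast
    have \<kappa>\<tau>: "\<kappa> \<tau> \<in> lower_p_central p H T' k" using \<tau> Suc.IH by auto
    show "\<tau> [^]\<^bsub>G\<^esub> p \<in> ?K"
      using lower_p_central_pow[OF H Suc.hyps \<kappa>\<tau>] \<tau>G by (simp add: hom_nat_pow)
    show "commutator G \<sigma> \<tau> \<in> ?K" if "\<sigma> \<in> carrier G" for \<sigma>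
      using lower_p_central_commutator[OF H Suc.hyps \<kappa>\<tau>, of "\<kappa> \<sigma>"] \<tau>G that by (simp add: commutator_def)
  qed
  then show ?case by blast
qed

text \<open>The kernel is a closed subgroup containing all p-th powers and commutators, so it
  contains every term from the second on. This provides \<open>vanish\<close> for
  \<open>inj_on_transgression\<close>.\<close>

lemma hom_to_Fp_vanishes:
  assumes G: "topological_group G T" and p: "1 < p" and n: "2 \<le> n"
    and f: "continuous_map T (discrete_topology (carrier (Fp p))) f"
    and hom: "\<And>g h. g \<in> carrier G \<Longrightarrow> h \<in> carrier G \<Longrightarrow> f (g \<otimes>\<^bsub>G\<^esub> h) = f g \<oplus>\<^bsub>Fp p\<^esub> f h"
    and \<nu>: "\<nu> \<in> lower_p_central p G T n"
  shows "f \<nu> = 0"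
proof -
  interpret group G using G unfolding topological_group_def by blast
  have top: "topspace T = carrier G" using G unfolding topological_group_def by blast
  have range: "0 \<le> f g" "f g < int p" if "g \<in> carrier G" for g
    using f that top by (auto simp: continuous_map_def Pi_iff)
  have hom: "f (g \<otimes>\<^bsub>G\<^esub> h) = (f g + f h) mod int p" if "g \<in> carrier G" "h \<in> carrier G" for g h
    using hom[OF that] by simp
  have one: "f \<one>\<^bsub>G\<^esub> = 0"
  proof -
    have "(f \<one>\<^bsub>G\<^esub> + f \<one>\<^bsub>G\<^esub>) mod int p = f \<one>\<^bsub>G\<^esub> mod int p"
      using hom[OF one_closed one_closed] range[OF one_closed] by (simp only: l_one one_closed mod_pos_pos_trivial)
    then have "int p dvd f \<one>\<^bsub>G\<^esub>" by (metis add_diff_cancel_right' mod_eq_dvd_iff)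
    then show ?thesis using range[of "\<one>\<^bsub>G\<^esub>"] by (metis one_closed zdvd_not_zless order_le_less)
  qed
  have inv: "(f (inv\<^bsub>G\<^esub> g) + f g) mod int p = 0" if "g \<in> carrier G" for g
    using hom[of "inv\<^bsub>G\<^esub> g" g] that one by simp
  let ?K = "{g \<in> carrier G. f g = 0}"
  have "lower_p_central p G T n \<subseteq> ?K"
  proof (rule lower_p_central_subset[OF G _ _ n])
    show "subgroup ?K G"
    proof (rule subgroupI)
      show "?K \<noteq> {}" using one by blast
      fix a assume a: "a \<in> ?K"
      then show "inv\<^bsub>G\<^esub> a \<in> ?K" using inv[of a] range[of "inv\<^bsub>G\<^esub> a"] by simp
    qed (use hom in auto)
    have "closedin T {g \<in> topspace T. f g \<in> {0}}"
      using f p by (intro closedin_continuous_map_preimage[OF f]) auto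
    then show "closedin T ?K" by (simp add: top)
    fix \<tau> assume "\<tau> \<in> lower_p_central p G T (n - 1)"
    then have \<tau>: "\<tau> \<in> carrier G"
      using lower_p_central_normal[OF G] normal_imp_subgroup subgroup.subset by blast
    have "f (\<tau> [^]\<^bsub>G\<^esub> k) = int k * f \<tau> mod int p" for k :: nat
      by (induction k) (use \<tau> one hom in \<open>simp_all add: mod_simps algebra_simps\<close>)
    then show "\<tau> [^]\<^bsub>G\<^esub> p \<in> ?K" using \<tau> by simp
    fix \<sigma> assume \<sigma>: "\<sigma> \<in> carrier G"
    have "f (commutator G \<sigma> \<tau>) = ((f (inv\<^bsub>G\<^esub> \<sigma>) + f \<sigma>) + (f (inv\<^bsub>G\<^esub> \<tau>) + f \<tau>)) mod int p"
      using \<sigma> \<tau> by (simp add: commutator_def hom mod_simps algebra_simps)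
    also have "\<dots> = 0" using inv[OF \<sigma>] inv[OF \<tau>] by (metis mod_add_eq add_0 mod_0)
    finally show "commutator G \<sigma> \<tau> \<in> ?K" using \<sigma> \<tau> by simp
  qed
  then show ?thesis using \<nu> by blast
qed

text \<open>A proper suffix of a power of x is also a prefix of it, and no word is lexicographically
  smaller than its own prefix.\<close>

lemma lyndon_not_constant:
  assumes "lyndon w" "\<forall>y\<in>set w. y = x"
  shows "w = [x]"
proof -
  have w: "w = replicate (length w) x" using assms(2) by (simp add: replicate_eqI)
  have "w \<noteq> []" using assms(1) by (simp add: lyndon_def)
  then obtain k where k: "length w = Suc k" by (cases w) auto
  have "(replicate (Suc j) x, replicate j x) \<notin> lexord {(a, b). a < b}" for j by (induction j) auto
  moreover have "strict_suffix (replicate k x) w"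
    using w k by (metis replicate_Suc strict_suffix_def suffix_ConsI suffix_order.order_refl length_replicate n_not_Suc_n)
  ultimately have "replicate k x = []" using assms(1) w k unfolding lyndon_def by metis
  then show ?thesis using w k by simp
qed

text \<open>Here a, b, c are the central parts at g, h, gh, k is the value of the extension cocycle,
  and t is the constant by which the cochain is normalized.\<close>

lemma coboundary_mod:
  fixes a b c k t p :: int
  assumes "c = (a + b + k) mod p"
  shows "(k - t) mod p = (((- b - t) mod p - (- c - t) mod p) mod p + (- a - t) mod p) mod p"
proof -
  have "(((- b - t) mod p - (- c - t) mod p) mod p + (- a - t) mod p) mod p =
      ((- b - t) - (- c - t) + (- a - t)) mod p"
    by (simp only: mod_simps)
  also have "(- b - t) - (- c - t) + (- a - t) = c + (- a - b - t)" by simp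
  also have "\<dots> mod p = (a + b + k + (- a - b - t)) mod p"
    unfolding assms by (simp only: mod_simps)
  finally show ?thesis by simp
qed

text \<open>Adding a constant t to a cochain adds t to its coboundary, which makes up for the shift
  by -t.\<close>

lemma coboundary_mod_add:
  fixes a b c k t p :: int
  shows "(a - b + c + k) mod p =
    ((((a + t) mod p - (b + t) mod p) mod p + (c + t) mod p) mod p + (k - t) mod p) mod p"
proof -
  have "a - b + c + k = (a + t) - (b + t) + (c + t) + (k - t)" by simp
  then show ?thesis by (simp only: mod_simps)
qed

text \<open>The products zg tg, zh th and zgh tgh stand for \<rho> g, \<rho> h and \<rho> (g h): the
  factor by which the z-parts fail to be multiplicative is the extension cocycle of the section
  t.\<close>

lemma (in group) section_defect:
  assumes "zg \<in> carrier G" "tg \<in> carrier G" "zh \<in> carrier G" "th \<in> carrier G"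
    "zgh \<in> carrier G" "tgh \<in> carrier G"
    and comm: "zh \<otimes> tg = tg \<otimes> zh" and eq: "zgh \<otimes> tgh = (zg \<otimes> tg) \<otimes> (zh \<otimes> th)"
  shows "zgh = zg \<otimes> zh \<otimes> (tg \<otimes> th \<otimes> inv tgh)"
proof -
  have "zgh = (zgh \<otimes> tgh) \<otimes> inv tgh" using assms(1-6) by (simp add: m_assoc)
  also have "\<dots> = zg \<otimes> (tg \<otimes> zh) \<otimes> th \<otimes> inv tgh"
    unfolding eq using assms(1-6) by (simp add: m_assoc)
  also have "\<dots> = zg \<otimes> zh \<otimes> (tg \<otimes> th \<otimes> inv tgh)"
    unfolding comm[symmetric] using assms(1-6) by (simp add: m_assoc)
  finally show ?thesis .
qed

section \<open>The central extension pulled back to S\<close>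

locale magnus_p = F: magnus_free S T X \<iota> m + V: unitriangular_p m "length w'" p n
  for S :: "('a, 'b) monoid_scheme" and T :: "'a topology" and X :: "'x::linorder set" and \<iota> m
    and w' :: "'x list" and p n +
  assumes w': "w' \<in> lists X"
begin

abbreviation "N \<equiv> lower_p_central p S T n"
abbreviation "\<rho> \<equiv> F.rep w'"
notation V.mult_U (infixl "\<cdot>" 70)
abbreviation "mod_C A \<equiv> V.C #>\<^bsub>V.U\<^esub> A"
abbreviation "\<phi> \<equiv> centre_to_Fp p n (length w')"

lemma profinite: "profinite_group S T" and topological: "topological_group S T"
  using F.free unfolding free_profinite_group_def profinite_group_def by blast+

lemma N_normal: "N \<lhd> S" by (rule lower_p_central_normal[OF topological])

lemma residues_p: "residues (int p)" using V.p_gt_1 by unfold_locales simp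

lemma Fp_minus [simp]: "\<ominus>\<^bsub>Fp p\<^esub> a = (- a) mod int p"
  by (rule residues.res_neg_eq[OF residues_p])

lemma Fp_diff [simp]: "a \<ominus>\<^bsub>Fp p\<^esub> b = (a - b) mod int p"
  by (simp add: a_minus_def mod_simps)

sublocale Q: topological_quotient "Fp p" N S T
  using N_normal topological residues.abelian_group[OF residues_p]
  by (simp add: topological_quotient_def topological_quotient_axioms_def)

sublocale UQ: topological_quotient "Fp p" V.C V.U "discrete_topology (carrier V.U)"
  using V.centre_normal V.topological_group_discrete residues.abelian_group[OF residues_p]
  by (simp add: topological_quotient_def topological_quotient_axioms_def)

lemma rho_N: "\<nu> \<in> N \<Longrightarrow> \<rho> \<nu> \<in> V.C"
proof -
  have "\<rho> \<in> hom S V.U" using F.rep_hom[of w'] by (simp add: continuous_hom_def)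
  moreover have "1 \<le> n" using V.n by simp
  ultimately have "\<rho> ` N \<subseteq> V.C"
    by (rule lower_p_central_image[OF topological V.topological_group_discrete F.rep_continuous])
  then show "\<nu> \<in> N \<Longrightarrow> \<rho> \<nu> \<in> V.C" by blast
qed

lemma rho_hom: "group_hom S V.U \<rho>" by (rule F.rep_group_hom)

text \<open>The union collapses, since the images under \<rho> of elements of one coset of N differ
  by elements of C.\<close>

lemma rep_bar:
  assumes \<sigma>: "\<sigma> \<in> carrier S"
  shows "magnus_rep_bar p S T X \<iota> w' n (N #>\<^bsub>S\<^esub> \<sigma>) = mod_C (\<rho> \<sigma>)"
proof -
  interpret \<rho>: group_hom S V.U \<rho> by (rule rho_hom)
  have eq: "mod_C (magnus_rep (residue_ring m) S T X \<iota> w' \<tau>) = mod_C (\<rho> \<sigma>)"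
    if \<tau>: "\<tau> \<in> N #>\<^bsub>S\<^esub> \<sigma>" for \<tau>
  proof -
    have "\<exists>\<nu>\<in>N. \<tau> = \<nu> \<otimes>\<^bsub>S\<^esub> \<sigma>" using \<tau> unfolding r_coset_def by simp
    then obtain \<nu> where \<nu>: "\<nu> \<in> N" "\<tau> = \<nu> \<otimes>\<^bsub>S\<^esub> \<sigma>" by (rule bexE)
    have \<nu>S: "\<nu> \<in> carrier S" by (rule subsetD[OF Q.subset \<nu>(1)])
    have \<tau>S: "\<tau> \<in> carrier S" unfolding \<nu>(2) using \<nu>S \<sigma> by (rule F.S.m_closed)
    have "\<rho> \<tau> = \<rho> \<nu> \<cdot> \<rho> \<sigma>" unfolding \<nu>(2) using \<nu>S \<sigma> by (rule \<rho>.hom_mult)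
    then have "\<exists>c\<in>V.C. \<rho> \<tau> = c \<cdot> \<rho> \<sigma>" using rho_N[OF \<nu>(1)] by (rule bexI)
    then have "mod_C (\<rho> \<tau>) = mod_C (\<rho> \<sigma>)"
      unfolding UQ.coset_eq_iff[OF \<rho>.hom_closed[OF \<tau>S] \<rho>.hom_closed[OF \<sigma>]] .
    then show ?thesis unfolding F.magnus_rep_eq_rep[OF w' \<tau>S] .
  qed
  have \<sigma>N: "\<sigma> \<in> N #>\<^bsub>S\<^esub> \<sigma>" by (rule F.S.rcos_self[OF \<sigma> Q.is_subgroup])
  have "(\<Union>\<tau>\<in>N #>\<^bsub>S\<^esub> \<sigma>. mod_C (magnus_rep (residue_ring m) S T X \<iota> w' \<tau>)) =
      (\<Union>\<tau>\<in>N #>\<^bsub>S\<^esub> \<sigma>. mod_C (\<rho> \<sigma>))"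
    by (rule SUP_cong[OF refl eq])
  also have "\<dots> = mod_C (\<rho> \<sigma>)" by (rule cSUP_const) (use \<sigma>N in blast)
  finally show ?thesis unfolding magnus_rep_bar_def Let_def V.m_eq[symmetric] .
qed

text \<open>The sign reflects the conventions: the extension cocycle is z(gh) - z(g) - z(h) in
  additive notation, the coboundary of -z.\<close>

definition psi :: "'a \<Rightarrow> int" where
  "psi = (\<lambda>\<nu>\<in>N. (- \<phi> (\<rho> \<nu>)) mod int p)"

lemma psi_in: "psi \<in> H1_invariants (Fp p) S T N"
  unfolding H1_invariants_def continuous_hom_def
proof (intro CollectI conjI ballI)
  interpret \<rho>: group_hom S V.U \<rho> by (rule rho_hom)
  have NS: "\<nu> \<in> carrier S" if "\<nu> \<in> N" for \<nu> using that Q.subset by blast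
  show "psi \<in> extensional (carrier (S\<lparr>carrier := N\<rparr>))" by (simp add: psi_def)
  show "psi \<in> hom (S\<lparr>carrier := N\<rparr>) (add_monoid (Fp p))"
    unfolding hom_def
  proof (intro CollectI conjI ballI)
    show "psi \<in> carrier (S\<lparr>carrier := N\<rparr>) \<rightarrow> carrier (add_monoid (Fp p))"
      using V.p_gt_1 by (simp add: psi_def)
    fix \<sigma> \<tau> assume "\<sigma> \<in> carrier (S\<lparr>carrier := N\<rparr>)" "\<tau> \<in> carrier (S\<lparr>carrier := N\<rparr>)"
    then have N: "\<sigma> \<in> N" "\<tau> \<in> N" by auto
    then have "\<phi> (\<rho> (\<sigma> \<otimes>\<^bsub>S\<^esub> \<tau>)) = (\<phi> (\<rho> \<sigma>) + \<phi> (\<rho> \<tau>)) mod int p"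
      using V.centre_to_Fp_mult[OF rho_N rho_N] NS by simp
    then show "psi (\<sigma> \<otimes>\<^bsub>S\<lparr>carrier := N\<rparr>\<^esub> \<tau>) = psi \<sigma> \<otimes>\<^bsub>add_monoid (Fp p)\<^esub> psi \<tau>"
      using N Q.m_closed by (simp add: psi_def mod_simps algebra_simps)
  qed
  have "continuous_map (subtopology T N) (discrete_topology (carrier V.U)) \<rho>"
    using F.rep_continuous by (rule continuous_map_from_subtopology)
  moreover have "continuous_map (discrete_topology (carrier V.U)) (discrete_topology (carrier (Fp p)))
      (\<lambda>A. (- \<phi> A) mod int p)"
    using V.p_gt_1 by simp
  ultimately have "continuous_map (subtopology T N) (discrete_topology (carrier (Fp p)))
      ((\<lambda>A. (- \<phi> A) mod int p) \<circ> \<rho>)"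
    by (rule continuous_map_compose)
  then show "continuous_map (subtopology T N) (discrete_topology (carrier (Fp p))) psi"
    by (rule continuous_map_eq) (simp add: psi_def)
  fix \<sigma> \<tau> assume \<sigma>: "\<sigma> \<in> carrier S" and \<tau>: "\<tau> \<in> N"
  have "\<rho> (inv\<^bsub>S\<^esub> \<sigma> \<otimes>\<^bsub>S\<^esub> \<tau> \<otimes>\<^bsub>S\<^esub> \<sigma>) = inv\<^bsub>V.U\<^esub> (\<rho> \<sigma>) \<cdot> (\<rho> \<tau> \<cdot> \<rho> \<sigma>)"
    using \<sigma> NS[OF \<tau>] by (simp add: V.m_assoc)
  also have "\<dots> = \<rho> \<tau>"
    using V.centre_commute[OF rho_N[OF \<tau>], of "\<rho> \<sigma>"] \<sigma> NS[OF \<tau>] by simp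
  finally show "psi (inv\<^bsub>S\<^esub> \<sigma> \<otimes>\<^bsub>S\<^esub> \<tau> \<otimes>\<^bsub>S\<^esub> \<sigma>) = psi \<tau>"
    using Q.inv_op_closed1[OF \<sigma> \<tau>] \<tau> by (simp add: psi_def)
qed

text \<open>Write \<open>\<theta>\<close> for the section of \<open>U \<rightarrow> U/C\<close> and \<open>\<rho> g = z g \<theta> (C (\<rho> g))\<close>.  Then \<open>- z\<close> cobounds the
  pulled back cocycle, and differs from \<open>psi\<close> on \<open>N\<close> by the constant \<open>\<theta> C\<close>, which only changes the
  cocycle by a coboundary.\<close>

definition \<theta> :: "(nat \<times> nat \<Rightarrow> int) set \<Rightarrow> nat \<times> nat \<Rightarrow> int" where
  "\<theta> D = (SOME A. A \<in> D)"

lemma \<theta>_in: "A \<in> D \<Longrightarrow> \<theta> D \<in> D"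
  unfolding \<theta>_def using someI_ex[of "\<lambda>A. A \<in> D"] by blast

definition z :: "(nat \<times> nat \<Rightarrow> int) \<Rightarrow> (nat \<times> nat \<Rightarrow> int)" where
  "z A = A \<cdot> inv\<^bsub>V.U\<^esub> \<theta> (mod_C A)"

lemma section_coset:
  assumes A: "A \<in> carrier V.U"
  shows "\<theta> (mod_C A) \<in> carrier V.U" "z A \<in> V.C" "z A \<cdot> \<theta> (mod_C A) = A"
proof -
  have "\<theta> (mod_C A) \<in> mod_C A"
    using V.rcos_self[OF A UQ.is_subgroup] by (rule \<theta>_in)
  then obtain c where c: "c \<in> V.C" "\<theta> (mod_C A) = c \<cdot> A" unfolding r_coset_def by blast
  then have cU: "c \<in> carrier V.U" using UQ.subset by blast
  show th: "\<theta> (mod_C A) \<in> carrier V.U" using c cU A by simp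
  have "z A = inv\<^bsub>V.U\<^esub> c" unfolding z_def c(2) using cU A by (simp add: V.inv_mult_group)
  then show "z A \<in> V.C" using c(1) by simp
  show "z A \<cdot> \<theta> (mod_C A) = A" unfolding z_def using th A by (simp add: V.m_assoc)
qed

definition y :: "'a \<Rightarrow> int" where
  "y \<sigma> = (- \<phi> (z (\<rho> \<sigma>)) - \<phi> (\<theta> V.C)) mod int p"

lemma y_continuous: "continuous_map T (discrete_topology (carrier (Fp p))) y"
proof -
  have "continuous_map (discrete_topology (carrier V.U)) (discrete_topology (carrier (Fp p)))
      (\<lambda>A. (- \<phi> (z A) - \<phi> (\<theta> V.C)) mod int p)"
    using V.p_gt_1 by simp
  from continuous_map_compose[OF F.rep_continuous this] show ?thesis
    by (simp add: o_def y_def[abs_def])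
qed

lemma y_N:
  assumes \<nu>: "\<nu> \<in> N" shows "y \<nu> = psi \<nu>"
proof -
  have A: "\<rho> \<nu> \<in> carrier V.U" using rho_N[OF \<nu>] UQ.subset by blast
  have coset: "mod_C (\<rho> \<nu>) = V.C"
    using V.coset_join2[OF A UQ.is_subgroup rho_N[OF \<nu>]] .
  have "\<theta> V.C \<in> V.C" using rho_N[OF \<nu>] by (rule \<theta>_in)
  moreover have "z (\<rho> \<nu>) \<in> V.C" "z (\<rho> \<nu>) \<cdot> \<theta> V.C = \<rho> \<nu>" using section_coset[OF A] unfolding coset by blast+
  ultimately have "\<phi> (\<rho> \<nu>) = (\<phi> (z (\<rho> \<nu>)) + \<phi> (\<theta> V.C)) mod int p"
    using V.centre_to_Fp_mult[of "z (\<rho> \<nu>)" "\<theta> V.C"] by simp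
  then show ?thesis using \<nu> by (simp add: y_def psi_def mod_simps algebra_simps)
qed

definition c0 where
  "c0 = (\<lambda>(g, h) \<in> carrier UQ.K \<times> carrier UQ.K.
     \<phi> (\<theta> g \<cdot> \<theta> h \<cdot> inv\<^bsub>V.U\<^esub> \<theta> (g \<otimes>\<^bsub>UQ.K\<^esub> h)))"

text \<open>Decomposing \<rho> g, \<rho> h and \<rho> (g h) into central part and section value,
  \<open>section_defect\<close> exhibits c0 as the coboundary of the negative central part; the
  normalizing constant gives the shift.\<close>

lemma c0_rho:
  assumes g: "g \<in> carrier S" and h: "h \<in> carrier S"
  shows "(c0 (mod_C (\<rho> g), mod_C (\<rho> h)) - \<phi> (\<theta> V.C)) mod int p =
      coboundary (Fp p) S y (g, h)"
    and "c0 (mod_C (\<rho> g), mod_C (\<rho> h)) \<in> carrier (Fp p)"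
proof -
  interpret \<rho>: group_hom S V.U \<rho> by (rule rho_hom)
  let ?t = "\<lambda>g. \<theta> (mod_C (\<rho> g))" and ?z = "\<lambda>g. z (\<rho> g)"
  have gh: "g \<otimes>\<^bsub>S\<^esub> h \<in> carrier S" using g h by simp
  note sec = section_coset[OF \<rho>.hom_closed[OF g]] section_coset[OF \<rho>.hom_closed[OF h]] section_coset[OF \<rho>.hom_closed[OF gh]]
  have zU: "?z g \<in> carrier V.U" "?z h \<in> carrier V.U" "?z (g \<otimes>\<^bsub>S\<^esub> h) \<in> carrier V.U"
    using sec UQ.subset by blast+
  let ?k = "?t g \<cdot> ?t h \<cdot> inv\<^bsub>V.U\<^esub> ?t (g \<otimes>\<^bsub>S\<^esub> h)"
  have kU: "?k \<in> carrier V.U" using sec by simp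
  have c0: "c0 (mod_C (\<rho> g), mod_C (\<rho> h)) = \<phi> ?k"
    using g h by (simp add: c0_def UQ.coset_mult)
  have "?z (g \<otimes>\<^bsub>S\<^esub> h) \<cdot> ?t (g \<otimes>\<^bsub>S\<^esub> h) = (?z g \<cdot> ?t g) \<cdot> (?z h \<cdot> ?t h)"
    unfolding sec(3) sec(6) sec(9) using g h by (rule \<rho>.hom_mult)
  from V.section_defect[OF zU(1) sec(1) zU(2) sec(4) zU(3) sec(7) V.centre_commute[OF sec(5) sec(1)] this]
  have eq: "?z (g \<otimes>\<^bsub>S\<^esub> h) = ?z g \<cdot> ?z h \<cdot> ?k" .
  have zz: "?z g \<cdot> ?z h \<in> V.C" using sec UQ.m_closed by blast
  \<comment> \<open>The defect lies in C because the three central parts do.\<close>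
  have "?k = inv\<^bsub>V.U\<^esub> (?z g \<cdot> ?z h) \<cdot> ?z (g \<otimes>\<^bsub>S\<^esub> h)"
    unfolding eq by (rule V.inv_cancel_left(1)[OF _ kU, symmetric]) (use zU in simp)
  then have kC: "?k \<in> V.C" using UQ.m_closed[OF UQ.m_inv_closed[OF zz] sec(8)] by simp
  then show "c0 (mod_C (\<rho> g), mod_C (\<rho> h)) \<in> carrier (Fp p)"
    unfolding c0 by (rule V.centre_to_Fp_in)
  have dy: "coboundary (Fp p) S y (g, h) = ((y h - y (g \<otimes>\<^bsub>S\<^esub> h)) mod int p + y g) mod int p"
    using g h by (simp add: coboundary_def del: \<rho>.hom_mult)
  have "\<phi> (?z (g \<otimes>\<^bsub>S\<^esub> h)) = (\<phi> (?z g) + \<phi> (?z h) + \<phi> ?k) mod int p"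
    unfolding eq using V.centre_to_Fp_mult[OF zz kC] V.centre_to_Fp_mult[OF sec(2,5)]
    by (simp add: mod_simps)
  then show "(c0 (mod_C (\<rho> g), mod_C (\<rho> h)) - \<phi> (\<theta> V.C)) mod int p =
      coboundary (Fp p) S y (g, h)"
    unfolding c0 dy y_def by (rule coboundary_mod)
qed

definition c1 where
  "c1 = (\<lambda>(A, B) \<in> carrier Q.K \<times> carrier Q.K.
     (c0 (magnus_rep_bar p S T X \<iota> w' n A, magnus_rep_bar p S T X \<iota> w' n B) - \<phi> (\<theta> V.C)) mod int p)"

lemma c1_coset:
  assumes "g \<in> carrier S" "h \<in> carrier S"
  shows "c1 (N #>\<^bsub>S\<^esub> g, N #>\<^bsub>S\<^esub> h) = coboundary (Fp p) S y (g, h)"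
proof -
  have "c1 (N #>\<^bsub>S\<^esub> g, N #>\<^bsub>S\<^esub> h) =
      (c0 (mod_C (\<rho> g), mod_C (\<rho> h)) - \<phi> (\<theta> V.C)) mod int p"
    using assms by (simp add: c1_def rep_bar)
  then show ?thesis using c0_rho(1)[OF assms] by (rule trans)
qed

lemma c1_extensional: "c1 \<in> extensional (carrier Q.K \<times> carrier Q.K)"
  by (simp add: c1_def)

lemma transgression_psi:
  "transgression (Fp p) S T N psi = H2_class (Fp p) Q.K Q.Q c1"
proof (rule Q.transgression_eq)
  show "continuous_map T Q.D y" by (rule y_continuous)
  show "\<And>\<tau>. \<tau> \<in> N \<Longrightarrow> y \<tau> = psi \<tau>" by (rule y_N)
  show "c1 \<in> extensional (carrier Q.K \<times> carrier Q.K)" by (rule c1_extensional)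
  show "\<And>g h. g \<in> carrier S \<Longrightarrow> h \<in> carrier S \<Longrightarrow> c1 (N #>\<^bsub>S\<^esub> g, N #>\<^bsub>S\<^esub> h) = coboundary (Fp p) S y (g, h)"
    by (rule c1_coset)
qed

text \<open>Each representative of \<open>omega\<close> is c0 changed by the coboundary of some b on
  U/C, and its pullback differs from c1 by the coboundary of B. So all members of the union in
  \<open>H2_pullback\<close> are the class of c1.\<close>

lemma alpha_class_eq:
  "alpha_class p S T X \<iota> w' n = transgression (Fp p) S T N psi"
proof -
  interpret \<rho>: group_hom S V.U \<rho> by (rule rho_hom)
  let ?bar = "magnus_rep_bar p S T X \<iota> w' n"
  let ?pull = "\<lambda>c. \<lambda>(g, h) \<in> carrier Q.K \<times> carrier Q.K. c (?bar g, ?bar h)"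
  let ?\<omega> = "H2_class (Fp p) UQ.K UQ.Q c0"
  have omega: "omega p n (length w') = ?\<omega>"
    unfolding omega_def Let_def c0_def \<theta>_def V.m_eq[symmetric] ..
  have tC: "\<phi> (\<theta> V.C) \<in> carrier (Fp p)"
    using subgroup.one_closed[OF UQ.is_subgroup] by (intro V.centre_to_Fp_in) (rule \<theta>_in)
  have pull: "H2_class (Fp p) Q.K Q.Q (?pull c) = H2_class (Fp p) Q.K Q.Q c1" if c: "c \<in> ?\<omega>" for c
  proof -
    obtain b where b: "continuous_map UQ.Q UQ.D b" and
      c: "c = coboundary (Fp p) UQ.K b \<otimes>\<^bsub>cocycle_group (Fp p) UQ.K UQ.Q\<^esub> c0"
      using c unfolding H2_class_def r_coset_def coboundaries2_def by blast
    \<comment> \<open>The coboundary of a constant cochain is that constant; adding \<phi> (\<theta>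
      C) to b compensates the shift in c1.\<close>
    define B where "B A = (b (?bar A) + \<phi> (\<theta> V.C)) mod int p" for A
    note b_in = UQ.continuous_map_quotient_in[OF b]
    have "continuous_map (discrete_topology (carrier V.U)) UQ.D
        (\<lambda>A. (b (mod_C A) + \<phi> (\<theta> V.C)) mod int p)"
      using V.p_gt_1 by simp
    from continuous_map_compose[OF F.rep_continuous this]
    have "continuous_map T Q.D (\<lambda>\<sigma>. B (N #>\<^bsub>S\<^esub> \<sigma>))"
      by (rule continuous_map_eq) (simp add: B_def rep_bar F.S_top)
    then have B: "continuous_map Q.Q Q.D B" by (rule Q.continuous_map_from_quotient)
    show ?thesis
    proof (rule Q.H2_class_eqI[OF Q.cocycle_of_coboundary[OF y_continuous c1_extensional c1_coset] B])
      show "?pull c \<in> extensional (carrier Q.K \<times> carrier Q.K)" by simp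
      fix g h assume g: "g \<in> carrier S" and h: "h \<in> carrier S"
      have gh: "g \<otimes>\<^bsub>S\<^esub> h \<in> carrier S" using g h by simp
      have c1: "c1 (N #>\<^bsub>S\<^esub> g, N #>\<^bsub>S\<^esub> h) =
          (c0 (mod_C (\<rho> g), mod_C (\<rho> h)) - \<phi> (\<theta> V.C)) mod int p"
        using g h by (simp add: c1_def rep_bar)
      let ?b = "\<lambda>g. b (mod_C (\<rho> g))"
      have "?pull c (N #>\<^bsub>S\<^esub> g, N #>\<^bsub>S\<^esub> h) =
          (?b h - ?b (g \<otimes>\<^bsub>S\<^esub> h) + ?b g + c0 (mod_C (\<rho> g), mod_C (\<rho> h))) mod int p"
        using g h by (simp add: rep_bar c cocycle_group_def coboundary_def UQ.coset_mult mod_simps)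
      also have "\<dots> = (B (N #>\<^bsub>S\<^esub> h) \<ominus>\<^bsub>Fp p\<^esub> B (N #>\<^bsub>S\<^esub> (g \<otimes>\<^bsub>S\<^esub> h)) \<oplus>\<^bsub>Fp p\<^esub> B (N #>\<^bsub>S\<^esub> g))
          \<oplus>\<^bsub>Fp p\<^esub> c1 (N #>\<^bsub>S\<^esub> g, N #>\<^bsub>S\<^esub> h)"
        unfolding B_def rep_bar[OF g] rep_bar[OF h] rep_bar[OF gh] c1 Fp_diff residue_ring_simps
        by (rule coboundary_mod_add)
      finally show "?pull c (N #>\<^bsub>S\<^esub> g, N #>\<^bsub>S\<^esub> h) =
          (B (N #>\<^bsub>S\<^esub> h) \<ominus>\<^bsub>Fp p\<^esub> B (N #>\<^bsub>S\<^esub> (g \<otimes>\<^bsub>S\<^esub> h)) \<oplus>\<^bsub>Fp p\<^esub> B (N #>\<^bsub>S\<^esub> g))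
          \<oplus>\<^bsub>Fp p\<^esub> c1 (N #>\<^bsub>S\<^esub> g, N #>\<^bsub>S\<^esub> h)" .
    qed
  qed
  have "?\<omega> \<noteq> {}"
    using subgroup.one_closed[OF UQ.coboundaries_subgroup] unfolding H2_class_def r_coset_def by blast
  then have "(\<Union>c\<in>?\<omega>. H2_class (Fp p) Q.K Q.Q (?pull c)) = H2_class (Fp p) Q.K Q.Q c1"
    using pull by blast
  then show ?thesis
    unfolding alpha_class_def Let_def H2_pullback_def omega transgression_psi .
qed

text \<open>Injectivity makes \<open>psi\<close> the inverse image of the class, and the minus sign
  of the pairing undoes the one in \<open>psi\<close>.\<close>

lemma transgression_pairing_alpha:
  assumes \<sigma>: "\<sigma> \<in> N"
  shows "transgression_pairing p S T n \<sigma> (alpha_class p S T X \<iota> w' n) = \<phi> (\<rho> \<sigma>)"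
proof -
  have "inj_on (transgression (Fp p) S T N) (H1_invariants (Fp p) S T N)"
  proof (rule Q.inj_on_transgression[OF profinite])
    fix f \<nu> assume "continuous_map T Q.D f" "\<nu> \<in> N"
      and "\<And>g h. g \<in> carrier S \<Longrightarrow> h \<in> carrier S \<Longrightarrow> f (g \<otimes>\<^bsub>S\<^esub> h) = f g \<oplus>\<^bsub>Fp p\<^esub> f h"
    then show "f \<nu> = \<zero>\<^bsub>Fp p\<^esub>"
      using hom_to_Fp_vanishes[OF topological V.p_gt_1 V.n] by simp
  qed
  then have "the_inv_into (H1_invariants (Fp p) S T N) (transgression (Fp p) S T N)
      (alpha_class p S T X \<iota> w' n) = psi"
    unfolding alpha_class_eq using psi_in by (rule the_inv_into_f_f)
  then have "transgression_pairing p S T n \<sigma> (alpha_class p S T X \<iota> w' n) = (- psi \<sigma>) mod int p"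
    unfolding transgression_pairing_def Let_def by simp
  also have "\<dots> = \<phi> (\<rho> \<sigma>) mod int p" using \<sigma> by (simp add: psi_def mod_simps)
  also have "\<dots> = \<phi> (\<rho> \<sigma>)" using V.centre_to_Fp_in[OF rho_N[OF \<sigma>]] by simp
  finally show ?thesis .
qed

section \<open>Magnus coefficients of powers of basic commutators\<close>

lemma subword_append:
  "1 \<le> i \<Longrightarrow> i \<le> k \<Longrightarrow> k \<le> j \<Longrightarrow> j \<le> length v + 1 \<Longrightarrow> subword i j v = subword i k v @ subword k j v"
  using take_subword[of i k j v] drop_subword[of i k j v] by (metis append_take_drop_id)

text \<open>The lowest degree part of \<open>\<tau>\<^sub>u - 1\<close> is homogeneous of degree \<open>|u|\<close>, and involves only
  permutations of \<open>u\<close>.\<close>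

definition commutator_pattern :: "'x list \<Rightarrow> nat \<Rightarrow> nat \<Rightarrow> int" where
  "commutator_pattern u i j =
     (if j - i < length u \<or> j - i = length u \<and> mset (subword i j w') \<noteq> mset u then m else 1)"

text \<open>If neither factor is forced to vanish, the two pieces have lengths at least |u| and |v|.
  When j - i \<le> |w|, both lengths are then exact, the contents match, and they add up to that of
  w.\<close>

lemma commutator_pattern_mult:
  assumes u: "u @ v = w \<or> v @ u = w" and ik: "1 \<le> i" "i < k" "k < j" "j \<le> length w' + 1"
  shows "commutator_pattern w i j dvd commutator_pattern u i k * commutator_pattern v k j"
proof (rule ccontr)
  assume *: "\<not> ?thesis"
  then have w: "j - i < length w \<or> j - i = length w \<and> mset (subword i j w') \<noteq> mset w"
    by (auto simp: commutator_pattern_def split: if_splits)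
  have "\<not> (k - i < length u \<or> k - i = length u \<and> mset (subword i k w') \<noteq> mset u)"
    "\<not> (j - k < length v \<or> j - k = length v \<and> mset (subword k j w') \<noteq> mset v)"
    using * by (auto simp: commutator_pattern_def split: if_splits)
  moreover have len: "length w = length u + length v" and ms: "mset w = mset u + mset v"
    using u by auto
  ultimately have "k - i = length u" "j - k = length v" "j - i = length w"
      "mset (subword i k w') = mset u" "mset (subword k j w') = mset v"
    using w ik by linarith+
  then have "mset (subword i j w') = mset w"
    using subword_append[of i k j w'] ik ms by simp
  then show False using w \<open>j - i = length w\<close> by simp
qed

text \<open>In a b - b a the words uv and vu occur, which have the same content; so
  \<open>commutator_pattern_mult\<close> is applied in both orders.\<close>

lemma lyndon_commutator_rep:
  assumes "u \<noteq> []" "set u \<subseteq> X"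
  shows "lyndon_commutator S \<iota> u \<in> carrier S \<and>
    (\<forall>i j. 1 \<le> i \<longrightarrow> i < j \<longrightarrow> j \<le> length w' + 1 \<longrightarrow>
      commutator_pattern u i j dvd \<rho> (lyndon_commutator S \<iota> u) (i, j))"
  using assms
proof (induction u rule: word_induct_std_factorization)
  case (single x)
  then have x: "x \<in> X" by simp
  have "commutator_pattern [x] i j dvd F.gen w' x (i, j)" if ij: "1 \<le> i" "i < j" "j \<le> length w' + 1" for i j
  proof (cases "j = i + 1 \<and> w' ! (i - 1) = x")
    case True
    then have "subword i j w' = [x]"
      using ij length_subword[of i j w'] nth_subword[of i j w' 0] by (cases "subword i j w'") auto
    then show ?thesis using True by (simp add: commutator_pattern_def)
  next
    case False
    then show ?thesis using ij by (auto simp: F.gen_def)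
  qed
  then show ?case using F.\<iota>_in[OF x] F.rep_gen[OF x] by (simp add: lyndon_commutator_singleton)
next
  case (factors w)
  interpret \<rho>: group_hom S V.U \<rho> by (rule rho_hom)
  let ?u = "std_left w" and ?v = "std_right w"
  note std = std_factorization(1)[OF \<open>2 \<le> length w\<close>]
  have sub: "set ?u \<subseteq> X" "set ?v \<subseteq> X"
    using factors.prems std by (metis set_append Un_subset_iff)+
  let ?A = "lyndon_commutator S \<iota> ?u" and ?B = "lyndon_commutator S \<iota> ?v"
  note IH = factors.IH(1)[OF sub(1)] factors.IH(2)[OF sub(2)]
  then have AB: "?A \<in> carrier S" "?B \<in> carrier S" by blast+
  have w: "lyndon_commutator S \<iota> w = commutator S ?A ?B"
    by (rule lyndon_commutator_factors[OF \<open>2 \<le> length w\<close>])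
  have \<rho>w: "\<rho> (commutator S ?A ?B) = commutator V.U (\<rho> ?A) (\<rho> ?B)"
    using AB by (simp add: commutator_def)
  have "commutator_pattern w i j dvd commutator V.U (\<rho> ?A) (\<rho> ?B) (i, j)"
    if ij: "1 \<le> i" "i < j" "j \<le> length w' + 1" for i j
  proof (rule V.commutator_entry_dvd[where f = "commutator_pattern ?u" and g = "commutator_pattern ?v"])
    show "commutator_pattern w i j dvd m" for i j by (simp add: commutator_pattern_def)
    fix i k j :: nat assume ik: "1 \<le> i" "i < k" "k < j" "j \<le> length w' + 1"
    show "commutator_pattern w i j dvd commutator_pattern ?u i k * commutator_pattern ?v k j"
      by (rule commutator_pattern_mult) (use std ik in auto)
    show "commutator_pattern w i j dvd commutator_pattern ?v i k * commutator_pattern ?u k j"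
      by (rule commutator_pattern_mult) (use std ik in auto)
    \<comment> \<open>If the entry (i, j) is constrained at all, then j - i \<le> |w|, so (k, j) is
      below the lowest degree and its pattern is m.\<close>
    have "j - k < j - i" using ik by linarith
    then show "commutator_pattern w i j dvd commutator_pattern w k j"
      by (auto simp: commutator_pattern_def)
  qed (use IH AB ij in auto)
  then show ?case unfolding w \<rho>w using AB by simp
qed

text \<open>The divisibility of the coefficients of \<open>\<tau>\<^sub>u^(p^r)\<close>: those of degree \<open>|u| + e\<close> are divisible by
  \<open>p^(r - e + 1)\<close> if \<open>e > 0\<close>, and by \<open>p^r\<close> if \<open>e = 0\<close>.\<close>

definition power_pattern :: "'x list \<Rightarrow> nat \<Rightarrow> nat \<Rightarrow> nat \<Rightarrow> int" where
  "power_pattern u r i j =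
     (if j - i < length u \<or> j - i = length u \<and> mset (subword i j w') \<noteq> mset u then m
      else if j - i = length u then V.q r
      else V.q (r + 1 - (j - i - length u)))"

text \<open>One p-th power at a time. The linear term gains a factor p. A product of entries in
  degrees |u| + e1 and |u| + e2 sits at e = |u| + e1 + e2 \<ge> e1 + 2 and has exponent at least r -
  e1 \<ge> r + 2 - e, as wanted for r + 1. This is where |u| \<ge> 2 enters.\<close>

lemma power_pattern_dvd:
  assumes A: "A \<in> carrier V.U" and u: "2 \<le> length u"
    and pat: "\<And>i j. 1 \<le> i \<Longrightarrow> i < j \<Longrightarrow> j \<le> length w' + 1 \<Longrightarrow> commutator_pattern u i j dvd A (i, j)"
    and ij: "1 \<le> i" "i < j" "j \<le> length w' + 1"
  shows "power_pattern u r i j dvd (A [^]\<^bsub>V.U\<^esub> (p ^ r)) (i, j)"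
  using ij
proof (induction r arbitrary: i j)
  case 0
  have "power_pattern u 0 i j dvd commutator_pattern u i j"
    by (auto simp: power_pattern_def commutator_pattern_def)
  then show ?case using pat[OF 0] A dvd_trans by simp
next
  case (Suc r)
  let ?B = "A [^]\<^bsub>V.U\<^esub> (p ^ r)"
  have B: "?B \<in> carrier V.U" using A by simp
  \<comment> \<open>Products of two entries vanish below degree 2 |u|; from there on the exponent is
    the one wanted for \<open>Suc r\<close>.\<close>
  define g where "g i j = (if j - i < 2 * length u then m else V.q (r + 2 - (j - i - length u)))" for i j :: nat
  have small: "power_pattern u r i j = m" if "j - i < length u" for i j
    using that by (simp add: power_pattern_def)
  \<comment> \<open>The bound r - e covers both e = 0, with exponent r, and e > 0, with exponent r -
    e + 1.\<close>
  have q_pat: "V.q (r - (j - i - length u)) dvd power_pattern u r i j" if "length u \<le> j - i" for i j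
    using that V.q_dvd V.q_mono by (auto simp: power_pattern_def)
  have g_m: "g i j dvd m" for i j using V.q_dvd by (simp add: g_def)
  have "g i j dvd (?B [^]\<^bsub>V.U\<^esub> p) (i, j) - int p * ?B (i, j)"
  proof (rule V.pow_entry_dvd[OF B Suc.IH g_m])
    fix i k j :: nat assume ik: "1 \<le> i" "i < k" "k < j" "j \<le> length w' + 1"
    show "g i j dvd power_pattern u r i k * power_pattern u r k j"
    proof (cases "k - i < length u \<or> j - k < length u")
      case True
      then show ?thesis using small g_m by auto
    next
      case False
      then have "\<not> j - i < 2 * length u" using ik by linarith
      then have "g i j = V.q (r + 2 - (j - i - length u))" by (simp add: g_def)
      also have "\<dots> dvd V.q (r - (k - i - length u))"
        using False u ik by (intro V.q_mono) linarith
      also have "\<dots> dvd power_pattern u r i k" using False by (intro q_pat) simp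
      finally show ?thesis by (rule dvd_mult2)
    qed
    show "g i j dvd g i k * power_pattern u r k j"
    proof (cases "k - i < 2 * length u \<or> j - k < length u")
      case True
      then have "g i k = m \<or> power_pattern u r k j = m" using small by (auto simp: g_def)
      then show ?thesis using g_m by auto
    next
      case False
      then have "\<not> j - i < 2 * length u" using ik by linarith
      then have "g i j = V.q (r + 2 - (j - i - length u))" by (simp add: g_def)
      also have "\<dots> dvd V.q (r + 2 - (k - i - length u))" using ik by (intro V.q_mono) linarith
      also have "\<dots> = g i k" using False by (simp add: g_def)
      finally show ?thesis by (rule dvd_mult2)
    qed
  qed (use Suc.prems in auto)
  moreover have "power_pattern u (Suc r) i j dvd g i j"
    using V.q_dvd u by (auto simp: power_pattern_def g_def)
  ultimately have "power_pattern u (Suc r) i j dvd (?B [^]\<^bsub>V.U\<^esub> p) (i, j) - int p * ?B (i, j)"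
    using dvd_trans by blast
  moreover have "power_pattern u (Suc r) i j dvd int p * ?B (i, j)"
  proof -
    have "power_pattern u (Suc r) i j dvd int p * power_pattern u r i j"
    \<comment> \<open>For e > r + 1 the truncated exponents are 0 and nothing is claimed.\<close>
    proof (cases "r + 1 < j - i - length u")
      case False
      then have "Suc r + 1 - (j - i - length u) = Suc (r + 1 - (j - i - length u))" by linarith
      then show ?thesis using V.q_Suc by (auto simp: power_pattern_def)
    qed (auto simp: power_pattern_def)
    moreover have "int p * power_pattern u r i j dvd int p * ?B (i, j)"
      using Suc.IH[OF Suc.prems] by (intro mult_dvd_mono) auto
    ultimately show ?thesis by (rule dvd_trans)
  qed
  ultimately have "power_pattern u (Suc r) i j dvd (?B [^]\<^bsub>V.U\<^esub> p) (i, j)"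
    by (metis dvd_add diff_add_cancel)
  then show ?case using A by (simp add: V.nat_pow_pow mult.commute)
qed

lemma rho_sigma_element:
  assumes w: "w \<in> lists X" "lyndon w" "length w \<le> n" and lw': "lyndon w'" and ne: "mset w \<noteq> mset w'"
  shows "\<rho> (sigma_element p S \<iota> w n) (1, length w' + 1) = 0"
proof -
  interpret \<rho>: group_hom S V.U \<rho> by (rule rho_hom)
  have "w \<noteq> []" using w by (simp add: lyndon_def)
  have wX: "set w \<subseteq> X" using w(1) by auto
  let ?t = "lyndon_commutator S \<iota> w"
  let ?N = "p ^ (n - length w)"
  note t = lyndon_commutator_rep[OF \<open>w \<noteq> []\<close> wX]
  then have tS: "?t \<in> carrier S" by blast
  have \<rho>\<sigma>: "\<rho> (sigma_element p S \<iota> w n) = \<rho> ?t [^]\<^bsub>V.U\<^esub> ?N"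
    unfolding sigma_element_def using tS by (simp add: \<rho>.hom_nat_pow)
  have PU: "\<rho> ?t [^]\<^bsub>V.U\<^esub> ?N \<in> carrier V.U" using tS by simp
  have s: "1 \<le> length w'" by (rule V.s(1))
  have "m dvd (\<rho> ?t [^]\<^bsub>V.U\<^esub> ?N) (1, length w' + 1)"
  proof (cases "length w = 1")
    case True
    then obtain x where x: "w = [x]" by (cases w) auto
    have xX: "x \<in> X" using wX x by simp
    \<comment> \<open>Series in x alone, in terms of entries: those whose word contains another
      letter vanish. This is a subgroup condition, hence stable under all powers.\<close>
    define f where "f i j = (if set (subword i j w') \<subseteq> {x} then 1 else m)" for i j
    let ?H = "{A \<in> carrier V.U. \<forall>i j. 1 \<le> i \<longrightarrow> i < j \<longrightarrow> j \<le> length w' + 1 \<longrightarrow> f i j dvd A (i, j)}"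
    have H: "subgroup ?H V.U"
    proof (rule V.subgroup_dvd)
      show "f i j dvd m" for i j by (simp add: f_def)
      fix i k j :: nat assume ik: "1 \<le> i" "i < k" "k < j" "j \<le> length w' + 1"
      then have "set (subword i j w') = set (subword i k w') \<union> set (subword k j w')"
        using subword_append[of i k j w'] by simp
      then show "f i j dvd f i k * f k j" by (auto simp: f_def)
    qed
    have "f i j dvd F.gen w' x (i, j)" if ij: "1 \<le> i" "i < j" "j \<le> length w' + 1" for i j
    proof (cases "j = i + 1 \<and> w' ! (i - 1) = x")
      case True
      then have "subword i j w' = [x]"
        using ij length_subword[of i j w'] nth_subword[of i j w' 0] by (cases "subword i j w'") auto
      then show ?thesis by (simp add: f_def)
    next
      case False
      then show ?thesis using ij by (auto simp: F.gen_def)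
    qed
    then have "\<rho> ?t \<in> ?H"
      using F.gen_in F.rep_gen[OF xX] unfolding x lyndon_commutator_singleton by simp
    then have "\<rho> ?t [^]\<^bsub>V.U\<^esub> k \<in> ?H" for k :: nat
      by (induction k) (use subgroup.one_closed[OF H] subgroup.m_closed[OF H] in auto)
    from this[of ?N] have "\<forall>i j. 1 \<le> i \<longrightarrow> i < j \<longrightarrow> j \<le> length w' + 1 \<longrightarrow>
        f i j dvd (\<rho> ?t [^]\<^bsub>V.U\<^esub> ?N) (i, j)" by blast
    from this[rule_format, of 1 "length w' + 1"]
    have "f 1 (length w' + 1) dvd (\<rho> ?t [^]\<^bsub>V.U\<^esub> ?N) (1, length w' + 1)"
      using V.s(1) by fastforce
    moreover have "\<not> set w' \<subseteq> {x}"
      using lyndon_not_constant[OF lw', of x] ne x by auto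
    ultimately show ?thesis by (simp only: f_def subword_full if_False)
  next
    case False
    moreover have "length w \<noteq> 0" using \<open>w \<noteq> []\<close> by simp
    ultimately have "2 \<le> length w" by linarith
    then have "power_pattern w (n - length w) 1 (length w' + 1) dvd (\<rho> ?t [^]\<^bsub>V.U\<^esub> ?N) (1, length w' + 1)"
      using t tS s by (intro power_pattern_dvd) auto
    moreover have "power_pattern w (n - length w) 1 (length w' + 1) = m"
    proof (cases "length w < length w'")
      case True
      \<comment> \<open>With r = n - |w| and e = |w'| - |w| the exponent r - e + 1 equals n - |w'| +
        1, exactly that of m.\<close>
      then have "n - length w' < n - length w + 1 - (length w' - length w)"
        using w(3) V.s by linarith
      then show ?thesis using True V.q_large by (simp add: power_pattern_def)
    next
      case False
      \<comment> \<open>If |w'| < |w| the coefficient is below the lowest degree; if |w'| = |w| the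
        contents differ.\<close>
      then show ?thesis using ne subword_full[of w'] by (auto simp: power_pattern_def)
    qed
    ultimately show ?thesis by simp
  qed
  moreover have "0 \<le> (\<rho> ?t [^]\<^bsub>V.U\<^esub> ?N) (1, length w' + 1)" "(\<rho> ?t [^]\<^bsub>V.U\<^esub> ?N) (1, length w' + 1) < m"
    using V.entry(3,4)[OF PU, of 1 "length w' + 1"] by auto
  ultimately show ?thesis unfolding \<rho>\<sigma> using zdvd_not_zless by (metis order_le_less)
qed

end

theorem theoremA:
  fixes p n :: nat
    and X :: "'x::linorder set"
    and S :: "('a, 'b) monoid_scheme"
    and T :: "'a topology"
    and \<iota> :: "'x \<Rightarrow> 'a"
    and w w' :: "'x list"
  assumes "prime p" and "2 \<le> n"
    and "finite X" and "X \<noteq> {}"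
    and "free_profinite_group S T X \<iota>"
    and "w \<in> lists X" and "lyndon w" and "length w \<le> n"
    and "w' \<in> lists X" and "lyndon w'" and "length w' \<le> n"
    and "mset w \<noteq> mset w'"
  shows "transgression_pairing p S T n (sigma_element p S \<iota> w n) (alpha_class p S T X \<iota> w' n) = \<zero>\<^bsub>Fp p\<^esub>"
proof -
  have p: "1 < p" using assms(1) by (rule prime_gt_1_nat)
  have ne: "w \<noteq> []" "w' \<noteq> []" using assms(7,10) by (simp_all add: lyndon_def)
  define m where "m = int (p ^ (n - length w' + 1))"
  have "1 < p ^ (n - length w' + 1)" using p by (intro one_less_power) auto
  then have m: "1 < m" unfolding m_def by linarith
  interpret magnus_p S T X \<iota> m w' p n
  proof unfold_locales
    show "1 \<le> length w'" using ne(2) by (cases w') auto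
  qed (use assms m m_def in auto)
  let ?\<sigma> = "sigma_element p S \<iota> w n"
  have \<sigma>: "?\<sigma> \<in> N"
    using ne(1) assms(6,8) F.\<iota>_in
    by (intro sigma_element_in_lower_p_central[OF topological, of _ X]) auto
  have "transgression_pairing p S T n ?\<sigma> (alpha_class p S T X \<iota> w' n) = \<phi> (\<rho> ?\<sigma>)"
    by (rule transgression_pairing_alpha[OF \<sigma>])
  also have "\<dots> = 0"
    by (rule V.centre_to_Fp_zero[OF rho_N[OF \<sigma>]]) (rule rho_sigma_element[OF assms(6-8,10,12)])
  finally show ?thesis by simp
qed

end
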